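(* Suppose that the standing assumptions on $b,f,g$ stated in the context hold. Let $u(\cdot)\in L^2$, with corresponding state $x(\cdot)$ and adjoint $p(\cdot)$, let $v(\cdot)\in L^2$, and let $y(\cdot)$ and $\psi(\cdot)$ be the state variation and adjoint variation at $u(\cdot)$ in the direction $v(\cdot)$. Then the following assertions hold. (i) $J:L^2\to\mathbb{R}$ is twice G\^ateaux differentiable, and its second derivative $J''(u(\cdot))\in\mathbb{L}(L^2)$ is given by $$(J''(u(\cdot))v(\cdot))(t)=H_{ux}[t]\,y(t)+H_{uu}[t]\,v(t)+b_u[t]^\top\psi(t)\quad\text{for a.e. } t\in[0,T].$$ (ii) For any $w(\cdot)\in L^2$, let $y_w(\cdot)$ be the state variation at $u(\cdot)$ in the direction $w(\cdot)$. Then $$\langle J''(u(\cdot))v,w\rangle_{L^2}=\int_0^T\begin{pmatrix}y_w(t)\\ w(t)\end{pmatrix}^\top\begin{pmatrix}H_{xx}[t]&H_{xu}[t]\\ H_{ux}[t]&H_{uu}[t]\end{pmatrix}\begin{pmatrix}y(t)\\ v(t)\end{pmatrix}dt+y_w(T)^\top g_{xx}(x(T))\,y(T).$$ (iii) If $\beta\in[2,\infty]$ and $u(\cdot)\in L^\beta$, then $J''(u(\cdot))\in\mathbb{L}(L^\beta)$ (i.e. $J''(u(\cdot))$ maps $L^\beta$ boundedly into $L^\beta$).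
   Context: Setting. Fix $T>0$, $n,m\in\mathbb{N}$, $x_0\in\mathbb{R}^n$ and maps $b:[0,T]\times\mathbb{R}^n\times\mathbb{R}^m\to\mathbb{R}^n$, $f:[0,T]\times\mathbb{R}^n\times\mathbb{R}^m\to\mathbb{R}$, $g:\mathbb{R}^n\to\mathbb{R}$. $|\cdot|$ is the Euclidean norm (for matrices and higher-order arrays, that of the entries). For $\beta\in[1,\infty]$, $L^\beta=L^\beta(0,T;\mathbb{R}^m)$ with norm $\|\cdot\|_\beta$. For a normed space $X$, $\mathbb{L}(X)$ is the space of bounded linear operators $X\to X$ with the operator norm. Derivatives. $b_x,b_u$ are Jacobians ($n\times n$, $n\times m$); gradients $f_x,f_u,g_x,H_x,H_u$ are column vectors; $H_{xu}$ is the derivative of $H_x$ with respect to $u$ (an $n\times m$ matrix), $H_{ux}=H_{xu}^\top$; $\varphi_{(x,u)^2}$ is the full second derivative of $\varphi$ in $(x,u)$. Standing assumptions. $b,f,g$ are measurable; for every $t$, $b(t,\cdot,\cdot)$ and $f(t,\cdot,\cdot)$ are twice differentiable, and $g$ is twice differentiable; there is a constant $L>0$, independent of $t$, such that for all $t\in[0,T]$, $x,\bar x\in\mathbb{R}^n$, $u,\bar u\in\mathbb{R}^m$: $|b(t,x,u)|\le L(|x|+|u|+1)$, $|b_x(t,x,u)|+|b_u(t,x,u)|\le L$, $|b_{(x,u)^2}(t,x,u)|\le L$, $|b_{(x,u)^2}(t,x,u)-b_{(x,u)^2}(t,\bar x,\bar u)|\le L(|x-\bar x|+|u-\bar u|)$;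 $|f(t,x,u)|\le L(|x|^2+|u|^2+1)$, $|f_x(t,x,u)|+|f_u(t,x,u)|\le L(|x|+|u|+1)$, $|f_{(x,u)^2}(t,x,u)|\le L$, $|f_{(x,u)^2}(t,x,u)-f_{(x,u)^2}(t,\bar x,\bar u)|\le L(|x-\bar x|+|u-\bar u|)$; $|g(x)|\le L(|x|^2+1)$, $|g_x(x)|\le L(|x|+1)$, $|g_{xx}(x)|\le L$, $|g_{xx}(x)-g_{xx}(\bar x)|\le L|x-\bar x|$. State, cost, adjoint. For $u(\cdot)\in L^2$, the state $x(\cdot)$ is the unique solution of $\dot x(t)=b(t,x(t),u(t))$, $x(0)=x_0$; the cost is $J(u(\cdot))=\int_0^Tf(t,x(t),u(t))\,dt+g(x(T))$; the adjoint $p(\cdot)$ is the unique solution of $\dot p(t)=-b_x(t,x(t),u(t))^\top p(t)-f_x(t,x(t),u(t))$, $p(T)=g_x(x(T))$. The Hamiltonian is $H(t,x,u,p)=b(t,x,u)^\top p+f(t,x,u)$. Write $b_i[t]=b_i(t,x(t),u(t))$ and $H_i[t]=H_i(t,x(t),u(t),p(t))$. Variations. The state variation $y(\cdot)$ at $u(\cdot)$ in direction $v(\cdot)\in L^2$ solves $\dot y(t)=b_x[t]y(t)+b_u[t]v(t)$, $y(0)=0$. The adjoint variation $\psi(\cdot)$ solves $\dot\psi(t)=-b_x[t]^\top\psi(t)-H_{xx}[t]y(t)-H_{xu}[t]v(t)$ for a.e. $t$, $\psi(T)=g_{xx}(x(T))y(T)$. The first derivative $J'(u(\cdot))\in L^2$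 is identified with its Riesz representative; $J''(u(\cdot))$ is the G\^ateaux derivative of the map $J':L^2\to L^2$ at $u(\cdot)$. *)

theory Defs
  imports "HOL-Analysis.Analysis" "HOL-Probability.Essential_Supremum"
begin

section \<open>The spaces \<open>L\<^sup>\<beta>(0,T)\<close>\<close>

text \<open>
  Elements of \<open>L\<^sup>\<beta>\<close> are represented by functions on the reals of which only the values on
  \<open>[0,T]\<close> matter, up to almost-everywhere equality with respect to Lebesgue measure on
  \<open>[0,T]\<close>; for instance, linearity of an operator is required almost everywhere.
  The exponent ranges over \<open>[1,\<infinity>]\<close>. As \<open>0 powr \<beta> = 0\<close>, the power below is correct also
  where the function vanishes.
\<close>

definition Lspace :: "real \<Rightarrow> ennreal \<Rightarrow> (real \<Rightarrow> 'a::euclidean_space) set" where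
  "Lspace T \<beta> = {u \<in> borel_measurable (lebesgue_on {0..T}).
     if \<beta> = \<infinity> then esssup (lebesgue_on {0..T}) (\<lambda>t. ereal (norm (u t))) < \<infinity>
     else integrable (lebesgue_on {0..T}) (\<lambda>t. norm (u t) powr enn2real \<beta>)}"

definition Lnorm :: "real \<Rightarrow> ennreal \<Rightarrow> (real \<Rightarrow> 'a::euclidean_space) \<Rightarrow> real" where
  "Lnorm T \<beta> u =
    (if \<beta> = \<infinity> then real_of_ereal (esssup (lebesgue_on {0..T}) (\<lambda>t. ereal (norm (u t))))
     else (LINT t|lebesgue_on {0..T}. norm (u t) powr enn2real \<beta>) powr (1 / enn2real \<beta>))"

definition L2_inner :: "real \<Rightarrow> (real \<Rightarrow> 'a::euclidean_space) \<Rightarrow> (real \<Rightarrow> 'a) \<Rightarrow> real" where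
  "L2_inner T u v = (LINT t|lebesgue_on {0..T}. u t \<bullet> v t)"

text \<open>
  Membership in the space of bounded linear operators on \<open>L\<^sup>\<beta>\<close>. Linearity and
  boundedness together imply that the operator respects almost-everywhere equality.
\<close>

definition bounded_operator ::
    "real \<Rightarrow> ennreal \<Rightarrow> ((real \<Rightarrow> 'a::euclidean_space) \<Rightarrow> (real \<Rightarrow> 'a)) \<Rightarrow> bool" where
  "bounded_operator T \<beta> A \<longleftrightarrow>
     (\<forall>v\<in>Lspace T \<beta>. A v \<in> Lspace T \<beta>) \<and>
     (\<forall>v\<in>Lspace T \<beta>. \<forall>w\<in>Lspace T \<beta>.
        AE t in lebesgue_on {0..T}. A (\<lambda>s. v s + w s) t = A v t + A w t) \<and>
     (\<forall>c. \<forall>v\<in>Lspace T \<beta>. AE t in lebesgue_on {0..T}. A (\<lambda>s. c *\<^sub>R v s) t = c *\<^sub>R A v t) \<and>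
     (\<exists>K. \<forall>v\<in>Lspace T \<beta>. Lnorm T \<beta> (A v) \<le> K * Lnorm T \<beta> v)"

definition bounded_functional_L2 :: "real \<Rightarrow> ((real \<Rightarrow> 'a::euclidean_space) \<Rightarrow> real) \<Rightarrow> bool" where
  "bounded_functional_L2 T l \<longleftrightarrow>
     (\<forall>v\<in>Lspace T 2. \<forall>w\<in>Lspace T 2. l (\<lambda>s. v s + w s) = l v + l w) \<and>
     (\<forall>c. \<forall>v\<in>Lspace T 2. l (\<lambda>s. c *\<^sub>R v s) = c * l v) \<and>
     (\<exists>K. \<forall>v\<in>Lspace T 2. \<bar>l v\<bar> \<le> K * Lnorm T 2 v)"

section \<open>G\^ateaux derivatives on \<open>L\<^sup>2\<close>\<close>

definition functional_gateaux_derivative ::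
    "real \<Rightarrow> ((real \<Rightarrow> 'a::euclidean_space) \<Rightarrow> real) \<Rightarrow> (real \<Rightarrow> 'a)
      \<Rightarrow> ((real \<Rightarrow> 'a) \<Rightarrow> real) \<Rightarrow> bool" where
  "functional_gateaux_derivative T \<Phi> u l \<longleftrightarrow>
     bounded_functional_L2 T l \<and>
     (\<forall>v\<in>Lspace T 2.
        ((\<lambda>\<epsilon>. (\<Phi> (\<lambda>s. u s + \<epsilon> *\<^sub>R v s) - \<Phi> u) / \<epsilon>) \<longlongrightarrow> l v) (at 0))"

definition operator_gateaux_derivative ::
    "real \<Rightarrow> ((real \<Rightarrow> 'a::euclidean_space) \<Rightarrow> (real \<Rightarrow> 'a)) \<Rightarrow> (real \<Rightarrow> 'a)
      \<Rightarrow> ((real \<Rightarrow> 'a) \<Rightarrow> (real \<Rightarrow> 'a)) \<Rightarrow> bool" where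
  "operator_gateaux_derivative T F u A \<longleftrightarrow>
     bounded_operator T 2 A \<and>
     (\<forall>v\<in>Lspace T 2.
        ((\<lambda>\<epsilon>. Lnorm T 2 (\<lambda>t. (F (\<lambda>s. u s + \<epsilon> *\<^sub>R v s) t - F u t) /\<^sub>R \<epsilon> - A v t)) \<longlongrightarrow> 0) (at 0))"

text \<open>The Riesz representative in \<open>L\<^sup>2\<close> of the G\^ateaux derivative of a functional.\<close>

definition is_first_derivative ::
    "real \<Rightarrow> ((real \<Rightarrow> 'a::euclidean_space) \<Rightarrow> real) \<Rightarrow> (real \<Rightarrow> 'a) \<Rightarrow> (real \<Rightarrow> 'a) \<Rightarrow> bool" where
  "is_first_derivative T \<Phi> u G \<longleftrightarrow>
     G \<in> Lspace T 2 \<and>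
     (\<exists>l. functional_gateaux_derivative T \<Phi> u l \<and> (\<forall>v\<in>Lspace T 2. l v = L2_inner T G v))"

text \<open>The choices below are unique up to almost-everywhere equality whenever the derivatives exist.\<close>

definition first_derivative ::
    "real \<Rightarrow> ((real \<Rightarrow> 'a::euclidean_space) \<Rightarrow> real) \<Rightarrow> (real \<Rightarrow> 'a) \<Rightarrow> (real \<Rightarrow> 'a)" where
  "first_derivative T \<Phi> u = (SOME G. is_first_derivative T \<Phi> u G)"

definition second_derivative ::
    "real \<Rightarrow> ((real \<Rightarrow> 'a::euclidean_space) \<Rightarrow> real) \<Rightarrow> (real \<Rightarrow> 'a)
      \<Rightarrow> (real \<Rightarrow> 'a) \<Rightarrow> (real \<Rightarrow> 'a)" where
  "second_derivative T \<Phi> u =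
     (SOME A. operator_gateaux_derivative T (first_derivative T \<Phi>) u A)"

definition twice_gateaux_differentiable ::
    "real \<Rightarrow> ((real \<Rightarrow> 'a::euclidean_space) \<Rightarrow> real) \<Rightarrow> bool" where
  "twice_gateaux_differentiable T \<Phi> \<longleftrightarrow>
     (\<forall>u\<in>Lspace T 2. \<exists>G. is_first_derivative T \<Phi> u G) \<and>
     (\<forall>u\<in>Lspace T 2. \<exists>A. operator_gateaux_derivative T (first_derivative T \<Phi>) u A)"

section \<open>Finite-dimensional derivatives\<close>

definition gradient :: "('a::euclidean_space \<Rightarrow> real) \<Rightarrow> 'a \<Rightarrow> 'a" where
  "gradient \<phi> z = (THE D. GDERIV \<phi> z :> D)"

definition twice_differentiable :: "('a::euclidean_space \<Rightarrow> 'b::euclidean_space) \<Rightarrow> bool" where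
  "twice_differentiable \<phi> \<longleftrightarrow>
     (\<exists>D :: 'a \<Rightarrow> 'a \<Rightarrow>\<^sub>L 'b.
        (\<forall>z. (\<phi> has_derivative blinfun_apply (D z)) (at z)) \<and> (\<forall>z. D differentiable (at z)))"

text \<open>
  The array of second-order partial derivatives, indexed by pairs of basis vectors, and the
  Euclidean norm of the entries of such an array (each entry being a vector for vector-valued maps).
\<close>

definition second_deriv_array ::
    "('a::euclidean_space \<Rightarrow> 'b::euclidean_space) \<Rightarrow> 'a \<Rightarrow> 'a \<Rightarrow> 'a \<Rightarrow> 'b" where
  "second_deriv_array \<phi> z h k =
     frechet_derivative (\<lambda>\<zeta>. frechet_derivative \<phi> (at \<zeta>) h) (at z) k"

definition array_norm :: "('a::euclidean_space \<Rightarrow> 'a \<Rightarrow> 'b::euclidean_space) \<Rightarrow> real" where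
  "array_norm A = sqrt (\<Sum>h\<in>Basis. \<Sum>k\<in>Basis. (norm (A h k))\<^sup>2)"

definition jac_x :: "(real \<Rightarrow> real^'n \<Rightarrow> real^'m \<Rightarrow> real^'n) \<Rightarrow> real \<Rightarrow> real^'n \<Rightarrow> real^'m \<Rightarrow> real^'n^'n" where
  "jac_x b t x u = jacobian (\<lambda>\<xi>. b t \<xi> u) (at x)"

definition jac_u :: "(real \<Rightarrow> real^'n \<Rightarrow> real^'m \<Rightarrow> real^'n) \<Rightarrow> real \<Rightarrow> real^'n \<Rightarrow> real^'m \<Rightarrow> real^'m^'n" where
  "jac_u b t x u = jacobian (\<lambda>\<mu>. b t x \<mu>) (at u)"

definition grad_x :: "(real \<Rightarrow> real^'n \<Rightarrow> real^'m \<Rightarrow> real) \<Rightarrow> real \<Rightarrow> real^'n \<Rightarrow> real^'m \<Rightarrow> real^'n" where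
  "grad_x f t x u = gradient (\<lambda>\<xi>. f t \<xi> u) x"

definition grad_u :: "(real \<Rightarrow> real^'n \<Rightarrow> real^'m \<Rightarrow> real) \<Rightarrow> real \<Rightarrow> real^'n \<Rightarrow> real^'m \<Rightarrow> real^'m" where
  "grad_u f t x u = gradient (\<lambda>\<mu>. f t x \<mu>) u"

definition hessian :: "(real^'n \<Rightarrow> real) \<Rightarrow> real^'n \<Rightarrow> real^'n^'n" where
  "hessian g x = jacobian (gradient g) (at x)"

section \<open>Standing assumptions\<close>

text \<open>
  Measurability of \<open>b\<close>, \<open>f\<close>, \<open>g\<close> is Lebesgue measurability, so Borel measurable
  data are included. The norm of a matrix is the Euclidean norm of its entries.
\<close>

definition dynamics_assms :: "real \<Rightarrow> (real \<Rightarrow> real^'n \<Rightarrow> real^'m \<Rightarrow> real^'n) \<Rightarrow> real \<Rightarrow> bool" where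
  "dynamics_assms T b L \<longleftrightarrow>
     (\<lambda>(t, x, u). b t x u) \<in> borel_measurable (lebesgue_on ({0..T} \<times> UNIV)) \<and>
     (\<forall>t\<in>{0..T}.
        twice_differentiable (\<lambda>(x, u). b t x u) \<and>
        (\<forall>x u. norm (b t x u) \<le> L * (norm x + norm u + 1)) \<and>
        (\<forall>x u. norm (jac_x b t x u) + norm (jac_u b t x u) \<le> L) \<and>
        (\<forall>x u. array_norm (second_deriv_array (\<lambda>(\<xi>, \<mu>). b t \<xi> \<mu>) (x, u)) \<le> L) \<and>
        (\<forall>x u x' u'. array_norm (\<lambda>h k. second_deriv_array (\<lambda>(\<xi>, \<mu>). b t \<xi> \<mu>) (x, u) h k
                                    - second_deriv_array (\<lambda>(\<xi>, \<mu>). b t \<xi> \<mu>) (x', u') h k)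
                     \<le> L * (norm (x - x') + norm (u - u'))))"

definition running_cost_assms :: "real \<Rightarrow> (real \<Rightarrow> real^'n \<Rightarrow> real^'m \<Rightarrow> real) \<Rightarrow> real \<Rightarrow> bool" where
  "running_cost_assms T f L \<longleftrightarrow>
     (\<lambda>(t, x, u). f t x u) \<in> borel_measurable (lebesgue_on ({0..T} \<times> UNIV)) \<and>
     (\<forall>t\<in>{0..T}.
        twice_differentiable (\<lambda>(x, u). f t x u) \<and>
        (\<forall>x u. \<bar>f t x u\<bar> \<le> L * ((norm x)\<^sup>2 + (norm u)\<^sup>2 + 1)) \<and>
        (\<forall>x u. norm (grad_x f t x u) + norm (grad_u f t x u) \<le> L * (norm x + norm u + 1)) \<and>
        (\<forall>x u. array_norm (second_deriv_array (\<lambda>(\<xi>, \<mu>). f t \<xi> \<mu>) (x, u)) \<le> L) \<and>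
        (\<forall>x u x' u'. array_norm (\<lambda>h k. second_deriv_array (\<lambda>(\<xi>, \<mu>). f t \<xi> \<mu>) (x, u) h k
                                    - second_deriv_array (\<lambda>(\<xi>, \<mu>). f t \<xi> \<mu>) (x', u') h k)
                     \<le> L * (norm (x - x') + norm (u - u'))))"

definition terminal_cost_assms :: "(real^'n \<Rightarrow> real) \<Rightarrow> real \<Rightarrow> bool" where
  "terminal_cost_assms g L \<longleftrightarrow>
     g \<in> borel_measurable lebesgue \<and>
     twice_differentiable g \<and>
     (\<forall>x. \<bar>g x\<bar> \<le> L * ((norm x)\<^sup>2 + 1)) \<and>
     (\<forall>x. norm (gradient g x) \<le> L * (norm x + 1)) \<and>
     (\<forall>x. norm (hessian g x) \<le> L) \<and>
     (\<forall>x x'. norm (hessian g x - hessian g x') \<le> L * norm (x - x'))"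

definition standing_assms ::
    "real \<Rightarrow> (real \<Rightarrow> real^'n \<Rightarrow> real^'m \<Rightarrow> real^'n) \<Rightarrow> (real \<Rightarrow> real^'n \<Rightarrow> real^'m \<Rightarrow> real)
      \<Rightarrow> (real^'n \<Rightarrow> real) \<Rightarrow> bool" where
  "standing_assms T b f g \<longleftrightarrow>
     (\<exists>L>0. dynamics_assms T b L \<and> running_cost_assms T f L \<and> terminal_cost_assms g L)"

section \<open>State, cost and adjoint\<close>

definition absolutely_continuous_on :: "real set \<Rightarrow> (real \<Rightarrow> 'a::euclidean_space) \<Rightarrow> bool" where
  "absolutely_continuous_on S x \<longleftrightarrow>
     (\<forall>\<epsilon>>0. \<exists>\<delta>>0. \<forall>d X. d division_of X \<and> X \<subseteq> S \<and> (\<Sum>I\<in>d. Sup I - Inf I) < \<delta> \<longrightarrow>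
        (\<Sum>I\<in>d. norm (x (Sup I) - x (Inf I))) < \<epsilon>)"

text \<open>
  Controls are only in \<open>L\<^sup>2\<close>, so differential equations are understood in the sense of
  Carath\'eodory: a solution is absolutely continuous and satisfies the equation almost everywhere.
\<close>

definition solves_ode_ae :: "real \<Rightarrow> (real \<Rightarrow> 'a::euclidean_space \<Rightarrow> 'a) \<Rightarrow> (real \<Rightarrow> 'a) \<Rightarrow> bool" where
  "solves_ode_ae T F x \<longleftrightarrow>
     absolutely_continuous_on {0..T} x \<and>
     (AE t in lebesgue_on {0..T}. (x has_vector_derivative F t (x t)) (at t within {0..T}))"

definition is_state ::
    "real \<Rightarrow> (real \<Rightarrow> real^'n \<Rightarrow> real^'m \<Rightarrow> real^'n) \<Rightarrow> real^'n
      \<Rightarrow> (real \<Rightarrow> real^'m) \<Rightarrow> (real \<Rightarrow> real^'n) \<Rightarrow> bool" where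
  "is_state T b x0 u x \<longleftrightarrow> solves_ode_ae T (\<lambda>t \<xi>. b t \<xi> (u t)) x \<and> x 0 = x0"

text \<open>The state is unique on \<open>[0,T]\<close>, and the cost depends on its values there only.\<close>

definition state ::
    "real \<Rightarrow> (real \<Rightarrow> real^'n \<Rightarrow> real^'m \<Rightarrow> real^'n) \<Rightarrow> real^'n
      \<Rightarrow> (real \<Rightarrow> real^'m) \<Rightarrow> (real \<Rightarrow> real^'n)" where
  "state T b x0 u = (SOME x. is_state T b x0 u x)"

definition cost ::
    "real \<Rightarrow> (real \<Rightarrow> real^'n \<Rightarrow> real^'m \<Rightarrow> real^'n) \<Rightarrow> (real \<Rightarrow> real^'n \<Rightarrow> real^'m \<Rightarrow> real)
      \<Rightarrow> (real^'n \<Rightarrow> real) \<Rightarrow> real^'n \<Rightarrow> (real \<Rightarrow> real^'m) \<Rightarrow> real" where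
  "cost T b f g x0 u =
     (LINT t|lebesgue_on {0..T}. f t (state T b x0 u t) (u t)) + g (state T b x0 u T)"

definition is_adjoint ::
    "real \<Rightarrow> (real \<Rightarrow> real^'n \<Rightarrow> real^'m \<Rightarrow> real^'n) \<Rightarrow> (real \<Rightarrow> real^'n \<Rightarrow> real^'m \<Rightarrow> real)
      \<Rightarrow> (real^'n \<Rightarrow> real) \<Rightarrow> (real \<Rightarrow> real^'m) \<Rightarrow> (real \<Rightarrow> real^'n) \<Rightarrow> (real \<Rightarrow> real^'n) \<Rightarrow> bool" where
  "is_adjoint T b f g u x p \<longleftrightarrow>
     solves_ode_ae T (\<lambda>t \<pi>. - (transpose (jac_x b t (x t) (u t)) *v \<pi>) - grad_x f t (x t) (u t)) p \<and>
     p T = gradient g (x T)"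

section \<open>The Hamiltonian and its derivatives\<close>

definition ham ::
    "(real \<Rightarrow> real^'n \<Rightarrow> real^'m \<Rightarrow> real^'n) \<Rightarrow> (real \<Rightarrow> real^'n \<Rightarrow> real^'m \<Rightarrow> real)
      \<Rightarrow> real \<Rightarrow> real^'n \<Rightarrow> real^'m \<Rightarrow> real^'n \<Rightarrow> real" where
  "ham b f t x u p = b t x u \<bullet> p + f t x u"

definition ham_x ::
    "(real \<Rightarrow> real^'n \<Rightarrow> real^'m \<Rightarrow> real^'n) \<Rightarrow> (real \<Rightarrow> real^'n \<Rightarrow> real^'m \<Rightarrow> real)
      \<Rightarrow> real \<Rightarrow> real^'n \<Rightarrow> real^'m \<Rightarrow> real^'n \<Rightarrow> real^'n" where
  "ham_x b f t x u p = gradient (\<lambda>\<xi>. ham b f t \<xi> u p) x"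

definition ham_u ::
    "(real \<Rightarrow> real^'n \<Rightarrow> real^'m \<Rightarrow> real^'n) \<Rightarrow> (real \<Rightarrow> real^'n \<Rightarrow> real^'m \<Rightarrow> real)
      \<Rightarrow> real \<Rightarrow> real^'n \<Rightarrow> real^'m \<Rightarrow> real^'n \<Rightarrow> real^'m" where
  "ham_u b f t x u p = gradient (\<lambda>\<mu>. ham b f t x \<mu> p) u"

definition ham_xx ::
    "(real \<Rightarrow> real^'n \<Rightarrow> real^'m \<Rightarrow> real^'n) \<Rightarrow> (real \<Rightarrow> real^'n \<Rightarrow> real^'m \<Rightarrow> real)
      \<Rightarrow> real \<Rightarrow> real^'n \<Rightarrow> real^'m \<Rightarrow> real^'n \<Rightarrow> real^'n^'n" where
  "ham_xx b f t x u p = jacobian (\<lambda>\<xi>. ham_x b f t \<xi> u p) (at x)"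

definition ham_xu ::
    "(real \<Rightarrow> real^'n \<Rightarrow> real^'m \<Rightarrow> real^'n) \<Rightarrow> (real \<Rightarrow> real^'n \<Rightarrow> real^'m \<Rightarrow> real)
      \<Rightarrow> real \<Rightarrow> real^'n \<Rightarrow> real^'m \<Rightarrow> real^'n \<Rightarrow> real^'m^'n" where
  "ham_xu b f t x u p = jacobian (\<lambda>\<mu>. ham_x b f t x \<mu> p) (at u)"

definition ham_ux ::
    "(real \<Rightarrow> real^'n \<Rightarrow> real^'m \<Rightarrow> real^'n) \<Rightarrow> (real \<Rightarrow> real^'n \<Rightarrow> real^'m \<Rightarrow> real)
      \<Rightarrow> real \<Rightarrow> real^'n \<Rightarrow> real^'m \<Rightarrow> real^'n \<Rightarrow> real^'n^'m" where
  "ham_ux b f t x u p = transpose (ham_xu b f t x u p)"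

definition ham_uu ::
    "(real \<Rightarrow> real^'n \<Rightarrow> real^'m \<Rightarrow> real^'n) \<Rightarrow> (real \<Rightarrow> real^'n \<Rightarrow> real^'m \<Rightarrow> real)
      \<Rightarrow> real \<Rightarrow> real^'n \<Rightarrow> real^'m \<Rightarrow> real^'n \<Rightarrow> real^'m^'m" where
  "ham_uu b f t x u p = jacobian (\<lambda>\<mu>. ham_u b f t x \<mu> p) (at u)"

section \<open>State and adjoint variations\<close>

definition is_state_variation ::
    "real \<Rightarrow> (real \<Rightarrow> real^'n \<Rightarrow> real^'m \<Rightarrow> real^'n) \<Rightarrow> (real \<Rightarrow> real^'m) \<Rightarrow> (real \<Rightarrow> real^'n)
      \<Rightarrow> (real \<Rightarrow> real^'m) \<Rightarrow> (real \<Rightarrow> real^'n) \<Rightarrow> bool" where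
  "is_state_variation T b u x v y \<longleftrightarrow>
     solves_ode_ae T (\<lambda>t \<eta>. jac_x b t (x t) (u t) *v \<eta> + jac_u b t (x t) (u t) *v v t) y \<and>
     y 0 = 0"

definition is_adjoint_variation ::
    "real \<Rightarrow> (real \<Rightarrow> real^'n \<Rightarrow> real^'m \<Rightarrow> real^'n) \<Rightarrow> (real \<Rightarrow> real^'n \<Rightarrow> real^'m \<Rightarrow> real)
      \<Rightarrow> (real^'n \<Rightarrow> real) \<Rightarrow> (real \<Rightarrow> real^'m) \<Rightarrow> (real \<Rightarrow> real^'n) \<Rightarrow> (real \<Rightarrow> real^'n)
      \<Rightarrow> (real \<Rightarrow> real^'m) \<Rightarrow> (real \<Rightarrow> real^'n) \<Rightarrow> (real \<Rightarrow> real^'n) \<Rightarrow> bool" where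
  "is_adjoint_variation T b f g u x p v y \<psi> \<longleftrightarrow>
     solves_ode_ae T
       (\<lambda>t \<eta>. - (transpose (jac_x b t (x t) (u t)) *v \<eta>)
              - ham_xx b f t (x t) (u t) (p t) *v y t
              - ham_xu b f t (x t) (u t) (p t) *v v t) \<psi> \<and>
     \<psi> T = hessian g (x T) *v y T"

end

theory Submission
  imports Defs
begin

text \<open>
  Put \<open>z = (x,u)\<close> and let \<open>G(t,z,p)\<close> be the gradient of \<open>H\<close> in \<open>z\<close>. The adjoint equation reads
  \<open>p' = - fst G\<close> and \<open>J'(u) = snd G\<close>, while the adjoint variation and \<open>J''(u)v\<close> are \<open>- fst Q\<close> and \<open>snd Q\<close>
  for the linearization \<open>Q\<close> of \<open>G\<close> in direction \<open>((y,v),\<psi>)\<close>. For the control \<open>u + \<epsilon>v\<close>, Gronwall's inequality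
  gives first-order bounds for the increments of state and adjoint and, since second derivatives are Lipschitz,
  remainders \<open>x\<^sub>\<epsilon> - x - \<epsilon>y\<close> and \<open>p\<^sub>\<epsilon> - p - \<epsilon>\<psi>\<close> of order \<open>\<epsilon>\<^sup>2\<close>. Hence \<open>(J'(u + \<epsilon>v) - J'(u)) / \<epsilon> - J''(u)v\<close> is
  pointwise at most \<open>\<bar>\<epsilon>\<bar> C (1 + \<bar>v\<bar>\<^sup>2)\<close>; this is not square integrable, but the difference is also at most
  \<open>C (1 + \<bar>v\<bar>)\<close>, so dominated convergence yields the limit in \<open>L\<^sup>2\<close>. The bilinear formula follows
  by integrating \<open>(\<psi> \<bullet> y\<^sub>w)'\<close>, and boundedness in \<open>L\<^sup>\<beta>\<close> from \<open>\<bar>J''(u)v\<bar> \<le> C (\<bar>v\<bar> + \<integral>\<bar>v\<bar>)\<close>, where \<open>C\<close>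
  depends on \<open>u\<close> only through bounds of the adjoint.
\<close>

section \<open>Absolutely continuous functions\<close>

text \<open>Controls are only square integrable, so the equations hold almost everywhere and rest on
  absolute continuity: the fundamental theorem of calculus for such functions makes a solution the
  integral of its right-hand side, and a converse turns fixed points of integral operators into
  solutions. A second obstacle is measurability. Joint Lebesgue measurability in (t,x,u) alone does
  not make b(t,x(t),u(t)) measurable in t; continuity in (x,u) repairs this, and derivatives are
  limits of difference quotients. States and the derivatives of J are picked by Hilbert choice, so
  uniqueness results have to identify them, for the derivatives of J only up to null sets depending
  on the control. Finally \<open>ham_ux\<close> is defined as a transpose; that it is the mixed
  derivative in the other order requires symmetry of second derivatives, obtained from second
  differences. The constant C of the joint formulation is 2 (n+m)^2 L: the squared dimension passes
  from arrays of entries to bilinear forms, the factor 2 from |x|+|u| to the norm of the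
  pair.\<close>

lemma AE_lebesgue_on_iff_negligible:
  fixes S :: "'a::euclidean_space set"
  assumes "S \<in> sets lebesgue"
  shows "(AE x in lebesgue_on S. P x) \<longleftrightarrow> (\<exists>N. negligible N \<and> (\<forall>x\<in>S - N. P x))"
proof -
  have "(AE x in lebesgue_on S. P x) \<longleftrightarrow> (AE x in lebesgue. x \<in> S \<longrightarrow> P x)"
    using assms by (simp add: AE_restrict_space_iff)
  also have "\<dots> \<longleftrightarrow> (\<exists>N. negligible N \<and> (\<forall>x\<in>S - N. P x))"
  proof
    assume "AE x in lebesgue. x \<in> S \<longrightarrow> P x"
    then obtain N where "N \<in> null_sets lebesgue" "{x \<in> space lebesgue. \<not> (x \<in> S \<longrightarrow> P x)} \<subseteq> N"
      by (auto simp: eventually_ae_filter)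
    then show "\<exists>N. negligible N \<and> (\<forall>x\<in>S - N. P x)"
      by (auto simp: negligible_iff_null_sets)
  next
    assume "\<exists>N. negligible N \<and> (\<forall>x\<in>S - N. P x)"
    then show "AE x in lebesgue. x \<in> S \<longrightarrow> P x"
      by (auto simp: eventually_ae_filter negligible_iff_null_sets)
  qed
  finally show ?thesis .
qed

text \<open>The constant 1 has the total content as its integral over the covered set, and integrals
  of nonnegative functions grow with the domain. It is applied to an open \<open>U\<close> of small
  measure around an exceptional null set.\<close>

lemma sum_content_le_measure:
  fixes U :: "'a::euclidean_space set"
  assumes D: "\<D> division_of X" and "X \<subseteq> U" and "U \<in> lmeasurable"
  shows "(\<Sum>K\<in>\<D>. measure lborel K) \<le> measure lebesgue U"
proof -
  have X: "((\<lambda>_. 1::real) has_integral (\<Sum>K\<in>\<D>. measure lborel K)) X"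
  proof (rule has_integral_combine_division[OF D])
    fix K assume "K \<in> \<D>"
    then obtain c d where "K = cbox c d"
      using division_ofD(4)[OF D] by blast
    then show "((\<lambda>_. 1::real) has_integral measure lborel K) K"
      using has_integral_const[of "1::real" c d] by simp
  qed
  then have "(\<Sum>K\<in>\<D>. measure lborel K) = integral X (\<lambda>_. 1::real)"
    by (simp add: integral_unique)
  also have "\<dots> \<le> integral U (\<lambda>_. 1)"
    using assms X by (intro integral_subset_le) (auto simp: lmeasurable_iff_integrable_on)
  also have "\<dots> = measure lebesgue U"
    by (simp add: assms(3) lmeasure_integral)
  finally show ?thesis .
qed

text \<open>The fundamental theorem for absolutely continuous functions, with integrability of
  \<open>h\<close> as part of the conclusion. In a fine tagged division, cells tagged outside the
  null set \<open>N\<close> are handled by differentiability at the tag; cells tagged in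
  \<open>N\<close> have small total length, so absolute continuity makes their increments
  small.\<close>

lemma absolutely_continuous_on_imp_has_integral:
  fixes x :: "real \<Rightarrow> 'a::euclidean_space"
  assumes "a \<le> b" and ac: "absolutely_continuous_on {a..b} x"
    and deriv: "AE t in lebesgue_on {a..b}. (x has_vector_derivative h t) (at t within {a..b})"
  shows "(h has_integral (x b - x a)) {a..b}"
proof -
  obtain N where N: "negligible N"
    and vec: "\<And>t. t \<in> {a..b} - N \<Longrightarrow> (x has_vector_derivative h t) (at t within {a..b})"
    using deriv by (auto simp: AE_lebesgue_on_iff_negligible)
  \<comment> \<open>Zero values on \<open>N\<close> remove the Riemann terms of the bad cells, so
    that only their increments remain. The spike theorem restores \<open>h\<close> at the
    end.\<close>
  define h0 where "h0 t = (if t \<in> N then 0 else h t)" for t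
  have "(h0 has_integral (x b - x a)) {a..b}"
    unfolding has_integral_real
  proof (intro allI impI)
    fix e :: real assume "e > 0"
    define e' where "e' = e / (2 * (b - a + 1))"
    have e': "e' > 0" "e' * (b - a) \<le> e / 2"
      using \<open>e > 0\<close> \<open>a \<le> b\<close> by (auto simp: e'_def field_simps)
    obtain \<delta> where \<delta>: "\<delta> > 0" and ac': "\<And>\<D> X. \<D> division_of X \<Longrightarrow> X \<subseteq> {a..b} \<Longrightarrow>
        (\<Sum>I\<in>\<D>. Sup I - Inf I) < \<delta> \<Longrightarrow> (\<Sum>I\<in>\<D>. norm (x (Sup I) - x (Inf I))) < e / 2"
      using ac \<open>e > 0\<close> unfolding absolutely_continuous_on_def by (metis half_gt_zero)
    have Nleb: "N \<in> sets lebesgue"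
      using N negligible_imp_sets by blast
    obtain U where U: "open U" "N \<subseteq> U" "(U - N) \<in> lmeasurable" "emeasure lebesgue (U - N) < ennreal \<delta>"
      using sets_lebesgue_outer_open[OF Nleb \<delta>] by blast
    have mU: "U \<in> lmeasurable" "measure lebesgue U < \<delta>"
    proof -
      have *: "emeasure lebesgue U = emeasure lebesgue (U - N)"
        using N Nleb U by (simp add: emeasure_Diff_null_set negligible_iff_null_sets)
      show "U \<in> lmeasurable"
        using * U by (auto simp: fmeasurable_def)
      show "measure lebesgue U < \<delta>"
        using * U(3,4) \<delta> by (metis emeasure_eq_measure2 ennreal_less_iff measure_def measure_nonneg)
    qed
    have "\<forall>t. \<exists>d>0. t \<in> {a..b} - N \<longrightarrow>
         (\<forall>s\<in>{a..b}. norm (s - t) < d \<longrightarrow> norm (x s - x t - (s - t) *\<^sub>R h t) \<le> e' * norm (s - t))"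
      using vec[unfolded has_vector_derivative_def has_derivative_within_alt] e'(1)
      by (metis zero_less_one)
    then obtain d where d: "\<And>t. 0 < d t"
      "\<And>t s. t \<in> {a..b} - N \<Longrightarrow> s \<in> {a..b} \<Longrightarrow> norm (s - t) < d t
          \<Longrightarrow> norm (x s - x t - (s - t) *\<^sub>R h t) \<le> e' * norm (s - t)"
      by metis
    \<comment> \<open>Cells tagged in \<open>N\<close> stay inside the open set \<open>U\<close> of
      measure below \<delta>, all others inside the ball where the linear approximation at the tag
      has error at most \<open>e'\<close> times the distance.\<close>
    define \<gamma> where "\<gamma> t = (if t \<in> N then U else ball t (d t))" for t
    have "gauge \<gamma>"
      using U d by (auto simp: gauge_def \<gamma>_def)
    moreover have "norm ((\<Sum>(t, K)\<in>p. measure lborel K *\<^sub>R h0 t) - (x b - x a)) < e"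
      if p: "p tagged_division_of {a..b}" and fine: "\<gamma> fine p" for p
    proof -
      define r where "r = (\<lambda>(t, K). measure lborel K *\<^sub>R h0 t - (x (Sup K) - x (Inf K)))"
      define pN where "pN = {(t, K) \<in> p. t \<in> N}"
      have fin: "finite p"
        using p by blast
      have xba: "x b - x a = (\<Sum>(t, K)\<in>p. x (Sup K) - x (Inf K))"
        using additive_tagged_division_1[OF \<open>a \<le> b\<close> p, of x] by simp
      have tot: "(\<Sum>(t, K)\<in>p. measure lborel K *\<^sub>R h0 t) - (x b - x a) = sum r p"
        unfolding xba r_def by (simp add: sum_subtractf case_prod_unfold)
      have pNp: "pN \<subseteq> p"
        by (auto simp: pN_def)
      have good: "norm (sum r (p - pN)) \<le> e / 2"
      proof -
        have "norm (sum r (p - pN)) \<le> (\<Sum>(t, K)\<in>p - pN. e' * measure lborel K)"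
        proof (rule sum_norm_le, clarify)
          fix t K assume tK: "(t, K) \<in> p" "(t, K) \<notin> pN"
          have tN: "t \<notin> N" using tK by (auto simp: pN_def)
          obtain c c' where K: "K = {c..c'}" "t \<in> K" "K \<subseteq> {a..b}"
            using tagged_division_ofD(2-4)[OF p tK(1)] by (metis box_real(2))
          have cc: "c \<le> c'" "c \<in> {a..b}" "c' \<in> {a..b}" "t \<in> {a..b} - N" "c \<le> t" "t \<le> c'"
            using K tN by auto
          have "K \<subseteq> ball t (d t)"
            using fineD[OF fine tK(1)] tN by (simp add: \<gamma>_def)
          then have "dist t c < d t" "dist t c' < d t"
            using K(1) cc by (simp_all add: subset_eq)
          then have 1: "norm (x c - x t - (c - t) *\<^sub>R h t) \<le> e' * norm (c - t)"
            and 2: "norm (x c' - x t - (c' - t) *\<^sub>R h t) \<le> e' * norm (c' - t)"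
            using cc by (intro d(2); simp add: dist_norm norm_minus_commute)+
          \<comment> \<open>Straddling: the tag lies between the endpoints, so the two one-sided
            errors add up to \<open>e'\<close> times the length of the cell.\<close>
          have "r (t, K) = (x c - x t - (c - t) *\<^sub>R h t) - (x c' - x t - (c' - t) *\<^sub>R h t)"
            using cc tN by (simp add: r_def K h0_def algebra_simps)
          then have "norm (r (t, K)) \<le> e' * norm (c - t) + e' * norm (c' - t)"
            using 1 2 norm_triangle_ineq4 by (smt (verit))
          also have "\<dots> = e' * measure lborel K"
            using cc by (simp add: K algebra_simps)
          finally show "norm (r (t, K)) \<le> e' * measure lborel K" .
        qed
        also have "\<dots> \<le> (\<Sum>(t, K)\<in>p. e' * measure lborel K)"
          using fin e'(1) by (intro sum_mono2) auto
        also have "\<dots> = e' * (b - a)"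
          using additive_content_tagged_division[of p a b] p \<open>a \<le> b\<close>
          by (simp add: sum_distrib_left [symmetric] case_prod_unfold)
        finally show ?thesis
          using e'(2) by linarith
      qed
      have bad: "norm (sum r pN) < e / 2"
      proof -
        have tag: "pN tagged_division_of \<Union>(snd ` pN)"
          using p pNp tagged_division_ofD tagged_division_of_def tagged_partial_division_subset
            tagged_partial_division_of_Union_self by metis
        have div: "snd ` pN division_of \<Union>(snd ` pN)"
          using division_of_tagged_division[OF tag] .
        have sub: "\<Union>(snd ` pN) \<subseteq> {a..b}" "\<Union>(snd ` pN) \<subseteq> U"
          using p fine by (fastforce simp: pN_def fine_def \<gamma>_def)+
        have "norm (sum r pN) \<le> (\<Sum>(t, K)\<in>pN. norm (x (Sup K) - x (Inf K)))"
          by (rule sum_norm_le) (auto simp: r_def pN_def h0_def norm_minus_commute)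
        also have "\<dots> = (\<Sum>K\<in>snd ` pN. norm (x (Sup K) - x (Inf K)))"
        proof -
          \<comment> \<open>Reindexing by cells asks for the value 0 on every box with empty
            interior. On singletons this is automatic; on the empty set, where \<open>Sup\<close>
            and \<open>Inf\<close> carry no information, it has to be imposed.\<close>
          define \<phi> where "\<phi> K = (if K = {} then 0 else norm (x (Sup K) - x (Inf K)))" for K :: "real set"
          have "(\<Sum>(t, K)\<in>pN. \<phi> K) = (\<Sum>K\<in>snd ` pN. \<phi> K)"
            by (rule sum.over_tagged_division_lemma[OF tag]) (auto simp: box_eq_empty \<phi>_def)
          moreover have "K \<noteq> {}" if "K \<in> snd ` pN" for K
            using division_ofD(3)[OF div that] .
          ultimately show ?thesis
            by (force simp: \<phi>_def case_prod_unfold cong: sum.cong_simp)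
        qed
        also have "\<dots> < e / 2"
        proof (rule ac'[OF div sub(1)])
          have "(\<Sum>I\<in>snd ` pN. Sup I - Inf I) = (\<Sum>I\<in>snd ` pN. measure lborel I)"
            by (rule sum.cong) (use division_ofD(3,4)[OF div] in force)+
          also have "\<dots> \<le> measure lebesgue U"
            by (rule sum_content_le_measure[OF div sub(2) mU(1)])
          finally show "(\<Sum>I\<in>snd ` pN. Sup I - Inf I) < \<delta>"
            using mU(2) by linarith
        qed
        finally show ?thesis .
      qed
      have "sum r p = sum r (p - pN) + sum r pN"
        using fin pNp by (metis sum.subset_diff)
      then show ?thesis
        unfolding tot using good bad
          norm_triangle_le[of "sum r (p - pN)" "sum r pN" "e / 2 + norm (sum r pN)"] by simp
    qed
    ultimately show "\<exists>\<gamma>. gauge \<gamma> \<and> (\<forall>\<D>. \<D> tagged_division_of {a..b} \<and> \<gamma> fine \<D> \<longrightarrow>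
        norm ((\<Sum>(t, K)\<in>\<D>. measure lborel K *\<^sub>R h0 t) - (x b - x a)) < e)"
      by (intro exI[of _ \<gamma>]) simp
  qed
  then show ?thesis
    by (rule has_integral_spike[OF N, rotated]) (auto simp: h0_def)
qed

section \<open>Indefinite Lebesgue integrals: absolute continuity and differentiability\<close>

lemma integrable_tail_small:
  fixes h :: "'a \<Rightarrow> 'b::{banach,second_countable_topology}"
  assumes "integrable M h" and "\<epsilon> > 0"
  obtains n :: nat where "(LINT t|M. max 0 (norm (h t) - real n)) < \<epsilon>"
proof -
  have "(\<lambda>n. LINT t|M. max 0 (norm (h t) - real n)) \<longlonglongrightarrow> (LINT t|M. 0)"
  proof (rule integral_dominated_convergence[where w="\<lambda>t. norm (h t)"])
    show "AE t in M. (\<lambda>n. max 0 (norm (h t) - real n)) \<longlonglongrightarrow> 0"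
    proof (rule AE_I2, rule tendsto_eventually)
      fix t
      obtain k where "norm (h t) \<le> real k"
        using real_arch_simple by blast
      then have "max 0 (norm (h t) - real n) = 0" if "n \<ge> k" for n
        using that by simp
      then show "\<forall>\<^sub>F n in sequentially. max 0 (norm (h t) - real n) = 0"
        using eventually_sequentially by blast
    qed
  qed (use assms in auto)
  then have "\<forall>\<^sub>F n in sequentially. (LINT t|M. max 0 (norm (h t) - real n)) < \<epsilon>"
    using \<open>\<epsilon> > 0\<close> by (auto dest: order_tendstoD(2))
  then show ?thesis
    using that eventually_sequentially by auto
qed


lemma integrable_lebesgue_on_imp_integrable_on:
  fixes h :: "real \<Rightarrow> 'a::euclidean_space"
  assumes "integrable (lebesgue_on {a..b}) h" "{c..d} \<subseteq> {a..b}"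
  shows "h integrable_on {c..d}"
  using assms integrable_on_lebesgue_on integrable_on_subinterval by (metis lmeasurable_cbox box_real(2) fmeasurableD)

text \<open>The norm of \<open>h\<close> is at most the constant \<open>n\<close> plus the excess
  \<open>k\<close> over it: the first contributes at most \<open>n\<close> times the total length,
  the second at most its integral, which is small for large \<open>n\<close>.\<close>

lemma absolutely_continuous_on_indefinite_integral:
  fixes h :: "real \<Rightarrow> 'a::euclidean_space"
  assumes h: "integrable (lebesgue_on {a..b}) h"
    and x: "\<And>t. t \<in> {a..b} \<Longrightarrow> x t = c + integral {a..t} h"
  shows "absolutely_continuous_on {a..b} x"
  unfolding absolutely_continuous_on_def
proof (intro allI impI)
  fix \<epsilon> :: real assume "\<epsilon> > 0"
  then obtain n where n: "(LINT t|lebesgue_on {a..b}. max 0 (norm (h t) - real n)) < \<epsilon> / 2"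
    using integrable_tail_small[OF h, of "\<epsilon> / 2"] by auto
  define k where "k t = max 0 (norm (h t) - real n)" for t
  have k: "integrable (lebesgue_on {a..b}) k"
    unfolding k_def by (rule Bochner_Integration.integrable_bound[OF h]) (use h in auto)
  have ik: "integral {a..b} k < \<epsilon> / 2"
    using n lebesgue_integral_eq_integral[OF k] by (simp add: k_def [abs_def])
  show "\<exists>\<delta>>0. \<forall>d X. d division_of X \<and> X \<subseteq> {a..b} \<and> (\<Sum>I\<in>d. Sup I - Inf I) < \<delta> \<longrightarrow>
      (\<Sum>I\<in>d. norm (x (Sup I) - x (Inf I))) < \<epsilon>"
  \<comment> \<open>Half of \<epsilon> is reserved for the integral of \<open>k\<close>; the
    denominator \<open>n + 1\<close> also covers \<open>n = 0\<close>.\<close>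
  proof (rule exI[of _ "\<epsilon> / (2 * (real n + 1))"], intro conjI allI impI; (elim conjE)?)
    show "\<epsilon> / (2 * (real n + 1)) > 0"
      using \<open>\<epsilon> > 0\<close> by simp
    fix D X assume D: "D division_of X" and X: "X \<subseteq> {a..b}"
      and small: "(\<Sum>I\<in>D. Sup I - Inf I) < \<epsilon> / (2 * (real n + 1))"
    have kI: "k integrable_on I" if "I \<in> D" for I
      using division_ofD(2,4)[OF D that] X integrable_lebesgue_on_imp_integrable_on[OF k]
      by (metis box_real(2) subset_trans)
    have "(\<Sum>I\<in>D. norm (x (Sup I) - x (Inf I))) \<le> (\<Sum>I\<in>D. real n * (Sup I - Inf I) + integral I k)"
    proof (rule sum_mono)
      fix I assume I: "I \<in> D"
      obtain c1 c2 where I': "I = {c1..c2}" "c1 \<le> c2"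
        using division_ofD(3,4)[OF D I] by force
      have c12: "a \<le> c1" "c2 \<le> b"
        using division_ofD(2)[OF D I] X I' by (meson atLeastAtMost_iff atLeastatMost_subset_iff order_trans)+
      have hI: "h integrable_on {a..c2}" "h integrable_on {c1..c2}"
        using c12 I' by (auto intro!: integrable_lebesgue_on_imp_integrable_on[OF h])
      have "x c2 - x c1 = integral {c1..c2} h"
        using Henstock_Kurzweil_Integration.integral_combine[of a c1 c2 h] c12 I' hI
        by (simp add: x algebra_simps)
      also have "norm \<dots> \<le> integral {c1..c2} (\<lambda>t. real n + k t)"
      proof (rule integral_norm_bound_integral)
        show "(\<lambda>t. real n + k t) integrable_on {c1..c2}"
          using kI[OF I] I' by (auto intro!: integrable_add)
      qed (use hI in \<open>auto simp: k_def\<close>)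
      also have "\<dots> = real n * (c2 - c1) + integral {c1..c2} k"
        using kI[OF I] I' by (subst integral_add) auto
      finally show "norm (x (Sup I) - x (Inf I)) \<le> real n * (Sup I - Inf I) + integral I k"
        using I' by simp
    qed
    also have "\<dots> = real n * (\<Sum>I\<in>D. Sup I - Inf I) + integral X k"
      using integral_combine_division_bottomup[OF D kI] by (simp add: sum.distrib sum_distrib_left)
    also have "\<dots> \<le> real n * (\<epsilon> / (2 * (real n + 1))) + integral {a..b} k"
    proof (rule add_mono)
      show "integral X k \<le> integral {a..b} k"
        using integrable_combine_division[OF D kI] X integrable_lebesgue_on_imp_integrable_on[OF k order_refl]
        by (intro integral_subset_le) (auto simp: k_def)
    qed (use small in \<open>intro mult_left_mono, auto\<close>)
    also have "\<dots> < \<epsilon>"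
    proof -
      have "real n * (\<epsilon> / (2 * (real n + 1))) \<le> \<epsilon> / 2"
        using \<open>\<epsilon> > 0\<close> by (simp add: field_simps)
      then show ?thesis using ik by linarith
    qed
    finally show "(\<Sum>I\<in>D. norm (x (Sup I) - x (Inf I))) < \<epsilon>" .
  qed
qed

text \<open>Left-hand averages of \<open>h\<close> are right-hand averages of the reflected
  function, so the exceptional set is the union of one null set and the mirror image of
  another.\<close>

lemma Lebesgue_differentiation_real:
  fixes h :: "real \<Rightarrow> 'a::euclidean_space"
  assumes h: "\<And>c d. h integrable_on {c..d}"
  obtains N where "negligible N"
    "\<And>t e. t \<notin> N \<Longrightarrow> e > 0 \<Longrightarrow> \<exists>d>0. \<forall>s. 0 < s \<and> s < d \<longrightarrow>
        norm (integral {t..t+s} h /\<^sub>R s - h t) < e \<and> norm (integral {t-s..t} h /\<^sub>R s - h t) < e"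
proof -
  obtain N1 where N1: "negligible N1" "\<And>t e. t \<notin> N1 \<Longrightarrow> 0 < e \<Longrightarrow>
      \<exists>d>0. \<forall>s. 0 < s \<and> s < d \<longrightarrow> norm (integral {t..t+s} h /\<^sub>R s - h t) < e"
    using integrable_ccontinuous_explicit[of h] h by auto
  have h': "(\<lambda>t. h (- t)) integrable_on {c..d}" for c d
    using h[of "- d" "- c"] Henstock_Kurzweil_Integration.integrable_reflect_real[where f=h and a="-d" and b="-c"] by simp
  obtain N2 where N2: "negligible N2" "\<And>t e. t \<notin> N2 \<Longrightarrow> 0 < e \<Longrightarrow>
      \<exists>d>0. \<forall>s. 0 < s \<and> s < d \<longrightarrow> norm (integral {t..t+s} (\<lambda>t. h (- t)) /\<^sub>R s - h (- t)) < e"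
    using integrable_ccontinuous_explicit[of "\<lambda>t. h (- t)"] h' by auto
  have refl: "integral {-t..-t+s} (\<lambda>t. h (- t)) = integral {t-s..t} h" for t s
    using Henstock_Kurzweil_Integration.integral_reflect_real[where f=h and b=t and a="t - s"] by simp
  show ?thesis
  proof (rule that)
    show "negligible (N1 \<union> uminus ` N2)"
      using N1(1) N2(1) by (intro negligible_Un negligible_differentiable_image_negligible differentiable_on_minus differentiable_on_ident) auto
    fix t e :: real assume t: "t \<notin> N1 \<union> uminus ` N2" and "e > 0"
    then have "t \<notin> N1" "- t \<notin> N2"
      using image_eqI[of t uminus "- t" N2] by auto
    obtain d1 where d1: "d1 > 0" "\<forall>s. 0 < s \<and> s < d1 \<longrightarrow> norm (integral {t..t+s} h /\<^sub>R s - h t) < e"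
      using N1(2)[OF \<open>t \<notin> N1\<close> \<open>e > 0\<close>] by blast
    obtain d2 where d2: "d2 > 0" "\<forall>s. 0 < s \<and> s < d2 \<longrightarrow> norm (integral {t-s..t} h /\<^sub>R s - h t) < e"
      using N2(2)[OF \<open>- t \<notin> N2\<close> \<open>e > 0\<close>] unfolding refl by auto
    show "\<exists>d>0. \<forall>s. 0 < s \<and> s < d \<longrightarrow>
        norm (integral {t..t+s} h /\<^sub>R s - h t) < e \<and> norm (integral {t-s..t} h /\<^sub>R s - h t) < e"
      using d1 d2 by (intro exI[of _ "min d1 d2"]) auto
  qed
qed

lemma has_vector_derivative_indefinite_integral_AE:
  fixes h :: "real \<Rightarrow> 'a::euclidean_space"
  assumes h: "integrable (lebesgue_on {a..b}) h"
    and x: "\<And>t. t \<in> {a..b} \<Longrightarrow> x t = c + integral {a..t} h"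
  shows "AE t in lebesgue_on {a..b}. (x has_vector_derivative h t) (at t within {a..b})"
proof -
  \<comment> \<open>Extension by 0 makes the function integrable on every interval, as the
    differentiation theorem asks, and leaves integrals over subintervals of [a,b] unchanged.\<close>
  define h0 where "h0 t = (if t \<in> {a..b} then h t else 0)" for t
  have hab: "h integrable_on {a..b}"
    by (rule integrable_lebesgue_on_imp_integrable_on[OF h order_refl])
  have "h0 integrable_on UNIV"
    using hab Henstock_Kurzweil_Integration.integrable_restrict_UNIV[of "{a..b}" h] by (simp add: h0_def [abs_def])
  then have h0: "h0 integrable_on {c..d}" for c d
    by (metis box_real(2) integrable_on_subcbox subset_UNIV)
  obtain N where N: "negligible N" and ld: "\<And>t e. t \<notin> N \<Longrightarrow> e > 0 \<Longrightarrow> \<exists>d>0. \<forall>s. 0 < s \<and> s < d \<longrightarrow>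
        norm (integral {t..t+s} h0 /\<^sub>R s - h0 t) < e \<and> norm (integral {t-s..t} h0 /\<^sub>R s - h0 t) < e"
    using Lebesgue_differentiation_real[OF h0] by metis
  have incr: "x d - x c = integral {c..d} h0" if "c \<le> d" "c \<in> {a..b}" "d \<in> {a..b}" for c d
  proof -
    have "integral {a..c} h + integral {c..d} h = integral {a..d} h"
      using that by (intro Henstock_Kurzweil_Integration.integral_combine)
        (auto intro!: integrable_lebesgue_on_imp_integrable_on[OF h])
    moreover have "integral {c..d} h0 = integral {c..d} h"
      using that by (intro integral_cong) (auto simp: h0_def)
    ultimately show ?thesis
      using that by (simp add: x algebra_simps)
  qed
  have "(x has_vector_derivative h t) (at t within {a..b})" if t: "t \<in> {a..b} - N" for t
    unfolding has_vector_derivative_def has_derivative_within_alt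
  proof (intro conjI allI impI)
    show "bounded_linear (\<lambda>s. s *\<^sub>R h t)"
      by (rule bounded_linear_scaleR_left)
    fix e :: real assume "e > 0"
    obtain d where "d > 0" and d: "\<And>s. 0 < s \<Longrightarrow> s < d \<Longrightarrow> norm (integral {t..t+s} h0 /\<^sub>R s - h t) < e"
       "\<And>s. 0 < s \<Longrightarrow> s < d \<Longrightarrow> norm (integral {t-s..t} h0 /\<^sub>R s - h t) < e"
      using ld[of t e] t \<open>e > 0\<close> by (auto simp: h0_def)
    have "norm (x s - x t - (s - t) *\<^sub>R h t) \<le> e * norm (s - t)"
      if s: "s \<in> {a..b}" "norm (s - t) < d" for s
    proof -
      consider "s = t" | "s > t" | "s < t" by linarith
      then show ?thesis
      proof cases
        case 2
        have "x s - x t - (s - t) *\<^sub>R h t = (s - t) *\<^sub>R (integral {t..t+(s-t)} h0 /\<^sub>R (s - t) - h t)"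
          using incr[of t s] s t 2 by (simp add: scaleR_diff_right)
        then show ?thesis
          using d(1)[of "s - t"] 2 s by (auto simp: mult.commute intro!: mult_left_mono)
      next
        case 3
        have "x s - x t - (s - t) *\<^sub>R h t = (s - t) *\<^sub>R (integral {t-(t-s)..t} h0 /\<^sub>R (t - s) - h t)"
        proof -
          have "(s - t) * inverse (t - s) = -1"
            using 3 by (simp add: field_simps)
          then show ?thesis
            using incr[of s t] s t 3 by (simp add: scaleR_diff_right) (metis minus_diff_eq)
        qed
        then show ?thesis
          using d(2)[of "t - s"] 3 s by (auto simp: mult.commute intro!: mult_left_mono)
      qed auto
    qed
    then show "\<exists>d>0. \<forall>s\<in>{a..b}. norm (s - t) < d \<longrightarrow> norm (x s - x t - (s - t) *\<^sub>R h t) \<le> e * norm (s - t)"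
      using \<open>d > 0\<close> by blast
  qed
  then show ?thesis
    using N by (subst AE_lebesgue_on_iff_negligible) auto
qed

section \<open>Carath\'eodory differential equations\<close>

lemma absolutely_continuous_onE:
  assumes "absolutely_continuous_on S x" "\<epsilon> > 0"
  obtains \<delta> where "\<delta> > 0" "\<forall>D X. D division_of X \<longrightarrow> X \<subseteq> S \<longrightarrow> (\<Sum>I\<in>D. Sup I - Inf I) < \<delta> \<longrightarrow>
        (\<Sum>I\<in>D. norm (x (Sup I) - x (Inf I))) < \<epsilon>"
  using assms(1)[unfolded absolutely_continuous_on_def, rule_format, OF assms(2)]
  by (elim exE conjE, intro that) auto

text \<open>Covers linear combinations and, with bounded factors, inner products by a single
  estimate on increments.\<close>

lemma absolutely_continuous_on_dominated:
  fixes x :: "real \<Rightarrow> 'a::euclidean_space" and y :: "real \<Rightarrow> 'b::euclidean_space"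
    and z :: "real \<Rightarrow> 'c::euclidean_space"
  assumes x: "absolutely_continuous_on S x" and y: "absolutely_continuous_on S y"
    and le: "\<And>s t. s \<in> S \<Longrightarrow> t \<in> S \<Longrightarrow> norm (z t - z s) \<le> M * (norm (x t - x s) + norm (y t - y s))"
  shows "absolutely_continuous_on S z"
  unfolding absolutely_continuous_on_def
proof (intro allI impI)
  fix \<epsilon> :: real assume "\<epsilon> > 0"
  \<comment> \<open>The constant \<open>M\<close> may vanish or be negative;
    \<open>\<bar>M\<bar> + 1\<close> is a safe denominator and leaves a strict inequality.\<close>
  define e where "e = \<epsilon> / (2 * (\<bar>M\<bar> + 1))"
  have e: "e > 0" "\<bar>M\<bar> * (e + e) < \<epsilon>"
  proof -
    show "e > 0"
      using \<open>\<epsilon> > 0\<close> by (simp add: e_def)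
    have "(\<bar>M\<bar> + 1) * (e + e) = \<epsilon>"
      by (simp add: e_def divide_simps)
    then show "\<bar>M\<bar> * (e + e) < \<epsilon>"
      using \<open>e > 0\<close> by (simp add: algebra_simps)
  qed
  obtain d1 where d1: "d1 > 0" "\<forall>D X. D division_of X \<longrightarrow> X \<subseteq> S \<longrightarrow> (\<Sum>I\<in>D. Sup I - Inf I) < d1 \<longrightarrow>
        (\<Sum>I\<in>D. norm (x (Sup I) - x (Inf I))) < e"
    by (rule absolutely_continuous_onE[OF x e(1)])
  obtain d2 where d2: "d2 > 0" "\<forall>D X. D division_of X \<longrightarrow> X \<subseteq> S \<longrightarrow> (\<Sum>I\<in>D. Sup I - Inf I) < d2 \<longrightarrow>
        (\<Sum>I\<in>D. norm (y (Sup I) - y (Inf I))) < e"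
    by (rule absolutely_continuous_onE[OF y e(1)])
  have "(\<Sum>I\<in>D. norm (z (Sup I) - z (Inf I))) < \<epsilon>"
    if D: "D division_of X" "X \<subseteq> S" "(\<Sum>I\<in>D. Sup I - Inf I) < min d1 d2" for D X
  proof -
    have "(\<Sum>I\<in>D. norm (z (Sup I) - z (Inf I)))
        \<le> (\<Sum>I\<in>D. \<bar>M\<bar> * (norm (x (Sup I) - x (Inf I)) + norm (y (Sup I) - y (Inf I))))"
    proof (rule sum_mono)
      fix I assume I: "I \<in> D"
      obtain c c' where I': "I = {c..c'}" "c \<le> c'"
        using division_ofD(3,4)[OF D(1) I] by force
      then have "Inf I \<in> S" "Sup I \<in> S"
        using division_ofD(2)[OF D(1) I] D(2) by auto
      then have "norm (z (Sup I) - z (Inf I)) \<le> M * (norm (x (Sup I) - x (Inf I)) + norm (y (Sup I) - y (Inf I)))"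
        by (rule le)
      also have "\<dots> \<le> \<bar>M\<bar> * (norm (x (Sup I) - x (Inf I)) + norm (y (Sup I) - y (Inf I)))"
        by (intro mult_right_mono) auto
      finally show "norm (z (Sup I) - z (Inf I)) \<le> \<dots>" .
    qed
    also have "\<dots> = \<bar>M\<bar> * ((\<Sum>I\<in>D. norm (x (Sup I) - x (Inf I))) + (\<Sum>I\<in>D. norm (y (Sup I) - y (Inf I))))"
      by (simp add: sum_distrib_left [symmetric] sum.distrib)
    also have "\<dots> \<le> \<bar>M\<bar> * (e + e)"
      using d1(2)[rule_format, OF D(1,2)] d2(2)[rule_format, OF D(1,2)] D(3) by (intro mult_left_mono add_mono) auto
    finally show ?thesis
      using e(2) by linarith
  qed
  then show "\<exists>\<delta>>0. \<forall>d X. d division_of X \<and> X \<subseteq> S \<and> (\<Sum>I\<in>d. Sup I - Inf I) < \<delta> \<longrightarrow>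
      (\<Sum>I\<in>d. norm (z (Sup I) - z (Inf I))) < \<epsilon>"
    using d1(1) d2(1) by (intro exI[of _ "min d1 d2"] conjI allI impI; (elim conjE)?) simp_all
qed

lemma absolutely_continuous_on_subset:
  assumes "absolutely_continuous_on S x" "S' \<subseteq> S"
  shows "absolutely_continuous_on S' x"
  unfolding absolutely_continuous_on_def
proof (intro allI impI)
  fix \<epsilon> :: real assume "\<epsilon> > 0"
  obtain \<delta> where "\<delta> > 0" "\<forall>D X. D division_of X \<longrightarrow> X \<subseteq> S \<longrightarrow> (\<Sum>I\<in>D. Sup I - Inf I) < \<delta> \<longrightarrow>
        (\<Sum>I\<in>D. norm (x (Sup I) - x (Inf I))) < \<epsilon>"
    by (rule absolutely_continuous_onE[OF assms(1) \<open>\<epsilon> > 0\<close>])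
  then show "\<exists>\<delta>>0. \<forall>d X. d division_of X \<and> X \<subseteq> S' \<and> (\<Sum>I\<in>d. Sup I - Inf I) < \<delta> \<longrightarrow>
      (\<Sum>I\<in>d. norm (x (Sup I) - x (Inf I))) < \<epsilon>"
    using assms(2) by (intro exI[of _ \<delta>]) auto
qed

lemma absolutely_continuous_on_imp_continuous_on:
  fixes x :: "real \<Rightarrow> 'a::euclidean_space"
  assumes "absolutely_continuous_on {a..b} x"
  shows "continuous_on {a..b} x"
  unfolding continuous_on_iff
proof (intro ballI allI impI)
  fix t e :: real assume t: "t \<in> {a..b}" and "e > 0"
  obtain \<delta> where "\<delta> > 0" and \<delta>: "\<forall>D X. D division_of X \<longrightarrow> X \<subseteq> {a..b} \<longrightarrow>
      (\<Sum>I\<in>D. Sup I - Inf I) < \<delta> \<longrightarrow> (\<Sum>I\<in>D. norm (x (Sup I) - x (Inf I))) < e"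
    by (rule absolutely_continuous_onE[OF assms \<open>e > 0\<close>])
  have *: "norm (x d - x c) < e" if "c \<in> {a..b}" "d \<in> {a..b}" "c \<le> d" "d - c < \<delta>" for c d
    using \<delta>[rule_format, of "{{c..d}}" "{c..d}"] that division_of_self[of c d] by simp
  have "dist (x s) (x t) < e" if "s \<in> {a..b}" "dist s t < \<delta>" for s
    using *[of s t] *[of t s] that t by (cases "s \<le> t") (auto simp: dist_norm norm_minus_commute)
  then show "\<exists>d>0. \<forall>x'\<in>{a..b}. dist x' t < d \<longrightarrow> dist (x x') (x t) < e"
    using \<open>\<delta> > 0\<close> by blast
qed

lemma AE_lebesgue_on_subset:
  fixes S :: "'a::euclidean_space set"
  assumes "AE t in lebesgue_on S. P t" "S' \<subseteq> S" "S \<in> sets lebesgue" "S' \<in> sets lebesgue"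
  shows "AE t in lebesgue_on S'. P t"
  using assms by (auto simp: AE_lebesgue_on_iff_negligible)

text \<open>Integrability of the right-hand side along a solution is a consequence rather than a
  condition: it comes with the fundamental theorem.\<close>

lemma solves_ode_ae_imp_has_integral:
  fixes x :: "real \<Rightarrow> 'a::euclidean_space"
  assumes sol: "solves_ode_ae T F x" and "0 \<le> s" "s \<le> t" "t \<le> T"
  shows "((\<lambda>r. F r (x r)) has_integral x t - x s) {s..t}"
proof (rule absolutely_continuous_on_imp_has_integral)
  have sub: "{s..t} \<subseteq> {0..T}" using assms by auto
  show "absolutely_continuous_on {s..t} x"
    using sol absolutely_continuous_on_subset[OF _ sub] by (auto simp: solves_ode_ae_def)
  have "AE r in lebesgue_on {s..t}. (x has_vector_derivative F r (x r)) (at r within {0..T})"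
    using sol by (intro AE_lebesgue_on_subset[OF _ sub]) (auto simp: solves_ode_ae_def)
  then show "AE r in lebesgue_on {s..t}. (x has_vector_derivative F r (x r)) (at r within {s..t})"
    by eventually_elim (rule has_vector_derivative_within_subset[OF _ sub])
qed fact

lemma solves_ode_ae_imp_continuous_on:
  fixes x :: "real \<Rightarrow> 'a::euclidean_space"
  shows "solves_ode_ae T F x \<Longrightarrow> continuous_on {0..T} x"
  by (simp add: solves_ode_ae_def absolutely_continuous_on_imp_continuous_on)

lemma solves_ode_aeI:
  fixes x :: "real \<Rightarrow> 'a::euclidean_space"
  assumes "integrable (lebesgue_on {0..T}) (\<lambda>t. F t (x t))"
    and "\<And>t. t \<in> {0..T} \<Longrightarrow> x t = c + integral {0..t} (\<lambda>s. F s (x s))"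
  shows "solves_ode_ae T F x"
  unfolding solves_ode_ae_def
  by (intro conjI absolutely_continuous_on_indefinite_integral[OF assms]
      has_vector_derivative_indefinite_integral_AE[OF assms])

text \<open>The combined right-hand side ignores its state argument: the two vector fields are
  frozen along the given solutions. Hence \<open>F\<close> and \<open>G\<close> may be nonlinear,
  which covers differences and Taylor remainders of states and adjoints.\<close>

lemma solves_ode_ae_linear_combination:
  fixes x y :: "real \<Rightarrow> 'a::euclidean_space"
  assumes x: "solves_ode_ae T F x" and y: "solves_ode_ae T G y"
  shows "solves_ode_ae T (\<lambda>t _. F t (x t) + c *\<^sub>R G t (y t)) (\<lambda>t. x t + c *\<^sub>R y t)"
  unfolding solves_ode_ae_def
proof
  show "absolutely_continuous_on {0..T} (\<lambda>t. x t + c *\<^sub>R y t)"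
  proof (rule absolutely_continuous_on_dominated)
    fix s t
    have "norm (x t + c *\<^sub>R y t - (x s + c *\<^sub>R y s)) = norm ((x t - x s) + c *\<^sub>R (y t - y s))"
      by (simp add: algebra_simps)
    also have "\<dots> \<le> norm (x t - x s) + \<bar>c\<bar> * norm (y t - y s)"
      by (rule order_trans[OF norm_triangle_ineq]) simp
    also have "\<dots> \<le> (1 + \<bar>c\<bar>) * (norm (x t - x s) + norm (y t - y s))"
      by (simp add: algebra_simps add_nonneg_nonneg)
    finally show "norm (x t + c *\<^sub>R y t - (x s + c *\<^sub>R y s)) \<le> \<dots>" .
  qed (use x y in \<open>auto simp: solves_ode_ae_def\<close>)
  have "AE t in lebesgue_on {0..T}. (x has_vector_derivative F t (x t)) (at t within {0..T})"
    "AE t in lebesgue_on {0..T}. (y has_vector_derivative G t (y t)) (at t within {0..T})"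
    using x y by (auto simp: solves_ode_ae_def)
  then show "AE t in lebesgue_on {0..T}. ((\<lambda>t. x t + c *\<^sub>R y t) has_vector_derivative
      F t (x t) + c *\<^sub>R G t (y t)) (at t within {0..T})"
    by eventually_elim (auto intro!: derivative_eq_intros)
qed

lemma solves_ode_ae_diff:
  fixes x y :: "real \<Rightarrow> 'a::euclidean_space"
  assumes "solves_ode_ae T F x" "solves_ode_ae T G y"
  shows "solves_ode_ae T (\<lambda>t _. F t (x t) - G t (y t)) (\<lambda>t. x t - y t)"
  using solves_ode_ae_linear_combination[OF assms, of "-1"] by simp

text \<open>The product rule behind both duality formulas. A product of absolutely continuous
  functions is absolutely continuous because both factors are bounded on the compact
  interval.\<close>

lemma solves_ode_ae_inner:
  fixes x y :: "real \<Rightarrow> 'a::euclidean_space"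
  assumes x: "solves_ode_ae T F x" and y: "solves_ode_ae T G y"
  shows "solves_ode_ae T (\<lambda>t _. x t \<bullet> G t (y t) + F t (x t) \<bullet> y t) (\<lambda>t. x t \<bullet> y t)"
  unfolding solves_ode_ae_def
proof
  have "bounded (x ` {0..T})" "bounded (y ` {0..T})"
    using x y by (auto intro!: compact_imp_bounded compact_continuous_image solves_ode_ae_imp_continuous_on)
  then obtain B C where B: "\<And>t. t \<in> {0..T} \<Longrightarrow> norm (x t) \<le> B" and C: "\<And>t. t \<in> {0..T} \<Longrightarrow> norm (y t) \<le> C"
    unfolding bounded_iff by (auto simp del: atLeastAtMost_iff)
  show "absolutely_continuous_on {0..T} (\<lambda>t. x t \<bullet> y t)"
  proof (rule absolutely_continuous_on_dominated)
    fix s t assume st: "s \<in> {0..T}" "t \<in> {0..T}"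
    have "norm (x t \<bullet> y t - x s \<bullet> y s) = norm ((x t - x s) \<bullet> y t + x s \<bullet> (y t - y s))"
      by (simp add: algebra_simps)
    also have "\<dots> \<le> norm (x t - x s) * norm (y t) + norm (x s) * norm (y t - y s)"
      by (rule order_trans[OF norm_triangle_ineq]) (auto intro!: add_mono Cauchy_Schwarz_ineq2)
    also have "\<dots> \<le> norm (x t - x s) * max B C + max B C * norm (y t - y s)"
      using B[OF st(1)] C[OF st(2)] by (intro add_mono mult_left_mono mult_right_mono) auto
    finally show "norm (x t \<bullet> y t - x s \<bullet> y s) \<le> max B C * (norm (x t - x s) + norm (y t - y s))"
      by (simp add: algebra_simps)
  qed (use x y in \<open>auto simp: solves_ode_ae_def\<close>)
  have "AE t in lebesgue_on {0..T}. (x has_vector_derivative F t (x t)) (at t within {0..T})"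
    "AE t in lebesgue_on {0..T}. (y has_vector_derivative G t (y t)) (at t within {0..T})"
    using x y by (auto simp: solves_ode_ae_def)
  then show "AE t in lebesgue_on {0..T}. ((\<lambda>t. x t \<bullet> y t) has_vector_derivative
      x t \<bullet> G t (y t) + F t (x t) \<bullet> y t) (at t within {0..T})"
    by eventually_elim (rule bounded_bilinear.has_vector_derivative[OF bounded_bilinear_inner])
qed

section \<open>Gronwall's inequality and solvability, for initial and terminal values alike\<close>

definition oriented_interval :: "real \<Rightarrow> bool \<Rightarrow> real \<Rightarrow> real set" where
  "oriented_interval T fwd t = (if fwd then {0..t} else {t..T})"

text \<open>The Bielecki weight: for a positive rate it grows away from the end at which the value
  is prescribed, which is 0 for the state (\<open>fwd\<close>) and T for the adjoint. The same flag
  selects the interval of integration in \<open>oriented_interval\<close>.\<close>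

definition exp_weight :: "real \<Rightarrow> bool \<Rightarrow> real \<Rightarrow> real \<Rightarrow> real" where
  "exp_weight T fwd l t = exp (l * (if fwd then t else T - t))"

lemma oriented_interval_subset: "t \<in> {0..T} \<Longrightarrow> oriented_interval T fwd t \<subseteq> {0..T}"
  by (auto simp: oriented_interval_def)

lemma integrable_on_oriented_interval:
  fixes h :: "real \<Rightarrow> 'a::euclidean_space"
  assumes "h integrable_on {0..T}" "t \<in> {0..T}"
  shows "h integrable_on oriented_interval T fwd t"
  using assms by (auto simp: oriented_interval_def intro: integrable_on_subinterval)

lemma continuous_on_integral_oriented_interval:
  fixes h :: "real \<Rightarrow> 'a::euclidean_space"
  assumes "h integrable_on {0..T}"
  shows "continuous_on {0..T} (\<lambda>t. integral (oriented_interval T fwd t) h)"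
  using indefinite_integral_continuous_1[OF assms] indefinite_integral_continuous_1'[OF assms]
  by (cases fwd) (simp_all add: oriented_interval_def)

lemma exp_weight_pos [simp]: "exp_weight T fwd l t > 0" "exp_weight T fwd l t \<ge> 0" "exp_weight T fwd l t \<noteq> 0"
  by (simp_all add: exp_weight_def)

lemma continuous_on_exp_weight [continuous_intros]: "continuous_on S (exp_weight T fwd l)"
  by (cases fwd) (auto simp: exp_weight_def [abs_def] intro!: continuous_intros)

text \<open>Integration gains the factor \<open>1 / l\<close>, so a large rate \<open>l\<close>
  makes the integral operator small in the weighted norm whatever the length T.\<close>

lemma integral_exp_weight_le:
  assumes "l > 0" "t \<in> {0..T}"
  shows "integral (oriented_interval T fwd t) (exp_weight T fwd l) \<le> exp_weight T fwd l t / l"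
proof (cases fwd)
  case True
  have "((\<lambda>s. exp (l * s)) has_integral exp (l * t) / l - exp (l * 0) / l) {0..t}"
    using assms by (intro fundamental_theorem_of_calculus)
      (auto intro!: derivative_eq_intros simp: has_real_derivative_iff_has_vector_derivative [symmetric])
  then show ?thesis
    using True assms by (simp add: oriented_interval_def exp_weight_def [abs_def] integral_unique)
next
  case False
  have "((\<lambda>s. exp (l * (T - s))) has_integral - exp (l * (T - T)) / l - - exp (l * (T - t)) / l) {t..T}"
    using assms by (intro fundamental_theorem_of_calculus)
      (auto intro!: derivative_eq_intros simp: has_real_derivative_iff_has_vector_derivative [symmetric])
  then show ?thesis
    using False assms by (simp add: oriented_interval_def exp_weight_def [abs_def] integral_unique)
qed

lemma exp_weight_le: "l \<ge> 0 \<Longrightarrow> t \<in> {0..T} \<Longrightarrow> exp_weight T fwd l t \<le> exp (l * T)"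
  by (auto simp: exp_weight_def intro!: mult_left_mono)

lemma exp_weight_ge_1: "l \<ge> 0 \<Longrightarrow> t \<in> {0..T} \<Longrightarrow> exp_weight T fwd l t \<ge> 1"
  by (auto simp: exp_weight_def)

text \<open>The maximum \<open>M\<close> of \<open>|x|\<close> relative to the weight \<open>exp (2Kt)\<close> satisfies
  \<open>M \<le> c + \<integral>r + M / 2\<close>.\<close>

lemma gronwall:
  fixes x :: "real \<Rightarrow> 'a::euclidean_space"
  assumes "K > 0" and cont: "continuous_on {0..T} x" and "c \<ge> 0"
    and r: "r integrable_on {0..T}" "\<And>t. t \<in> {0..T} \<Longrightarrow> r t \<ge> 0"
    and le: "\<And>t. t \<in> {0..T} \<Longrightarrow> norm (x t) \<le> c + integral (oriented_interval T fwd t) (\<lambda>s. K * norm (x s) + r s)"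
    and t: "t \<in> {0..T}"
  shows "norm (x t) \<le> 2 * exp (2 * K * T) * (c + integral {0..T} r)"
proof -
  define W where "W = exp_weight T fwd (2 * K)"
  define q where "q t = norm (x t) / W t" for t
  have Wpos: "W t > 0" for t by (simp add: W_def)
  have "continuous_on {0..T} q"
    unfolding q_def W_def using cont by (intro continuous_intros) auto
  then obtain s where s: "s \<in> {0..T}" and max: "\<And>t. t \<in> {0..T} \<Longrightarrow> q t \<le> q s"
    using continuous_attains_sup[of "{0..T}" q] t by auto
  define M where "M = q s"
  have xM: "norm (x t) \<le> M * W t" if "t \<in> {0..T}" for t
    using max[OF that] Wpos[of t] by (simp add: M_def q_def field_simps)
  have "M \<ge> 0"
    using Wpos[of s] by (simp add: M_def q_def)
  let ?I = "oriented_interval T fwd s"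
  have rI: "r integrable_on ?I" "integral ?I r \<le> integral {0..T} r"
    using r s by (auto intro!: integrable_on_oriented_interval integral_subset_le oriented_interval_subset
        simp del: atLeastAtMost_iff)
  have WI: "W integrable_on ?I"
    unfolding W_def by (cases fwd)
      (auto simp: oriented_interval_def intro!: integrable_continuous_interval continuous_on_exp_weight)
  have xI: "(\<lambda>t. norm (x t)) integrable_on ?I"
    using s by (intro integrable_on_oriented_interval integrable_continuous_interval continuous_on_norm cont) auto
  have "integral ?I (\<lambda>t. K * norm (x t) + r t) \<le> integral ?I (\<lambda>t. (K * M) * W t + r t)"
  proof (rule integral_le)
    show "(\<lambda>t. K * norm (x t) + r t) integrable_on ?I" "(\<lambda>t. K * M * W t + r t) integrable_on ?I"
      using integrable_add[OF integrable_cmul[OF xI, of K] rI(1)] integrable_add[OF integrable_cmul[OF WI, of "K * M"] rI(1)]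
      by simp_all
    fix t assume "t \<in> ?I"
    then have "t \<in> {0..T}" using oriented_interval_subset[OF s] by blast
    then show "K * norm (x t) + r t \<le> K * M * W t + r t"
      using xM \<open>K > 0\<close> by (simp add: mult.assoc)
  qed
  also have "\<dots> = (K * M) * integral ?I W + integral ?I r"
    using integrable_cmul[OF WI, of "K * M"] rI by (subst integral_add) auto
  also have "\<dots> \<le> (K * M) * (W s / (2 * K)) + integral {0..T} r"
    using rI(2) integral_exp_weight_le[OF _ s, of "2 * K" fwd] \<open>K > 0\<close> \<open>M \<ge> 0\<close>
    by (intro add_mono mult_left_mono) (auto simp: W_def)
  also have "(K * M) * (W s / (2 * K)) = norm (x s) / 2"
    using \<open>K > 0\<close> Wpos[of s] by (simp add: M_def q_def)
  finally have "norm (x s) \<le> c + (norm (x s) / 2 + integral {0..T} r)"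
    by (rule order_trans[OF le[OF s] add_left_mono])
  then have "norm (x s) \<le> 2 * (c + integral {0..T} r)"
    by simp
  \<comment> \<open>The weight is at least 1, so dividing by it cannot increase the value at the
    maximizer \<open>s\<close>.\<close>
  moreover have "M \<le> norm (x s)"
    using exp_weight_ge_1[of "2 * K" s T fwd] s \<open>K > 0\<close> mult_left_mono[of 1 "W s" "norm (x s)"] Wpos[of s]
    by (simp add: M_def q_def W_def field_simps)
  ultimately have "M \<le> 2 * (c + integral {0..T} r)"
    by linarith
  then have "norm (x t) \<le> 2 * (c + integral {0..T} r) * W t"
    using xM[OF t] Wpos[of t] by (meson mult_right_mono order_less_imp_le order_trans)
  also have "\<dots> \<le> 2 * (c + integral {0..T} r) * exp (2 * K * T)"
  proof (rule mult_left_mono)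
    show "W t \<le> exp (2 * K * T)"
      unfolding W_def using \<open>K > 0\<close> by (intro exp_weight_le t) simp
    show "0 \<le> 2 * (c + integral {0..T} r)"
      using \<open>c \<ge> 0\<close> Henstock_Kurzweil_Integration.integral_nonneg[OF r] by simp
  qed
  finally show ?thesis
    by (simp add: algebra_simps)
qed

text \<open>Gronwall in the form used for all later estimates. Only a linear growth bound along this
  one solution enters, so it applies to differences and Taylor remainders as well; \<open>r\<close>
  is the forcing term and \<open>fwd\<close> tells at which end \<open>x\<close> is known.\<close>

lemma solves_ode_ae_bound:
  fixes x :: "real \<Rightarrow> 'a::euclidean_space"
  assumes sol: "solves_ode_ae T F x" and "K > 0"
    and r: "integrable (lebesgue_on {0..T}) r" "\<And>t. t \<in> {0..T} \<Longrightarrow> r t \<ge> 0"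
    and le: "AE t in lebesgue_on {0..T}. norm (F t (x t)) \<le> K * norm (x t) + r t"
    and t: "t \<in> {0..T}"
  shows "norm (x t) \<le> 2 * exp (2 * K * T) * (norm (x (if fwd then 0 else T)) + (LINT t|lebesgue_on {0..T}. r t))"
proof -
  obtain N where N: "negligible N" "\<And>t. t \<in> {0..T} - N \<Longrightarrow> norm (F t (x t)) \<le> K * norm (x t) + r t"
    using le by (auto simp: AE_lebesgue_on_iff_negligible)
  \<comment> \<open>Zero on the exceptional set, so that the growth bound holds at every point while
    the integral is unchanged.\<close>
  define h where "h t = (if t \<in> N then 0 else F t (x t))" for t
  have cont: "continuous_on {0..T} x"
    using sol by (rule solves_ode_ae_imp_continuous_on)
  have ri: "r integrable_on {0..T}" "(LINT t|lebesgue_on {0..T}. r t) = integral {0..T} r"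
    using r integrable_lebesgue_on_imp_integrable_on[OF r(1) order_refl] lebesgue_integral_eq_integral[OF r(1)] by auto
  have hi: "(h has_integral x d - x c) {c..d}" if "0 \<le> c" "c \<le> d" "d \<le> T" for c d
    by (rule has_integral_spike[OF N(1) _ solves_ode_ae_imp_has_integral[OF sol that]]) (simp add: h_def)
  have gi: "(\<lambda>s. K * norm (x s) + r s) integrable_on {0..T}"
    by (intro integrable_add ri integrable_continuous_interval continuous_intros cont)
  have hb: "norm (x d - x c) \<le> integral {c..d} (\<lambda>s. K * norm (x s) + r s)" if "0 \<le> c" "c \<le> d" "d \<le> T" for c d
  proof -
    have "norm (integral {c..d} h) \<le> integral {c..d} (\<lambda>s. K * norm (x s) + r s)"
    proof (rule Henstock_Kurzweil_Integration.integral_norm_bound_integral)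
      show "(\<lambda>s. K * norm (x s) + r s) integrable_on {c..d}"
        using that by (intro integrable_on_subinterval[OF gi]) auto
      show "norm (h s) \<le> K * norm (x s) + r s" if "s \<in> {c..d}" for s
        using N(2)[of s] r(2)[of s] that \<open>0 \<le> c\<close> \<open>d \<le> T\<close> \<open>K > 0\<close> by (auto simp: h_def)
    qed (use hi[OF that] in auto)
    then show ?thesis
      using hi[OF that] by (simp add: integral_unique)
  qed
  show ?thesis unfolding ri(2)
  proof (rule gronwall[OF \<open>K > 0\<close> cont _ ri(1) r(2) _ t, of _ fwd])
    fix s assume s: "s \<in> {0..T}"
    show "norm (x s) \<le> norm (x (if fwd then 0 else T))
        + integral (oriented_interval T fwd s) (\<lambda>s. K * norm (x s) + r s)"
    proof (cases fwd)
      case True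
      then show ?thesis
        using hb[of 0 s] s norm_triangle_sub[of "x s" "x 0"] by (auto simp: oriented_interval_def)
    next
      case False
      then show ?thesis
        using hb[of s T] s norm_triangle_sub[of "x s" "x T"]
        by (auto simp: oriented_interval_def norm_minus_commute)
    qed
  qed auto
qed


text \<open>Banach's fixed point theorem for the unknown \<open>x / W\<close>, with \<open>W\<close>
  the exponential weight: the weighted norm of \<open>x\<close> becomes the ordinary supremum norm.
  The factor \<sigma> will be 1 for initial and -1 for terminal values.\<close>

lemma caratheodory_integral_equation:
  fixes F :: "real \<Rightarrow> 'a::euclidean_space \<Rightarrow> 'a"
  assumes "T \<ge> 0" "K > 0"
    and int: "\<And>w. continuous_on {0..T} w \<Longrightarrow> integrable (lebesgue_on {0..T}) (\<lambda>s. F s (w s))"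
    and lip: "\<And>t \<xi> \<eta>. t \<in> {0..T} \<Longrightarrow> norm (F t \<xi> - F t \<eta>) \<le> K * norm (\<xi> - \<eta>)"
  obtains x where "continuous_on {0..T} x"
    "\<forall>t\<in>{0..T}. x t = c + \<sigma> *\<^sub>R integral (oriented_interval T fwd t) (\<lambda>s. F s (x s))"
proof -
  \<comment> \<open>With this rate the map contracts by the factor 1/2, since \<bar>\<sigma>\<bar> K
    / L is below 1/2.\<close>
  define L where "L = 2 * K * (\<bar>\<sigma>\<bar> + 1)"
  have "L > 0" using \<open>K > 0\<close> by (simp add: L_def)
  define W where "W = exp_weight T fwd L"
  have W: "W t > 0" "W t \<noteq> 0" "continuous_on S W" for t S
    by (auto simp: W_def intro: continuous_on_exp_weight)
  \<comment> \<open>Clamping to [0,T] extends a continuous function on the interval to a bounded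
    continuous function on the whole line, so that the complete space of the latter can be
    used.\<close>
  define cl where "cl t = max 0 (min t T)" for t :: real
  have cl: "cl t \<in> {0..T}" "continuous_on UNIV cl" for t
    using \<open>T \<ge> 0\<close> by (auto simp: cl_def [abs_def] intro!: continuous_intros)
  have cl_id: "cl t = t" if "t \<in> {0..T}" for t
    using that by (auto simp: cl_def)
  define h where "h w s = F s (W s *\<^sub>R apply_bcontfun w s)" for w :: "real \<Rightarrow>\<^sub>C 'a" and s
  have hi: "h w integrable_on {0..T}" for w
    unfolding h_def using integrable_lebesgue_on_imp_integrable_on[OF int order_refl]
    by (intro integrable_lebesgue_on_imp_integrable_on[OF int order_refl] continuous_intros W) auto
  define \<Phi> where "\<Phi> w t = (c + \<sigma> *\<^sub>R integral (oriented_interval T fwd t) (h w)) /\<^sub>R W t" for w t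
  have cont\<Phi>: "continuous_on {0..T} (\<Phi> w)" for w
    unfolding \<Phi>_def using W
    by (intro continuous_intros continuous_on_integral_oriented_interval hi) auto
  have \<Phi>: "(\<lambda>t. \<Phi> w (cl t)) \<in> bcontfun" for w
    unfolding bcontfun_def
  proof (intro CollectI conjI)
    show "continuous_on UNIV (\<lambda>t. \<Phi> w (cl t))"
      by (rule continuous_on_compose2[OF cont\<Phi> cl(2)]) (use cl in auto)
    have "bounded (\<Phi> w ` {0..T})"
      by (intro compact_imp_bounded compact_continuous_image cont\<Phi>) auto
    then show "bounded (range (\<lambda>t. \<Phi> w (cl t)))"
      by (rule bounded_subset) (use cl in auto)
  qed
  define P where "P w = Bcontfun (\<lambda>t. \<Phi> w (cl t))" for w
  have P: "apply_bcontfun (P w) t = \<Phi> w (cl t)" for w t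
    unfolding P_def by (simp add: Bcontfun_inverse[OF \<Phi>])
  have "\<exists>!w. P w = w"
  proof (rule banach_fix_type[of "1 / 2"])
    show "\<forall>w w'. dist (P w) (P w') \<le> 1 / 2 * dist w w'"
    proof (intro allI dist_bound)
      fix w w' t
      define s where "s = cl t"
      have s: "s \<in> {0..T}" unfolding s_def by (rule cl)
      let ?I = "oriented_interval T fwd s"
      have I: "h w integrable_on ?I" "h w' integrable_on ?I" "W integrable_on ?I"
        by (intro integrable_on_oriented_interval s hi integrable_continuous_interval W)+
      have "norm (integral ?I (\<lambda>r. h w r - h w' r)) \<le> integral ?I (\<lambda>r. (K * dist w w') * W r)"
      proof (rule Henstock_Kurzweil_Integration.integral_norm_bound_integral)
        fix r assume "r \<in> ?I"
        then have "r \<in> {0..T}" using oriented_interval_subset[OF s] by blast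
        then have "norm (h w r - h w' r) \<le> K * norm (W r *\<^sub>R apply_bcontfun w r - W r *\<^sub>R apply_bcontfun w' r)"
          unfolding h_def by (rule lip)
        also have "\<dots> = K * (W r * dist (apply_bcontfun w r) (apply_bcontfun w' r))"
          using W(1)[of r] by (simp add: dist_norm scaleR_diff_right [symmetric])
        also have "\<dots> \<le> K * (W r * dist w w')"
          using \<open>K > 0\<close> W(1)[of r] dist_bounded by (intro mult_left_mono) auto
        finally show "norm (h w r - h w' r) \<le> K * dist w w' * W r"
          by (simp add: mult_ac)
      qed (use I in \<open>auto intro!: integrable_diff integrable_on_mult_right\<close>)
      also have "\<dots> = (K * dist w w') * integral ?I W"
        by simp
      also have "\<dots> \<le> (K * dist w w') * (W s / L)"
        using integral_exp_weight_le[OF \<open>L > 0\<close> s, of fwd] \<open>K > 0\<close> by (intro mult_left_mono) (auto simp: W_def)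
      finally have le: "norm (integral ?I (h w) - integral ?I (h w')) \<le> (K * dist w w') * (W s / L)"
        using I by (simp add: integral_diff)
      have "dist (apply_bcontfun (P w) t) (apply_bcontfun (P w') t)
          = norm ((\<sigma> / W s) *\<^sub>R (integral ?I (h w) - integral ?I (h w')))"
        unfolding P \<Phi>_def s_def [symmetric] dist_norm by (simp add: algebra_simps divide_inverse)
      also have "\<dots> = \<bar>\<sigma>\<bar> / W s * norm (integral ?I (h w) - integral ?I (h w'))"
        using W(1)[of s] by simp
      also have "\<dots> \<le> \<bar>\<sigma>\<bar> / W s * ((K * dist w w') * (W s / L))"
        using le W(1)[of s] by (intro mult_left_mono) auto
      also have "\<dots> = (\<bar>\<sigma>\<bar> / (\<bar>\<sigma>\<bar> + 1)) * (1 / 2 * dist w w')"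
        using W(1)[of s] \<open>K > 0\<close> by (simp add: L_def)
      also have "\<dots> \<le> 1 * (1 / 2 * dist w w')"
        by (intro mult_right_mono) auto
      finally show "dist (apply_bcontfun (P w) t) (apply_bcontfun (P w') t) \<le> 1 / 2 * dist w w'"
        by simp
    qed
  qed auto
  then obtain w where "P w = w" by blast
  then have w: "apply_bcontfun w t = \<Phi> w t" if "t \<in> {0..T}" for t
    using P[of w t] cl_id[OF that] by simp
  show ?thesis
  proof (rule that[of "\<lambda>t. W t *\<^sub>R apply_bcontfun w t"])
    show "continuous_on {0..T} (\<lambda>t. W t *\<^sub>R apply_bcontfun w t)"
      by (intro continuous_intros W) auto
    show "\<forall>t\<in>{0..T}. W t *\<^sub>R apply_bcontfun w t = c + \<sigma> *\<^sub>R integral (oriented_interval T fwd t)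
        (\<lambda>s. F s (W s *\<^sub>R apply_bcontfun w s))"
      using w W(2) by (simp add: \<Phi>_def h_def [abs_def])
  qed
qed

lemma solves_ode_ae_exists:
  fixes F :: "real \<Rightarrow> 'a::euclidean_space \<Rightarrow> 'a"
  assumes "T \<ge> 0" "K > 0"
    and int: "\<And>w. continuous_on {0..T} w \<Longrightarrow> integrable (lebesgue_on {0..T}) (\<lambda>s. F s (w s))"
    and lip: "\<And>t \<xi> \<eta>. t \<in> {0..T} \<Longrightarrow> norm (F t \<xi> - F t \<eta>) \<le> K * norm (\<xi> - \<eta>)"
  shows "\<exists>x. solves_ode_ae T F x \<and> x (if fwd then 0 else T) = c"
proof -
  obtain x where cont: "continuous_on {0..T} x" and
    x': "\<forall>t\<in>{0..T}. x t = c + (if fwd then 1 else -1) *\<^sub>R integral (oriented_interval T fwd t) (\<lambda>s. F s (x s))"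
    by (rule caratheodory_integral_equation[OF assms])
  note x = x'[rule_format]
  have Fx: "integrable (lebesgue_on {0..T}) (\<lambda>s. F s (x s))"
    by (rule int[OF cont])
  \<comment> \<open>A solution of the backward integral equation is rewritten as an integral from 0,
    the form to which the results on indefinite integrals apply.\<close>
  have "x t = (if fwd then c else x 0) + integral {0..t} (\<lambda>s. F s (x s))" if t: "t \<in> {0..T}" for t
  proof (cases fwd)
    case True
    then show ?thesis using x[OF t] by (simp add: oriented_interval_def)
  next
    case False
    have "integral {0..t} (\<lambda>s. F s (x s)) + integral {t..T} (\<lambda>s. F s (x s)) = integral {0..T} (\<lambda>s. F s (x s))"
      using t Fx by (intro Henstock_Kurzweil_Integration.integral_combine integrable_lebesgue_on_imp_integrable_on) auto
    then show ?thesis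
      using False x[OF t] x[of 0] \<open>T \<ge> 0\<close> by (simp add: oriented_interval_def algebra_simps) (metis add.assoc add_right_cancel)
  qed
  then have "solves_ode_ae T F x"
    by (intro solves_ode_aeI[where F=F and x=x] Fx)
  moreover have "x (if fwd then 0 else T) = c"
    using x[of 0] x[of T] \<open>T \<ge> 0\<close> by (auto simp: oriented_interval_def)
  ultimately show ?thesis by blast
qed

section \<open>The spaces \<open>L\<^sup>\<beta>\<close>\<close>

lemma finite_measure_lebesgue_on_Icc: "finite_measure (lebesgue_on {0..T::real})"
  by (rule finite_measureI) (simp add: emeasure_restrict_space emeasure_lborel_Icc_eq)

lemma integrable_const_lebesgue_on_Icc [simp]: "integrable (lebesgue_on {0..T::real}) (\<lambda>_. c::real)"
  by (rule finite_measure.integrable_const[OF finite_measure_lebesgue_on_Icc])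

lemma LINT_const_lebesgue_on_Icc: "T \<ge> 0 \<Longrightarrow> (LINT t|lebesgue_on {0..T}. c) = T * (c::real)"
  by (simp add: measure_restrict_space)

lemma Lspace_2_iff:
  "u \<in> Lspace T 2 \<longleftrightarrow> u \<in> borel_measurable (lebesgue_on {0..T}) \<and>
     integrable (lebesgue_on {0..T}) (\<lambda>t. (norm (u t))\<^sup>2)"
  by (simp add: Lspace_def powr_numeral)

lemma Lnorm_2: "Lnorm T 2 u = sqrt (LINT t|lebesgue_on {0..T}. (norm (u t))\<^sup>2)"
  by (simp add: Lnorm_def powr_numeral powr_half_sqrt)

lemma Lspace_measurable: "u \<in> Lspace T \<beta> \<Longrightarrow> u \<in> borel_measurable (lebesgue_on {0..T})"
  by (simp add: Lspace_def)

lemma Lspace_2_dominated: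
  assumes "w \<in> borel_measurable (lebesgue_on {0..T})"
    and "integrable (lebesgue_on {0..T}) (\<lambda>t. (k t)\<^sup>2)"
    and "AE t in lebesgue_on {0..T}. norm (w t) \<le> C * \<bar>k t\<bar>"
  shows "w \<in> Lspace T 2"
  unfolding Lspace_2_iff
proof
  show "integrable (lebesgue_on {0..T}) (\<lambda>t. (norm (w t))\<^sup>2)"
  proof (rule Bochner_Integration.integrable_bound)
    show "integrable (lebesgue_on {0..T}) (\<lambda>t. C\<^sup>2 * (k t)\<^sup>2)"
      using assms(2) by simp
    show "AE t in lebesgue_on {0..T}. norm ((norm (w t))\<^sup>2) \<le> norm (C\<^sup>2 * (k t)\<^sup>2)"
      using assms(3)
    proof eventually_elim
      case (elim t)
      then have "(norm (w t))\<^sup>2 \<le> (C * \<bar>k t\<bar>)\<^sup>2"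
        by (intro power_mono) auto
      then show ?case by (simp add: power_mult_distrib)
    qed
  qed (use assms(1) in measurable)
qed fact

lemma Lspace_2_integrable_mult:
  assumes "u \<in> Lspace T 2" "v \<in> Lspace T 2"
  shows "integrable (lebesgue_on {0..T}) (\<lambda>t. norm (u t) * norm (v t))"
proof (rule Bochner_Integration.integrable_bound)
  show "integrable (lebesgue_on {0..T}) (\<lambda>t. (norm (u t))\<^sup>2 + (norm (v t))\<^sup>2)"
    using assms by (auto simp: Lspace_2_iff)
  have "a * b \<le> a\<^sup>2 + b\<^sup>2" if "a \<ge> 0" "b \<ge> 0" for a b :: real
    using sum_squares_bound[of a b] that mult_nonneg_nonneg[OF that] by linarith
  then show "AE t in lebesgue_on {0..T}. norm (norm (u t) * norm (v t)) \<le> norm ((norm (u t))\<^sup>2 + (norm (v t))\<^sup>2)"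
    by auto
qed (use assms in \<open>auto simp: Lspace_2_iff\<close>)

lemma Lspace_2_integrable_inner:
  assumes "u \<in> Lspace T 2" "v \<in> Lspace T 2"
  shows "integrable (lebesgue_on {0..T}) (\<lambda>t. u t \<bullet> v t)"
  by (rule Bochner_Integration.integrable_bound[OF Lspace_2_integrable_mult[OF assms]])
    (use assms in \<open>auto simp: Lspace_2_iff Cauchy_Schwarz_ineq2\<close>)

lemma Lspace_2_const: "(\<lambda>_. c) \<in> Lspace T 2"
  by (simp add: Lspace_2_iff)

lemma Lspace_2_norm_iff: "u \<in> borel_measurable (lebesgue_on {0..T}) \<Longrightarrow> (\<lambda>t. norm (u t)) \<in> Lspace T 2 \<longleftrightarrow> u \<in> Lspace T 2"
  by (simp add: Lspace_2_iff)

lemma Lspace_2_integrable: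
  assumes "u \<in> Lspace T 2" shows "integrable (lebesgue_on {0..T}) u"
proof -
  have "integrable (lebesgue_on {0..T}) (\<lambda>t. norm (u t))"
    using Lspace_2_integrable_mult[OF assms Lspace_2_const[of "1::real"]] by simp
  then show ?thesis
    using assms by (simp add: Lspace_2_iff integrable_norm_iff)
qed

lemma Lspace_2_add:
  assumes "u \<in> Lspace T 2" "v \<in> Lspace T 2" shows "(\<lambda>t. u t + v t) \<in> Lspace T 2"
proof (rule Lspace_2_dominated)
  have "integrable (lebesgue_on {0..T}) (\<lambda>t. (norm (u t))\<^sup>2 + 2 * (norm (u t) * norm (v t)) + (norm (v t))\<^sup>2)"
    using assms Lspace_2_integrable_mult[OF assms] by (auto simp: Lspace_2_iff)
  then show "integrable (lebesgue_on {0..T}) (\<lambda>t. (norm (u t) + norm (v t))\<^sup>2)"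
    by (simp add: power2_sum algebra_simps)
  show "AE t in lebesgue_on {0..T}. norm (u t + v t) \<le> 1 * \<bar>norm (u t) + norm (v t)\<bar>"
    by (auto intro: norm_triangle_ineq)
qed (use assms in \<open>auto simp: Lspace_2_iff\<close>)

lemma Lspace_2_scaleR: "u \<in> Lspace T 2 \<Longrightarrow> (\<lambda>t. c *\<^sub>R u t) \<in> Lspace T 2"
  by (rule Lspace_2_dominated[where k="\<lambda>t. norm (u t)" and C="\<bar>c\<bar>"]) (auto simp: Lspace_2_iff)

lemma Lspace_2_diff: "u \<in> Lspace T 2 \<Longrightarrow> v \<in> Lspace T 2 \<Longrightarrow> (\<lambda>t. u t - v t) \<in> Lspace T 2"
  using Lspace_2_add[OF _ Lspace_2_scaleR[of v T "-1"], of u] by simp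

lemma Lspace_infinity_AE:
  assumes "T > 0" "u \<in> Lspace T \<infinity>"
  shows "AE t in lebesgue_on {0..T}. norm (u t) \<le> Lnorm T \<infinity> u" "Lnorm T \<infinity> u \<ge> 0"
proof -
  let ?s = "esssup (lebesgue_on {0..T}) (\<lambda>t. ereal (norm (u t)))"
  have m: "(\<lambda>t. ereal (norm (u t))) \<in> borel_measurable (lebesgue_on {0..T})"
    using assms by (auto dest: Lspace_measurable)
  \<comment> \<open>On a null measure space the essential supremum is minus infinity; T > 0 excludes
    this case.\<close>
  have "emeasure (lebesgue_on {0..T}) (space (lebesgue_on {0..T})) \<noteq> 0"
    using assms(1) by (simp add: emeasure_restrict_space)
  then have "0 \<le> ?s"
    using esssup_const[of "lebesgue_on {0..T}" "0::ereal"] esssup_mono[of "\<lambda>_. 0::ereal" "lebesgue_on {0..T}" "\<lambda>t. ereal (norm (u t))"]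
    by auto
  moreover have "?s < \<infinity>"
    using assms(2) by (simp add: Lspace_def)
  ultimately obtain r where r: "?s = ereal r" "r \<ge> 0"
    by (cases ?s) auto
  then show "AE t in lebesgue_on {0..T}. norm (u t) \<le> Lnorm T \<infinity> u" "Lnorm T \<infinity> u \<ge> 0"
    using esssup_AE[of "\<lambda>t. ereal (norm (u t))" "lebesgue_on {0..T}"] by (auto simp: Lnorm_def)
qed

lemma Lspace_infinityI:
  assumes "T > 0" "u \<in> borel_measurable (lebesgue_on {0..T})" "AE t in lebesgue_on {0..T}. norm (u t) \<le> c"
  shows "u \<in> Lspace T \<infinity>" "Lnorm T \<infinity> u \<le> c"
proof -
  have "esssup (lebesgue_on {0..T}) (\<lambda>t. ereal (norm (u t))) \<le> ereal c"
    using assms by (intro esssup_I) auto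
  then show u: "u \<in> Lspace T \<infinity>"
    using assms(2) by (auto simp: Lspace_def intro: le_less_trans)
  have "emeasure (lebesgue_on {0..T}) (space (lebesgue_on {0..T})) \<noteq> 0"
    using assms(1) by (simp add: emeasure_restrict_space)
  then have "0 \<le> esssup (lebesgue_on {0..T}) (\<lambda>t. ereal (norm (u t)))"
    using esssup_const[of "lebesgue_on {0..T}" "0::ereal"] esssup_mono[of "\<lambda>_. 0::ereal" "lebesgue_on {0..T}" "\<lambda>t. ereal (norm (u t))"] assms(2)
    by auto
  then show "Lnorm T \<infinity> u \<le> c"
    using \<open>_ \<le> ereal c\<close> real_of_ereal_positive_mono[of "esssup (lebesgue_on {0..T}) (\<lambda>t. ereal (norm (u t)))" "ereal c"]
    by (simp add: Lnorm_def)
qed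

lemma enn2real_exponent_ge_2: "\<beta> \<ge> 2 \<Longrightarrow> \<beta> \<noteq> \<infinity> \<Longrightarrow> enn2real \<beta> \<ge> 2"
  by (cases \<beta>) (auto simp: ennreal_numeral [symmetric] simp del: ennreal_numeral)

text \<open>For p at least 2 and nonnegative a, a^2 is at most 1 + a^p, and the constant 1 is
  integrable on a bounded interval.\<close>

lemma Lspace_subset_2:
  fixes u :: "real \<Rightarrow> 'a::euclidean_space"
  assumes "T > 0" "\<beta> \<ge> 2" "u \<in> Lspace T \<beta>"
  shows "u \<in> Lspace T 2"
proof (cases "\<beta> = \<infinity>")
  case True
  then show ?thesis
    using Lspace_infinity_AE(1)[OF assms(1)] assms(3)
    by (intro Lspace_2_dominated[where k="\<lambda>_. 1" and C="Lnorm T \<infinity> u"]) (auto dest: Lspace_measurable)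
next
  case False
  have p: "enn2real \<beta> \<ge> 2" by (rule enn2real_exponent_ge_2[OF assms(2) False])
  have le: "a\<^sup>2 \<le> 1 + a powr enn2real \<beta>" if "a \<ge> 0" for a :: real
  proof (cases "a \<le> 1")
    case True
    then show ?thesis using that power_le_one[of a 2] by (simp add: add_increasing2)
  next
    case False
    then have "a powr 2 \<le> a powr enn2real \<beta>"
      using p by (intro powr_mono) auto
    then show ?thesis using False by (simp add: powr_numeral)
  qed
  have "integrable (lebesgue_on {0..T}) (\<lambda>t. (norm (u t))\<^sup>2)"
  proof (rule Bochner_Integration.integrable_bound)
    show "integrable (lebesgue_on {0..T}) (\<lambda>t. 1 + norm (u t) powr enn2real \<beta>)"
      using assms(3) False by (simp add: Lspace_def)
    show "AE t in lebesgue_on {0..T}. norm ((norm (u t))\<^sup>2) \<le> norm (1 + norm (u t) powr enn2real \<beta>)"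
      using le by (auto simp: add_nonneg_nonneg)
  qed (use assms(3) in \<open>auto dest: Lspace_measurable\<close>)
  then show ?thesis
    using assms(3) by (auto simp: Lspace_2_iff dest: Lspace_measurable)
qed

lemma Lnorm_nonneg: "T > 0 \<Longrightarrow> u \<in> Lspace T \<beta> \<Longrightarrow> Lnorm T \<beta> u \<ge> 0"
  using Lspace_infinity_AE(2)[of T u] by (cases "\<beta> = \<infinity>") (auto simp: Lnorm_def)

text \<open>By homogeneity one may assume that the norm is \<open>1\<close>, where \<open>|u| \<le> 1 + |u|\<^sup>\<beta>\<close> suffices.\<close>

lemma LINT_norm_le_Lnorm:
  fixes u :: "real \<Rightarrow> 'a::euclidean_space"
  assumes "T > 0" "\<beta> \<ge> 2" and u: "u \<in> Lspace T \<beta>"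
  shows "(LINT t|lebesgue_on {0..T}. norm (u t)) \<le> (T + 1) * Lnorm T \<beta> u"
proof (cases "\<beta> = \<infinity>")
  case True
  note * = Lspace_infinity_AE[OF assms(1) u[unfolded True]]
  have "(LINT t|lebesgue_on {0..T}. norm (u t)) \<le> (LINT t|lebesgue_on {0..T}. Lnorm T \<infinity> u)"
    using *(1) Lspace_2_integrable[OF Lspace_subset_2[OF assms]] by (intro integral_mono_AE) auto
  also have "\<dots> \<le> (T + 1) * Lnorm T \<infinity> u"
    using assms(1) *(2) by (subst LINT_const_lebesgue_on_Icc) (auto simp: algebra_simps)
  finally show ?thesis using True by simp
next
  case False
  define p where "p = enn2real \<beta>"
  have p: "p \<ge> 2" unfolding p_def by (rule enn2real_exponent_ge_2[OF assms(2) False])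
  define N where "N = Lnorm T \<beta> u"
  have int: "integrable (lebesgue_on {0..T}) (\<lambda>t. norm (u t) powr p)"
    using u False by (simp add: Lspace_def p_def)
  have u1: "integrable (lebesgue_on {0..T}) u"
    by (rule Lspace_2_integrable[OF Lspace_subset_2[OF assms]])
  have N_eq: "N = (LINT t|lebesgue_on {0..T}. norm (u t) powr p) powr (1 / p)"
    using False by (simp add: N_def Lnorm_def p_def)
  have Np: "N powr p = (LINT t|lebesgue_on {0..T}. norm (u t) powr p)"
    using p by (simp add: N_eq powr_powr)
  show ?thesis
  proof (cases "N = 0")
    case True
    then have "(LINT t|lebesgue_on {0..T}. norm (u t) powr p) = 0"
      using Np p by simp
    then have "AE t in lebesgue_on {0..T}. norm (u t) powr p = 0"
      using int by (subst (asm) integral_nonneg_eq_0_iff_AE) auto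
    then have "AE t in lebesgue_on {0..T}. norm (u t) = 0"
      by auto
    then have "(LINT t|lebesgue_on {0..T}. norm (u t)) = 0"
      by (rule integral_eq_zero_AE)
    then show ?thesis using True by (simp add: N_def)
  next
    case False
    then have "N > 0" by (simp add: N_eq)
    have le: "a \<le> 1 + a powr p" if "a \<ge> 0" for a :: real
    proof (cases "a \<le> 1")
      case False
      then have "a powr 1 \<le> a powr p" using p by (intro powr_mono) auto
      then show ?thesis using False by simp
    qed (simp add: add_increasing2)
    have "(LINT t|lebesgue_on {0..T}. norm (u t) / N) \<le> (LINT t|lebesgue_on {0..T}. 1 + norm (u t) powr p / N powr p)"
    proof (rule integral_mono)
      fix t show "norm (u t) / N \<le> 1 + norm (u t) powr p / N powr p"
        using le[of "norm (u t) / N"] \<open>N > 0\<close> by (simp add: powr_divide)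
    qed (use u1 int in auto)
    also have "\<dots> = (LINT t|lebesgue_on {0..T}. 1) + (LINT t|lebesgue_on {0..T}. norm (u t) powr p) / N powr p"
      using int by simp
    also have "\<dots> = T + 1"
      unfolding Np [symmetric] using \<open>N > 0\<close> assms(1) by (subst LINT_const_lebesgue_on_Icc) auto
    finally show ?thesis
      using \<open>N > 0\<close> by (simp add: N_def [symmetric] divide_le_eq)
  qed
qed

text \<open>An operator bounded pointwise by |v(t)| plus the integral of |v| is bounded on every
  L^\<beta> with \<beta> at least 2 at once: the integral is a constant controlled by the norm of v,
  and constants belong to L^\<beta> on a bounded interval. Linearity is inherited because L^\<beta>
  is contained in L^2.\<close>

lemma bounded_operatorI:
  fixes A :: "(real \<Rightarrow> 'a::euclidean_space) \<Rightarrow> (real \<Rightarrow> 'a)"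
  assumes "T > 0" "\<beta> \<ge> 2" "C \<ge> 0"
    and meas: "\<And>v. v \<in> Lspace T 2 \<Longrightarrow> A v \<in> borel_measurable (lebesgue_on {0..T})"
    and add: "\<And>v w. v \<in> Lspace T 2 \<Longrightarrow> w \<in> Lspace T 2 \<Longrightarrow>
        AE t in lebesgue_on {0..T}. A (\<lambda>s. v s + w s) t = A v t + A w t"
    and scale: "\<And>c v. v \<in> Lspace T 2 \<Longrightarrow> AE t in lebesgue_on {0..T}. A (\<lambda>s. c *\<^sub>R v s) t = c *\<^sub>R A v t"
    and bound: "\<And>v. v \<in> Lspace T 2 \<Longrightarrow> AE t in lebesgue_on {0..T}.
        norm (A v t) \<le> C * (norm (v t) + (LINT s|lebesgue_on {0..T}. norm (v s)))"
  shows "bounded_operator T \<beta> A"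
proof -
  have "\<exists>K. \<forall>v\<in>Lspace T \<beta>. A v \<in> Lspace T \<beta> \<and> Lnorm T \<beta> (A v) \<le> K * Lnorm T \<beta> v"
  proof (cases "\<beta> = \<infinity>")
    case True
    have "A v \<in> Lspace T \<beta> \<and> Lnorm T \<beta> (A v) \<le> (C * (1 + (T + 1))) * Lnorm T \<beta> v" if v: "v \<in> Lspace T \<beta>" for v
    proof -
      have v2: "v \<in> Lspace T 2"
        by (rule Lspace_subset_2[OF assms(1,2) v])
      have "AE t in lebesgue_on {0..T}. norm (v t) \<le> Lnorm T \<infinity> v"
        using Lspace_infinity_AE[OF assms(1)] v True by simp
      then have "AE t in lebesgue_on {0..T}. norm (A v t) \<le> C * (1 + (T + 1)) * Lnorm T \<infinity> v"
        using bound[OF v2]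
      proof eventually_elim
        case (elim t)
        have "norm (A v t) \<le> C * (norm (v t) + (LINT s|lebesgue_on {0..T}. norm (v s)))"
          by (rule elim)
        also have "\<dots> \<le> C * (Lnorm T \<infinity> v + (T + 1) * Lnorm T \<infinity> v)"
          using elim(1) LINT_norm_le_Lnorm[OF assms(1,2) v] \<open>C \<ge> 0\<close> True by (intro mult_left_mono add_mono) auto
        finally show ?case by (simp add: algebra_simps)
      qed
      then show ?thesis
        using Lspace_infinityI[OF assms(1) meas[OF v2]] True by simp
    qed
    then show ?thesis by blast
  next
    case False
    define p where "p = enn2real \<beta>"
    have p: "p \<ge> 2" unfolding p_def by (rule enn2real_exponent_ge_2[OF assms(2) False])
    \<comment> \<open>The factor \<open>(2 * C) powr p\<close> bounds the power of a sum through its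
      larger summand; \<open>T * (T + 1) powr p\<close> comes from integrating over [0,T] the p-th
      power of the constant part, which is at most T + 1 times the norm of v.\<close>
    define K where "K = (2 * C) powr p * (1 + T * (T + 1) powr p)"
    have "K \<ge> 0" using assms(1) by (simp add: K_def)
    have "A v \<in> Lspace T \<beta> \<and> Lnorm T \<beta> (A v) \<le> K powr (1 / p) * Lnorm T \<beta> v" if v: "v \<in> Lspace T \<beta>" for v
    proof -
      have v2: "v \<in> Lspace T 2"
        by (rule Lspace_subset_2[OF assms(1,2) v])
      define N where "N = Lnorm T \<beta> v"
      define I where "I = (LINT s|lebesgue_on {0..T}. norm (v s))"
      have "N \<ge> 0" unfolding N_def by (rule Lnorm_nonneg[OF assms(1) v])
      have "I \<ge> 0" by (simp add: I_def)
      have I: "I \<le> (T + 1) * N"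
        unfolding I_def N_def by (rule LINT_norm_le_Lnorm[OF assms(1,2) v])
      have int: "integrable (lebesgue_on {0..T}) (\<lambda>t. norm (v t) powr p)"
        using v False by (simp add: Lspace_def p_def)
      have Np: "N powr p = (LINT t|lebesgue_on {0..T}. norm (v t) powr p)"
        using False p by (simp add: N_def Lnorm_def p_def [symmetric] powr_powr)
      have AE: "AE t in lebesgue_on {0..T}. norm (A v t) powr p \<le> (2 * C) powr p * (norm (v t) powr p + I powr p)"
        using bound[OF v2]
      proof eventually_elim
        case (elim t)
        define m where "m = max (norm (v t)) I"
        have "m \<ge> 0" using \<open>I \<ge> 0\<close> by (simp add: m_def)
        have "norm (A v t) \<le> C * (norm (v t) + I)"
          using elim by (simp add: I_def)
        also have "\<dots> \<le> C * (m + m)"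
          using \<open>C \<ge> 0\<close> by (intro mult_left_mono add_mono) (auto simp: m_def)
        finally have "norm (A v t) powr p \<le> (2 * C * m) powr p"
          using p by (intro powr_mono2) (auto simp: algebra_simps)
        also have "\<dots> = (2 * C) powr p * m powr p"
          using \<open>m \<ge> 0\<close> \<open>C \<ge> 0\<close> by (simp add: powr_mult)
        also have "\<dots> \<le> (2 * C) powr p * (norm (v t) powr p + I powr p)"
          by (intro mult_left_mono) (auto simp: m_def max_def)
        finally show ?case .
      qed
      have int': "integrable (lebesgue_on {0..T}) (\<lambda>t. (2 * C) powr p * (norm (v t) powr p + I powr p))"
        using int by simp
      have Ap: "integrable (lebesgue_on {0..T}) (\<lambda>t. norm (A v t) powr p)"
        by (rule Bochner_Integration.integrable_bound[OF int']) (use AE meas[OF v2] in auto)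
      have "(LINT t|lebesgue_on {0..T}. norm (A v t) powr p)
          \<le> (LINT t|lebesgue_on {0..T}. (2 * C) powr p * (norm (v t) powr p + I powr p))"
        by (rule integral_mono_AE[OF Ap int' AE])
      also have "\<dots> = (2 * C) powr p * (N powr p + T * I powr p)"
        using int assms(1) by (simp add: Np measure_restrict_space)
      also have "\<dots> \<le> (2 * C) powr p * (N powr p + T * ((T + 1) powr p * N powr p))"
        using I \<open>I \<ge> 0\<close> p assms(1) \<open>N \<ge> 0\<close> powr_mono2[of p I "(T + 1) * N"]
        by (intro mult_left_mono add_mono) (auto simp: powr_mult)
      also have "\<dots> = K * N powr p"
        by (simp add: K_def algebra_simps)
      finally have "(LINT t|lebesgue_on {0..T}. norm (A v t) powr p) powr (1 / p) \<le> (K * N powr p) powr (1 / p)"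
        using p by (intro powr_mono2) auto
      also have "\<dots> = K powr (1 / p) * N"
        using \<open>K \<ge> 0\<close> \<open>N \<ge> 0\<close> p by (simp add: powr_mult powr_powr)
      finally have "Lnorm T \<beta> (A v) \<le> K powr (1 / p) * N"
        using False by (simp add: Lnorm_def p_def)
      then show ?thesis
        using Ap meas[OF v2] False by (simp add: N_def Lspace_def p_def)
    qed
    then show ?thesis by blast
  qed
  then show ?thesis
    unfolding bounded_operator_def using Lspace_subset_2[OF assms(1,2)] add scale by blast
qed

section \<open>Uniqueness of Gateaux derivatives and limits in L^2\<close>

lemma Lnorm_2_eq_0_imp_AE:
  assumes "u \<in> Lspace T 2" "Lnorm T 2 u = 0"
  shows "AE t in lebesgue_on {0..T}. u t = 0"
proof -
  have "(LINT t|lebesgue_on {0..T}. (norm (u t))\<^sup>2) = 0"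
    using assms(2) by (simp add: Lnorm_2)
  then have "AE t in lebesgue_on {0..T}. (norm (u t))\<^sup>2 = 0"
    using assms(1) by (subst (asm) integral_nonneg_eq_0_iff_AE) (auto simp: Lspace_2_iff)
  then show ?thesis by auto
qed

lemma Lnorm_2_cong_AE:
  assumes "u \<in> borel_measurable (lebesgue_on {0..T})" "w \<in> borel_measurable (lebesgue_on {0..T})"
    "AE t in lebesgue_on {0..T}. u t = w t"
  shows "Lnorm T 2 u = Lnorm T 2 w"
proof -
  have "(LINT t|lebesgue_on {0..T}. (norm (u t))\<^sup>2) = (LINT t|lebesgue_on {0..T}. (norm (w t))\<^sup>2)"
    using assms by (intro integral_cong_AE) auto
  then show ?thesis by (simp add: Lnorm_2)
qed

text \<open>A substitute for the triangle inequality: the factor 2 is harmless where both terms on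
  the right tend to 0.\<close>

lemma Lnorm_2_diff_squared_le:
  assumes "u \<in> Lspace T 2" "w \<in> Lspace T 2"
  shows "(Lnorm T 2 (\<lambda>t. u t - w t))\<^sup>2 \<le> 2 * (Lnorm T 2 u)\<^sup>2 + 2 * (Lnorm T 2 w)\<^sup>2"
proof -
  have sq: "(Lnorm T 2 u)\<^sup>2 = (LINT t|lebesgue_on {0..T}. (norm (u t))\<^sup>2)" for u :: "real \<Rightarrow> 'a"
    by (simp add: Lnorm_2)
  have "(LINT t|lebesgue_on {0..T}. (norm (u t - w t))\<^sup>2)
      \<le> (LINT t|lebesgue_on {0..T}. 2 * (norm (u t))\<^sup>2 + 2 * (norm (w t))\<^sup>2)"
  proof (rule integral_mono)
    fix t
    have "(norm (u t - w t))\<^sup>2 \<le> (norm (u t) + norm (w t))\<^sup>2"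
      by (intro power_mono norm_triangle_ineq4) auto
    also have "\<dots> \<le> 2 * (norm (u t))\<^sup>2 + 2 * (norm (w t))\<^sup>2"
      using sum_squares_bound[of "norm (u t)" "norm (w t)"] by (simp add: power2_sum)
    finally show "(norm (u t - w t))\<^sup>2 \<le> 2 * (norm (u t))\<^sup>2 + 2 * (norm (w t))\<^sup>2" .
  qed (use assms Lspace_2_diff[OF assms] in \<open>auto simp: Lspace_2_iff\<close>)
  then show ?thesis
    using assms by (simp add: sq Lspace_2_iff)
qed

text \<open>The difference \<open>G - G'\<close> is itself an admissible direction, and in it both
  representatives give the limit of the same difference quotient.\<close>

lemma is_first_derivative_unique:
  assumes "is_first_derivative T \<Phi> u G" "is_first_derivative T \<Phi> u G'"
  shows "AE t in lebesgue_on {0..T}. G t = G' t"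
proof -
  have G: "G \<in> Lspace T 2" "G' \<in> Lspace T 2"
    using assms by (auto simp: is_first_derivative_def)
  define w where "w t = G t - G' t" for t
  have w: "w \<in> Lspace T 2"
    unfolding w_def by (rule Lspace_2_diff[OF G])
  have "L2_inner T G w = L2_inner T G' w"
  proof -
    have "((\<lambda>\<epsilon>. (\<Phi> (\<lambda>s. u s + \<epsilon> *\<^sub>R w s) - \<Phi> u) / \<epsilon>) \<longlongrightarrow> L2_inner T G w) (at 0)"
      "((\<lambda>\<epsilon>. (\<Phi> (\<lambda>s. u s + \<epsilon> *\<^sub>R w s) - \<Phi> u) / \<epsilon>) \<longlongrightarrow> L2_inner T G' w) (at 0)"
      using assms w by (auto simp: is_first_derivative_def functional_gateaux_derivative_def)
    then show ?thesis by (rule tendsto_unique[rotated]) simp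
  qed
  then have "(LINT t|lebesgue_on {0..T}. G t \<bullet> w t - G' t \<bullet> w t) = 0"
    using Lspace_2_integrable_inner[OF G(1) w] Lspace_2_integrable_inner[OF G(2) w]
    by (simp add: L2_inner_def)
  then have "Lnorm T 2 w = 0"
    by (simp add: Lnorm_2 w_def dot_square_norm [symmetric] inner_diff_left [symmetric])
  then have "AE t in lebesgue_on {0..T}. w t = 0"
    by (rule Lnorm_2_eq_0_imp_AE[OF w])
  then show ?thesis by (simp add: w_def)
qed

lemma bounded_operator_Lspace: "bounded_operator T \<beta> A \<Longrightarrow> v \<in> Lspace T \<beta> \<Longrightarrow> A v \<in> Lspace T \<beta>"
  by (simp add: bounded_operator_def)

text \<open>The distance of \<open>A v\<close> and \<open>B v\<close> does not depend on \<epsilon>,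
  while both are limits of the common difference quotient \<open>q \<epsilon>\<close>.\<close>

lemma operator_gateaux_derivative_unique:
  assumes A: "operator_gateaux_derivative T F u A" and B: "operator_gateaux_derivative T F u B"
    and F: "\<And>v. v \<in> Lspace T 2 \<Longrightarrow> F v \<in> Lspace T 2"
    and u: "u \<in> Lspace T 2" and v: "v \<in> Lspace T 2"
  shows "AE t in lebesgue_on {0..T}. A v t = B v t"
proof -
  have AB: "A v \<in> Lspace T 2" "B v \<in> Lspace T 2"
    using A B v by (auto simp: operator_gateaux_derivative_def bounded_operator_Lspace)
  define q where "q \<epsilon> t = (F (\<lambda>s. u s + \<epsilon> *\<^sub>R v s) t - F u t) /\<^sub>R \<epsilon>" for \<epsilon> t
  have q: "q \<epsilon> \<in> Lspace T 2" for \<epsilon>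
    unfolding q_def by (intro Lspace_2_scaleR Lspace_2_diff F Lspace_2_add u v)
  define e where "e \<epsilon> = 2 * (Lnorm T 2 (\<lambda>t. q \<epsilon> t - B v t))\<^sup>2 + 2 * (Lnorm T 2 (\<lambda>t. q \<epsilon> t - A v t))\<^sup>2" for \<epsilon>
  have "(Lnorm T 2 (\<lambda>t. A v t - B v t))\<^sup>2 \<le> e \<epsilon>" for \<epsilon>
  proof -
    have "(\<lambda>t. A v t - B v t) = (\<lambda>t. (q \<epsilon> t - B v t) - (q \<epsilon> t - A v t))"
      by auto
    then show ?thesis
      unfolding e_def
      using Lnorm_2_diff_squared_le[OF Lspace_2_diff[OF q AB(2)] Lspace_2_diff[OF q AB(1)], of \<epsilon> \<epsilon>] by simp
  qed
  moreover have "(e \<longlongrightarrow> 2 * 0\<^sup>2 + 2 * 0\<^sup>2) (at 0)"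
    unfolding e_def q_def using A B v
    by (intro tendsto_intros) (auto simp: operator_gateaux_derivative_def)
  ultimately have "(Lnorm T 2 (\<lambda>t. A v t - B v t))\<^sup>2 \<le> 2 * 0\<^sup>2 + 2 * 0\<^sup>2"
    by (intro tendsto_lowerbound[of e _ "at 0"]) auto
  then have "Lnorm T 2 (\<lambda>t. A v t - B v t) = 0"
    by simp
  then have "AE t in lebesgue_on {0..T}. A v t - B v t = 0"
    by (rule Lnorm_2_eq_0_imp_AE[OF Lspace_2_diff[OF AB]])
  then show ?thesis by simp
qed

lemma Lspace_2_affine_norm:
  fixes u :: "real \<Rightarrow> 'a::euclidean_space"
  assumes "u \<in> Lspace T 2"
  shows "(\<lambda>t. a + c * norm (u t)) \<in> Lspace T 2"
proof -
  have "(\<lambda>t. norm (u t)) \<in> Lspace T 2"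
    using assms by (simp add: Lspace_2_norm_iff Lspace_measurable)
  from Lspace_2_add[OF Lspace_2_const[of a] Lspace_2_scaleR[OF this, of c]] show ?thesis
    by simp
qed

text \<open>Young's inequality with weight \<open>N = Lnorm T 2 v\<close> takes the place of
  Cauchy-Schwarz: |G| |v| is at most N |G|^2 + |v|^2 / N, and integration leaves a factor N. The
  constant is crude, but only continuity of the functional is wanted.\<close>

lemma L2_inner_bound:
  assumes G: "G \<in> Lspace T 2" and v: "v \<in> Lspace T 2"
  shows "\<bar>L2_inner T G v\<bar> \<le> ((Lnorm T 2 G)\<^sup>2 + 1) * Lnorm T 2 v"
proof (cases "Lnorm T 2 v = 0")
  case True
  have "AE t in lebesgue_on {0..T}. G t \<bullet> v t = 0"
    using Lnorm_2_eq_0_imp_AE[OF v True] by eventually_elim simp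
  then have "L2_inner T G v = 0"
    unfolding L2_inner_def by (rule integral_eq_zero_AE)
  then show ?thesis using True by simp
next
  case False
  define N where "N = Lnorm T 2 v"
  have N: "N > 0"
    using False by (simp add: N_def Lnorm_2 less_le)
  have sq: "(Lnorm T 2 u)\<^sup>2 = (LINT t|lebesgue_on {0..T}. (norm (u t))\<^sup>2)" for u :: "real \<Rightarrow> 'a"
    by (simp add: Lnorm_2)
  have "norm (LINT t|lebesgue_on {0..T}. G t \<bullet> v t) \<le> (LINT t|lebesgue_on {0..T}. N * (norm (G t))\<^sup>2 + (norm (v t))\<^sup>2 / N)"
  proof (rule Bochner_Integration.integral_norm_bound_integral)
    show "integrable (lebesgue_on {0..T}) (\<lambda>t. G t \<bullet> v t)"
      by (rule Lspace_2_integrable_inner[OF G v])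
    show "integrable (lebesgue_on {0..T}) (\<lambda>t. N * (norm (G t))\<^sup>2 + (norm (v t))\<^sup>2 / N)"
      using G v by (simp add: Lspace_2_iff)
    fix t
    have "2 * (norm (G t) * (norm (v t) / N)) \<le> (norm (G t))\<^sup>2 + (norm (v t) / N)\<^sup>2"
      using sum_squares_bound[of "norm (G t)" "norm (v t) / N"] by (simp add: mult_ac)
    moreover have "0 \<le> norm (G t) * (norm (v t) / N)"
      using N by simp
    ultimately have "norm (G t) * (norm (v t) / N) \<le> (norm (G t))\<^sup>2 + (norm (v t) / N)\<^sup>2"
      by linarith
    then have "N * (norm (G t) * (norm (v t) / N)) \<le> N * ((norm (G t))\<^sup>2 + (norm (v t) / N)\<^sup>2)"
      using N by (intro mult_left_mono) auto
    moreover have "norm (G t \<bullet> v t) \<le> norm (G t) * norm (v t)"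
      by (simp add: Cauchy_Schwarz_ineq2)
    ultimately show "norm (G t \<bullet> v t) \<le> N * (norm (G t))\<^sup>2 + (norm (v t))\<^sup>2 / N"
      using N by (simp add: power_divide power2_eq_square algebra_simps)
  qed
  also have "\<dots> = N * (Lnorm T 2 G)\<^sup>2 + N\<^sup>2 / N"
    using G v by (simp add: sq N_def Lspace_2_iff)
  also have "\<dots> = ((Lnorm T 2 G)\<^sup>2 + 1) * N"
    using N by (simp add: power2_eq_square algebra_simps)
  finally show ?thesis by (simp add: L2_inner_def N_def)
qed

lemma bounded_functional_L2_inner:
  assumes G: "G \<in> Lspace T 2"
  shows "bounded_functional_L2 T (L2_inner T G)"
  unfolding bounded_functional_L2_def
proof (intro conjI ballI allI)
  show "L2_inner T G (\<lambda>s. v s + w s) = L2_inner T G v + L2_inner T G w"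
    if "v \<in> Lspace T 2" "w \<in> Lspace T 2" for v w
    using Lspace_2_integrable_inner[OF G that(1)] Lspace_2_integrable_inner[OF G that(2)]
    by (simp add: L2_inner_def inner_add_right)
  show "L2_inner T G (\<lambda>s. c *\<^sub>R v s) = c * L2_inner T G v" for c v
    by (simp add: L2_inner_def)
  show "\<exists>K. \<forall>v\<in>Lspace T 2. \<bar>L2_inner T G v\<bar> \<le> K * Lnorm T 2 v"
    using L2_inner_bound[OF G] by blast
qed

text \<open>Translates a quadratic remainder into the error of the difference quotient, and a
  Lipschitz bound into a bound of the quotient itself; these are the two inputs of dominated
  convergence.\<close>

lemma norm_difference_quotient_le:
  fixes D h :: "'a::real_normed_vector"
  assumes "\<epsilon> \<noteq> 0"
  shows "norm (D - \<epsilon> *\<^sub>R h) \<le> \<epsilon>\<^sup>2 * k \<Longrightarrow> norm (D /\<^sub>R \<epsilon> - h) \<le> \<bar>\<epsilon>\<bar> * k"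
    and "norm D \<le> \<bar>\<epsilon>\<bar> * k \<Longrightarrow> norm (D /\<^sub>R \<epsilon>) \<le> k"
proof -
  have *: "norm (D /\<^sub>R \<epsilon>) \<le> k" if "norm D \<le> \<bar>\<epsilon>\<bar> * k" for D :: 'a and k
  proof -
    have "norm (D /\<^sub>R \<epsilon>) = norm D / \<bar>\<epsilon>\<bar>"
      by (simp add: divide_inverse mult.commute)
    also have "\<dots> \<le> k"
      using that assms by (simp add: pos_divide_le_eq mult.commute)
    finally show ?thesis .
  qed
  then show "norm D \<le> \<bar>\<epsilon>\<bar> * k \<Longrightarrow> norm (D /\<^sub>R \<epsilon>) \<le> k" .
  assume "norm (D - \<epsilon> *\<^sub>R h) \<le> \<epsilon>\<^sup>2 * k"
  also have "\<epsilon>\<^sup>2 * k = \<bar>\<epsilon>\<bar> * (\<bar>\<epsilon>\<bar> * k)"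
    by (simp add: power2_eq_square flip: mult.assoc)
  finally have "norm ((D - \<epsilon> *\<^sub>R h) /\<^sub>R \<epsilon>) \<le> \<bar>\<epsilon>\<bar> * k"
    by (rule *)
  then show "norm (D /\<^sub>R \<epsilon> - h) \<le> \<bar>\<epsilon>\<bar> * k"
    using assms by (simp add: scaleR_diff_right)
qed

text \<open>Two separate bounds: the rate \<open>k\<close> gives convergence at each t and may fail
  to be square integrable, while \<open>m\<close> is the majorant. Sequences are used because
  dominated convergence is sequential.\<close>

lemma Lnorm_2_tendsto_0:
  fixes q :: "real \<Rightarrow> real \<Rightarrow> 'a::euclidean_space"
  assumes q: "\<And>\<epsilon>. q \<epsilon> \<in> borel_measurable (lebesgue_on {0..T})"
    and m: "m \<in> Lspace T 2"
    and small: "\<And>\<epsilon> t. \<epsilon> \<noteq> 0 \<Longrightarrow> t \<in> {0..T} \<Longrightarrow> norm (q \<epsilon> t) \<le> \<bar>\<epsilon>\<bar> * k t"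
    and dom: "\<And>\<epsilon> t. \<epsilon> \<noteq> 0 \<Longrightarrow> t \<in> {0..T} \<Longrightarrow> norm (q \<epsilon> t) \<le> m t"
  shows "((\<lambda>\<epsilon>. Lnorm T 2 (q \<epsilon>)) \<longlongrightarrow> 0) (at 0)"
  unfolding tendsto_at_iff_sequentially o_def
proof (intro allI impI)
  fix X :: "nat \<Rightarrow> real" assume "\<forall>i. X i \<in> UNIV - {0}" and X0: "X \<longlonglongrightarrow> 0"
  then have X: "X i \<noteq> 0" for i by simp
  have "(\<lambda>i. LINT t|lebesgue_on {0..T}. (norm (q (X i) t))\<^sup>2) \<longlonglongrightarrow> (LINT t|lebesgue_on {0..T}. 0)"
  proof (rule integral_dominated_convergence[where w="\<lambda>t. (norm (m t))\<^sup>2"])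
    show "integrable (lebesgue_on {0..T}) (\<lambda>t. (norm (m t))\<^sup>2)"
      using m by (simp add: Lspace_2_iff)
    show "(\<lambda>t. (norm (q (X i) t))\<^sup>2) \<in> borel_measurable (lebesgue_on {0..T})" for i
      using q[of "X i"] by measurable
    show "AE t in lebesgue_on {0..T}. norm ((norm (q (X i) t))\<^sup>2) \<le> (norm (m t))\<^sup>2" for i
    proof (rule AE_I2)
      fix t assume "t \<in> space (lebesgue_on {0..T})"
      then have "norm (q (X i) t) \<le> norm (m t)"
        using dom[OF X[of i], of t] by simp
      from power_mono[OF this norm_ge_zero, of 2] show "norm ((norm (q (X i) t))\<^sup>2) \<le> (norm (m t))\<^sup>2"
        by simp
    qed
    show "AE t in lebesgue_on {0..T}. (\<lambda>i. (norm (q (X i) t))\<^sup>2) \<longlonglongrightarrow> 0"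
    proof (rule AE_I2)
      fix t assume t: "t \<in> space (lebesgue_on {0..T})"
      have "(\<lambda>i. \<bar>X i\<bar> * k t) \<longlonglongrightarrow> \<bar>0\<bar> * k t"
        by (intro tendsto_intros X0)
      then have "(\<lambda>i. \<bar>X i\<bar> * k t) \<longlonglongrightarrow> 0" by simp
      then have "(\<lambda>i. norm (q (X i) t)) \<longlonglongrightarrow> 0"
      proof (rule Lim_null_comparison[rotated])
        show "\<forall>\<^sub>F i in sequentially. norm (norm (q (X i) t)) \<le> \<bar>X i\<bar> * k t"
          using small[OF X, of t] t by (intro always_eventually allI) simp
      qed
      then have "(\<lambda>i. (norm (q (X i) t))\<^sup>2) \<longlonglongrightarrow> 0\<^sup>2"
        by (intro tendsto_intros)
      then show "(\<lambda>i. (norm (q (X i) t))\<^sup>2) \<longlonglongrightarrow> 0" by simp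
    qed
  qed auto
  then have "(\<lambda>i. sqrt (LINT t|lebesgue_on {0..T}. (norm (q (X i) t))\<^sup>2)) \<longlonglongrightarrow> sqrt (LINT t|lebesgue_on {0..T}. 0)"
    by (intro tendsto_intros)
  then show "(\<lambda>i. Lnorm T 2 (q (X i))) \<longlonglongrightarrow> 0"
    by (simp add: Lnorm_2)
qed

section \<open>Taylor estimates with Lipschitz second derivative\<close>

lemma has_derivative_frechet_derivative:
  assumes "(\<phi> has_derivative D) (at z)"
  shows "frechet_derivative \<phi> (at z) = D"
  using assms frechet_derivative_at by metis

text \<open>The entry for \<open>h\<close>, \<open>k\<close> differentiates first in direction
  \<open>h\<close>, then in direction \<open>k\<close>. Evaluation at \<open>h\<close> is a bounded
  linear map on operators, so differentiability of the operator-valued first derivative gives the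
  entry together with its bilinearity.\<close>

lemma twice_differentiableD:
  fixes \<phi> :: "'a::euclidean_space \<Rightarrow> 'b::euclidean_space"
  assumes "twice_differentiable \<phi>"
  shows "(\<phi> has_derivative frechet_derivative \<phi> (at z)) (at z)"
    and "((\<lambda>\<zeta>. frechet_derivative \<phi> (at \<zeta>) h) has_derivative second_deriv_array \<phi> z h) (at z)"
    and "linear (\<lambda>h. second_deriv_array \<phi> z h k)"
proof -
  obtain D :: "'a \<Rightarrow> 'a \<Rightarrow>\<^sub>L 'b" where D: "\<And>z. (\<phi> has_derivative blinfun_apply (D z)) (at z)"
    and D': "\<And>z. D differentiable (at z)"
    using assms unfolding twice_differentiable_def by auto
  have fD: "frechet_derivative \<phi> (at z) = blinfun_apply (D z)" for z
    using D by (rule has_derivative_frechet_derivative)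
  then show "(\<phi> has_derivative frechet_derivative \<phi> (at z)) (at z)"
    using D by simp
  obtain D2 where D2: "(D has_derivative D2) (at z)"
    using D' differentiable_def by blast
  have *: "((\<lambda>\<zeta>. frechet_derivative \<phi> (at \<zeta>) h) has_derivative (\<lambda>k. blinfun_apply (D2 k) h)) (at z)" for h
    unfolding fD by (rule bounded_linear.has_derivative[OF blinfun.bounded_linear_left D2])
  have arr: "second_deriv_array \<phi> z h = (\<lambda>k. blinfun_apply (D2 k) h)" for h
    unfolding second_deriv_array_def using has_derivative_frechet_derivative[OF *] by simp
  show "((\<lambda>\<zeta>. frechet_derivative \<phi> (at \<zeta>) h) has_derivative second_deriv_array \<phi> z h) (at z)"
    unfolding arr by (rule *)
  show "linear (\<lambda>h. second_deriv_array \<phi> z h k)"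
    unfolding arr by (simp add: bounded_linear.linear blinfun.bounded_linear_right)
qed

lemma array_norm_entry_le:
  assumes "h \<in> Basis" "k \<in> Basis"
  shows "norm (A h k) \<le> array_norm A"
proof -
  have "(norm (A h k))\<^sup>2 \<le> (\<Sum>k\<in>Basis. (norm (A h k))\<^sup>2)"
    using assms by (intro member_le_sum) auto
  also have "\<dots> \<le> (\<Sum>h\<in>Basis. \<Sum>k\<in>Basis. (norm (A h k))\<^sup>2)"
    using assms by (intro member_le_sum[of _ _ "\<lambda>h. \<Sum>k\<in>Basis. (norm (A h k))\<^sup>2"]) (auto intro: sum_nonneg)
  finally show ?thesis
    unfolding array_norm_def by (rule real_le_rsqrt)
qed

text \<open>Both arguments are expanded in the basis; each coordinate is at most the norm of its
  argument and each entry at most the array norm. The number of terms gives the squared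
  dimension.\<close>

lemma bilinear_norm_le_array_norm:
  fixes A :: "'a::euclidean_space \<Rightarrow> 'a \<Rightarrow> 'b::euclidean_space"
  assumes 1: "\<And>k. linear (\<lambda>h. A h k)" and 2: "\<And>h. linear (A h)"
  shows "norm (A h k) \<le> (real DIM('a))\<^sup>2 * array_norm A * norm h * norm k"
proof -
  have nn: "array_norm A \<ge> 0"
    by (simp add: array_norm_def sum_nonneg)
  have "A h k = (\<Sum>i\<in>Basis. \<Sum>j\<in>Basis. (h \<bullet> i * (k \<bullet> j)) *\<^sub>R A i j)"
  proof -
    have "A h k = A (\<Sum>i\<in>Basis. (h \<bullet> i) *\<^sub>R i) k"
      by (simp add: euclidean_representation)
    also have "\<dots> = (\<Sum>i\<in>Basis. (h \<bullet> i) *\<^sub>R A i k)"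
      by (simp only: linear_sum[OF 1] linear_scale[OF 1])
    also have "\<dots> = (\<Sum>i\<in>Basis. (h \<bullet> i) *\<^sub>R A i (\<Sum>j\<in>Basis. (k \<bullet> j) *\<^sub>R j))"
      by (simp add: euclidean_representation)
    also have "\<dots> = (\<Sum>i\<in>Basis. \<Sum>j\<in>Basis. (h \<bullet> i * (k \<bullet> j)) *\<^sub>R A i j)"
      by (simp only: linear_sum[OF 2] linear_scale[OF 2] scaleR_sum_right scaleR_scaleR)
    finally show ?thesis .
  qed
  also have "norm \<dots> \<le> (\<Sum>i\<in>(Basis::'a set). \<Sum>j\<in>(Basis::'a set). norm h * norm k * array_norm A)"
  proof (intro sum_norm_le)
    fix i j :: 'a assume ij: "i \<in> Basis" "j \<in> Basis"
    show "norm ((h \<bullet> i * (k \<bullet> j)) *\<^sub>R A i j) \<le> norm h * norm k * array_norm A"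
      using ij array_norm_entry_le[OF ij, of A] nn
      by (auto simp: abs_mult intro!: mult_mono Basis_le_norm)
  qed
  finally show ?thesis
    by (simp add: power2_eq_square mult_ac)
qed

text \<open>The mean value inequality for \<open>f - f' z\<close> on the ball around
  \<open>z\<close> that reaches \<open>z'\<close>, where the derivative is at most \<open>M\<close>
  times the radius. This gives \<open>M\<close> instead of the optimal \<open>M / 2\<close>, without
  integrating along the segment.\<close>

lemma taylor_first_order:
  fixes f :: "'a::real_normed_vector \<Rightarrow> 'b::real_normed_vector"
  assumes f: "\<And>\<zeta>. (f has_derivative f' \<zeta>) (at \<zeta>)" and "M \<ge> 0"
    and le: "\<And>\<zeta> h. norm (f' \<zeta> h - f' z h) \<le> M * norm (\<zeta> - z) * norm h"
  shows "norm (f z' - f z - f' z (z' - z)) \<le> M * (norm (z' - z))\<^sup>2"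
proof -
  let ?g = "\<lambda>\<zeta>. f \<zeta> - f' z \<zeta>"
  have bl: "bounded_linear (f' z)"
    using f has_derivative_bounded_linear by blast
  have "norm (?g z' - ?g z) \<le> (M * norm (z' - z)) * norm (z' - z)"
  proof (rule differentiable_bound[where S="cball z (norm (z' - z))" and f'="\<lambda>\<zeta> h. f' \<zeta> h - f' z h"])
    fix \<zeta> assume \<zeta>: "\<zeta> \<in> cball z (norm (z' - z))"
    show "(?g has_derivative (\<lambda>h. f' \<zeta> h - f' z h)) (at \<zeta> within cball z (norm (z' - z)))"
      by (intro has_derivative_diff has_derivative_at_withinI[OF f] bounded_linear.has_derivative[OF bl] has_derivative_ident)
    show "onorm (\<lambda>h. f' \<zeta> h - f' z h) \<le> M * norm (z' - z)"
    proof (rule onorm_bound)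
      fix h
      have "M * norm (\<zeta> - z) \<le> M * norm (z' - z)"
        using \<zeta> \<open>M \<ge> 0\<close> by (intro mult_left_mono) (auto simp: dist_norm norm_minus_commute)
      then show "norm (f' \<zeta> h - f' z h) \<le> M * norm (z' - z) * norm h"
        using le[of \<zeta> h] mult_right_mono[of _ _ "norm h"] by (meson norm_ge_zero order_trans)
    qed (use \<open>M \<ge> 0\<close> in auto)
  qed (auto simp: dist_norm norm_minus_commute)
  also have "?g z' - ?g z = f z' - f z - f' z (z' - z)"
    using bl by (simp add: linear_diff bounded_linear.linear algebra_simps)
  finally show ?thesis
    by (simp add: power2_eq_square mult_ac)
qed

text \<open>The common form of the hypotheses on b(t,.), f(t,.) and g, stated for the second
  derivative as a bilinear map rather than as an array of entries.\<close>

locale lipschitz_second_derivative =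
  fixes \<phi> :: "'a::euclidean_space \<Rightarrow> 'b::euclidean_space" and C :: real
  assumes twice_diff: "twice_differentiable \<phi>" and C_nonneg: "C \<ge> 0"
    and second_bound: "\<And>z h k. norm (second_deriv_array \<phi> z h k) \<le> C * norm h * norm k"
    and second_lipschitz: "\<And>z z' h k. norm (second_deriv_array \<phi> z h k - second_deriv_array \<phi> z' h k)
          \<le> C * norm (z - z') * norm h * norm k"
begin

abbreviation "D1 z h \<equiv> frechet_derivative \<phi> (at z) h"
abbreviation "D2 \<equiv> second_deriv_array \<phi>"

lemmas first_has_derivative = twice_differentiableD(1)[OF twice_diff]
lemmas second_has_derivative = twice_differentiableD(2)[OF twice_diff]

lemma linear_first: "linear (frechet_derivative \<phi> (at z))"
  using first_has_derivative has_derivative_linear by blast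

lemma linear_second1: "linear (\<lambda>h. D2 z h k)"
  by (rule twice_differentiableD(3)[OF twice_diff])

lemma linear_second2: "linear (D2 z h)"
  using second_has_derivative has_derivative_linear by blast

lemma first_lipschitz: "norm (D1 z' h - D1 z h) \<le> C * norm (z' - z) * norm h"
proof -
  have "norm (D1 z' h - D1 z h) \<le> (C * norm h) * norm (z' - z)"
  proof (rule differentiable_bound[where S=UNIV and f'="\<lambda>\<zeta>. D2 \<zeta> h"])
    show "onorm (D2 \<zeta> h) \<le> C * norm h" for \<zeta>
      using second_bound C_nonneg by (intro onorm_bound) auto
  qed (use second_has_derivative in auto)
  then show ?thesis by (simp add: mult_ac)
qed

lemma taylor_zero: "norm (\<phi> z' - \<phi> z - D1 z (z' - z)) \<le> C * (norm (z' - z))\<^sup>2"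
  by (rule taylor_first_order[OF first_has_derivative C_nonneg first_lipschitz])

lemma taylor_first: "norm (D1 z' h - D1 z h - D2 z h (z' - z)) \<le> C * norm h * (norm (z' - z))\<^sup>2"
proof (rule taylor_first_order[OF second_has_derivative])
  show "norm (D2 \<zeta> h k - D2 z h k) \<le> C * norm h * norm (\<zeta> - z) * norm k" for \<zeta> k
    using second_lipschitz[of \<zeta> h k z] by (simp add: mult_ac)
qed (use C_nonneg in auto)

text \<open>Both \<open>D2 z h k\<close> and \<open>D2 z k h\<close> are the limit of
  \<open>(\<phi> (z + s h + s k) - \<phi> (z + s h) - \<phi> (z + s k) + \<phi> z) / s\<^sup>2\<close>.\<close>

lemma second_difference:
  assumes "s > 0"
  shows "norm (\<phi> (z + s *\<^sub>R h + s *\<^sub>R k) - \<phi> (z + s *\<^sub>R h) - \<phi> (z + s *\<^sub>R k) + \<phi> z - s\<^sup>2 *\<^sub>R D2 z h k)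
      \<le> C * (norm h + norm k) ^ 3 * s ^ 3"
proof -
  \<comment> \<open>Subtracting the linear map makes the derivative of \<open>?g\<close> a
    first-order Taylor remainder at \<zeta> plus the change of \<open>D2\<close> between \<zeta> and
    \<open>z\<close>; both are small on the ball of radius \<open>s * norm h\<close>.\<close>
  let ?g = "\<lambda>\<zeta>. \<phi> (\<zeta> + s *\<^sub>R k) - \<phi> \<zeta> - D2 z \<zeta> (s *\<^sub>R k)"
  define B where "B = C * s\<^sup>2 * norm k * (norm k + norm h)"
  have "B \<ge> 0" using C_nonneg by (simp add: B_def)
  have "norm (?g (z + s *\<^sub>R h) - ?g z) \<le> B * norm ((z + s *\<^sub>R h) - z)"
  proof (rule differentiable_bound[where S="cball z (s * norm h)"
        and f'="\<lambda>\<zeta> w. D1 (\<zeta> + s *\<^sub>R k) w - D1 \<zeta> w - D2 z w (s *\<^sub>R k)"])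
    fix \<zeta> assume \<zeta>: "\<zeta> \<in> cball z (s * norm h)"
    have "((\<lambda>\<zeta>. \<phi> (\<zeta> + s *\<^sub>R k)) has_derivative D1 (\<zeta> + s *\<^sub>R k)) (at \<zeta> within cball z (s * norm h))"
      by (rule has_derivative_compose[OF _ first_has_derivative, where f="\<lambda>\<zeta>. \<zeta> + s *\<^sub>R k" and f'="\<lambda>w. w"])
        (auto intro!: derivative_eq_intros)
    then show "(?g has_derivative (\<lambda>w. D1 (\<zeta> + s *\<^sub>R k) w - D1 \<zeta> w - D2 z w (s *\<^sub>R k))) (at \<zeta> within cball z (s * norm h))"
      by (intro has_derivative_diff has_derivative_at_withinI[OF first_has_derivative]
          bounded_linear.has_derivative[OF linear_conv_bounded_linear[THEN iffD1, OF linear_second1]] has_derivative_ident)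
    show "onorm (\<lambda>w. D1 (\<zeta> + s *\<^sub>R k) w - D1 \<zeta> w - D2 z w (s *\<^sub>R k)) \<le> B"
    proof (rule onorm_bound)
      fix w
      have "norm (D1 (\<zeta> + s *\<^sub>R k) w - D1 \<zeta> w - D2 z w (s *\<^sub>R k))
          \<le> norm (D1 (\<zeta> + s *\<^sub>R k) w - D1 \<zeta> w - D2 \<zeta> w (s *\<^sub>R k)) + norm (D2 \<zeta> w (s *\<^sub>R k) - D2 z w (s *\<^sub>R k))"
        using norm_triangle_ineq[of "D1 (\<zeta> + s *\<^sub>R k) w - D1 \<zeta> w - D2 \<zeta> w (s *\<^sub>R k)" "D2 \<zeta> w (s *\<^sub>R k) - D2 z w (s *\<^sub>R k)"]
        by simp
      also have "\<dots> \<le> C * norm w * (norm (s *\<^sub>R k))\<^sup>2 + C * (s * norm h) * norm w * norm (s *\<^sub>R k)"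
      proof (rule add_mono)
        show "norm (D1 (\<zeta> + s *\<^sub>R k) w - D1 \<zeta> w - D2 \<zeta> w (s *\<^sub>R k)) \<le> C * norm w * (norm (s *\<^sub>R k))\<^sup>2"
          using taylor_first[of "\<zeta> + s *\<^sub>R k" w \<zeta>] by simp
        have "norm (D2 \<zeta> w (s *\<^sub>R k) - D2 z w (s *\<^sub>R k)) \<le> C * norm (\<zeta> - z) * norm w * norm (s *\<^sub>R k)"
          by (rule second_lipschitz)
        also have "\<dots> \<le> C * (s * norm h) * norm w * norm (s *\<^sub>R k)"
          using \<zeta> C_nonneg by (intro mult_right_mono mult_left_mono) (auto simp: dist_norm norm_minus_commute)
        finally show "norm (D2 \<zeta> w (s *\<^sub>R k) - D2 z w (s *\<^sub>R k)) \<le> \<dots>" .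
      qed
      also have "\<dots> = B * norm w"
        using \<open>s > 0\<close> by (simp add: B_def algebra_simps power2_eq_square)
      finally show "norm (D1 (\<zeta> + s *\<^sub>R k) w - D1 \<zeta> w - D2 z w (s *\<^sub>R k)) \<le> B * norm w" .
    qed fact
  qed (use \<open>s > 0\<close> in \<open>auto simp: dist_norm\<close>)
  also have "?g (z + s *\<^sub>R h) - ?g z
      = \<phi> (z + s *\<^sub>R h + s *\<^sub>R k) - \<phi> (z + s *\<^sub>R h) - \<phi> (z + s *\<^sub>R k) + \<phi> z - s\<^sup>2 *\<^sub>R D2 z h k"
    using linear_add[OF linear_second1] linear_scale[OF linear_second1] linear_scale[OF linear_second2]
    by (simp add: power2_eq_square algebra_simps)
  also have "B * norm ((z + s *\<^sub>R h) - z) = C * s ^ 3 * (norm k * ((norm k + norm h) * norm h))"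
    using \<open>s > 0\<close> by (simp add: B_def power2_eq_square power3_eq_cube mult_ac)
  also have "\<dots> \<le> C * s ^ 3 * ((norm h + norm k) * ((norm h + norm k) * (norm h + norm k)))"
    using \<open>s > 0\<close> C_nonneg by (intro mult_left_mono mult_mono) auto
  finally show ?thesis
    by (simp add: power3_eq_cube mult_ac)
qed

text \<open>The second difference does not change when \<open>h\<close> and \<open>k\<close> are
  exchanged, and division by \<open>s\<^sup>2\<close> leaves an error of order \<open>s\<close>.
  This symmetry is what identifies \<open>ham_ux\<close>, by definition a transpose, with the
  derivative of \<open>ham_u\<close> in the state.\<close>

lemma second_symmetric: "D2 z h k = D2 z k h"
proof -
  define M where "M = 2 * (C * (norm h + norm k) ^ 3)"
  have "norm (D2 z h k - D2 z k h) \<le> M * s" if "s > 0" for s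
  proof -
    let ?d = "\<phi> (z + s *\<^sub>R h + s *\<^sub>R k) - \<phi> (z + s *\<^sub>R h) - \<phi> (z + s *\<^sub>R k) + \<phi> z"
    have a: "norm (?d - s\<^sup>2 *\<^sub>R D2 z h k) \<le> C * (norm h + norm k) ^ 3 * s ^ 3"
      by (rule second_difference[OF that])
    have b: "norm (?d - s\<^sup>2 *\<^sub>R D2 z k h) \<le> C * (norm h + norm k) ^ 3 * s ^ 3"
      using second_difference[OF that, of z k h] by (simp add: algebra_simps)
    have "s\<^sup>2 * norm (D2 z h k - D2 z k h) = norm ((?d - s\<^sup>2 *\<^sub>R D2 z k h) - (?d - s\<^sup>2 *\<^sub>R D2 z h k))"
      by (simp add: scaleR_diff_right [symmetric])
    also have "\<dots> \<le> M * s ^ 3"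
      using norm_triangle_ineq4[of "?d - s\<^sup>2 *\<^sub>R D2 z k h" "?d - s\<^sup>2 *\<^sub>R D2 z h k"] a b
      unfolding M_def by (simp add: algebra_simps)
    also have "\<dots> = s\<^sup>2 * (M * s)"
      by (simp add: power2_eq_square power3_eq_cube)
    finally show ?thesis using that by simp
  qed
  moreover have "((\<lambda>s. M * s) \<longlongrightarrow> M * 0) (at_right 0)"
    by (intro tendsto_intros)
  ultimately have "norm (D2 z h k - D2 z k h) \<le> M * 0"
    by (intro tendsto_lowerbound[of "\<lambda>s. M * s" _ "at_right 0"])
      (auto simp: eventually_at_filter)
  then show ?thesis by simp
qed

end

lemma lipschitz_second_derivativeI:
  fixes \<phi> :: "'a::euclidean_space \<Rightarrow> 'b::euclidean_space"
  assumes td: "twice_differentiable \<phi>" and "L \<ge> 0"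
    and bound: "\<And>z. array_norm (second_deriv_array \<phi> z) \<le> L"
    and lip: "\<And>z z'. array_norm (\<lambda>h k. second_deriv_array \<phi> z h k - second_deriv_array \<phi> z' h k) \<le> L * norm (z - z')"
  shows "lipschitz_second_derivative \<phi> ((real DIM('a))\<^sup>2 * L)"
proof
  have lin1: "linear (\<lambda>h. second_deriv_array \<phi> z h k)" for z k
    by (rule twice_differentiableD(3)[OF td])
  have lin2: "linear (second_deriv_array \<phi> z h)" for z h
    using twice_differentiableD(2)[OF td] has_derivative_linear by blast
  show "norm (second_deriv_array \<phi> z h k) \<le> (real DIM('a))\<^sup>2 * L * norm h * norm k" for z h k
  proof -
    have "norm (second_deriv_array \<phi> z h k) \<le> (real DIM('a))\<^sup>2 * array_norm (second_deriv_array \<phi> z) * norm h * norm k"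
      by (rule bilinear_norm_le_array_norm[OF lin1 lin2])
    also have "\<dots> \<le> (real DIM('a))\<^sup>2 * L * norm h * norm k"
      using bound by (intro mult_right_mono mult_left_mono) auto
    finally show ?thesis .
  qed
  show "norm (second_deriv_array \<phi> z h k - second_deriv_array \<phi> z' h k)
      \<le> (real DIM('a))\<^sup>2 * L * norm (z - z') * norm h * norm k" for z z' h k
  proof -
    let ?A = "\<lambda>h k. second_deriv_array \<phi> z h k - second_deriv_array \<phi> z' h k"
    have "norm (?A h k) \<le> (real DIM('a))\<^sup>2 * array_norm ?A * norm h * norm k"
      by (rule bilinear_norm_le_array_norm) (intro linear_compose_sub lin1 lin2)+
    also have "\<dots> \<le> (real DIM('a))\<^sup>2 * (L * norm (z - z')) * norm h * norm k"
      using lip by (intro mult_right_mono mult_left_mono) auto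
    finally show ?thesis by (simp add: mult_ac)
  qed
qed (use assms in auto)

section \<open>Measurability of superpositions\<close>

text \<open>Lebesgue measurability on the product does not make every section measurable. A Borel
  function agrees with \<open>F\<close> off a Borel null set \<open>N\<close>; by Fubini almost
  every section of \<open>N\<close> is null, and completeness makes the corresponding section of
  \<open>F\<close> measurable.\<close>

lemma AE_section_lebesgue_measurable_real:
  fixes F :: "real \<times> 'a::euclidean_space \<Rightarrow> real"
  assumes F: "F \<in> borel_measurable lebesgue"
  shows "AE z in lborel. (\<lambda>t. F (t, z)) \<in> borel_measurable lebesgue"
proof -
  obtain F' where F': "F' \<in> borel_measurable lborel" and ae: "AE p in lborel. F p = F' p"
    using completion_ex_borel_measurable_real[OF F] by blast
  obtain N where N: "N \<in> null_sets lborel" "{p. F p \<noteq> F' p} \<subseteq> N"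
    using ae by (auto simp: eventually_ae_filter)
  have Nsets: "N \<in> sets (lborel \<Otimes>\<^sub>M lborel)"
    unfolding lborel_prod using N(1) by (rule null_setsD2)
  have "AE p in lborel \<Otimes>\<^sub>M lborel. p \<notin> N"
    unfolding lborel_prod using N(1) by (rule AE_not_in)
  then have "AE t in lborel. AE z in lborel. (t, z) \<notin> N"
    by (rule lborel_pair.AE_pair)
  moreover have "{p \<in> space (lborel \<Otimes>\<^sub>M lborel). (fst p, snd p) \<notin> N} = space (lborel \<Otimes>\<^sub>M lborel) - N"
    by auto
  \<comment> \<open>Exchanging the two quantifiers requires \<open>N\<close> to be measurable in the
    product, which is why a Borel null set was taken.\<close>
  ultimately have "AE z in lborel. AE t in lborel. (t, z) \<notin> N"
    using sets.compl_sets[OF Nsets] by (subst (asm) lborel_pair.AE_commute) simp_all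
  then show ?thesis
  proof eventually_elim
    case (elim z)
    have "(\<lambda>t. F' (t, z)) \<in> borel_measurable borel"
      using F' by (intro measurable_compose[of "\<lambda>t. (t, z)" borel borel F' borel]) auto
    then have "(\<lambda>t. F' (t, z)) \<in> borel_measurable lebesgue"
      by (simp add: measurable_completion)
    moreover have "AE t in lebesgue. (t, z) \<notin> N"
      using elim by (rule AE_completion)
    then have "AE t in lebesgue. F' (t, z) = F (t, z)"
      by eventually_elim (use N(2) in \<open>force\<close>)
    ultimately show ?case
      by (rule borel_measurable_AE)
  qed
qed

lemma AE_section_lebesgue_measurable:
  fixes F :: "real \<times> 'a::euclidean_space \<Rightarrow> 'b::euclidean_space"
  assumes F: "F \<in> borel_measurable lebesgue"
  shows "AE z in lborel. (\<lambda>t. F (t, z)) \<in> borel_measurable lebesgue"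
proof -
  have "AE z in lborel. \<forall>i\<in>Basis. (\<lambda>t. F (t, z) \<bullet> i) \<in> borel_measurable lebesgue"
    using F by (intro AE_finite_allI AE_section_lebesgue_measurable_real) auto
  then show ?thesis
    by eventually_elim (simp add: borel_measurable_euclidean_space [symmetric])
qed

text \<open>The good parameters have a negligible complement, hence are dense, and continuity in
  \<open>z\<close> carries measurability of the sections from them to every
  \<open>z\<close>.\<close>

lemma caratheodory_section_measurable:
  fixes b :: "real \<Rightarrow> 'a::euclidean_space \<Rightarrow> 'b::euclidean_space"
  assumes b: "(\<lambda>(t, z). b t z) \<in> borel_measurable (lebesgue_on ({0..T} \<times> UNIV))"
    and cont: "\<And>t. t \<in> {0..T} \<Longrightarrow> continuous_on UNIV (b t)"
  shows "(\<lambda>t. b t z) \<in> borel_measurable (lebesgue_on {0..T})"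
proof -
  have S: "{0..T} \<times> (UNIV :: 'a set) \<in> sets lebesgue"
    by (metis borel_closed closed_Times closed_UNIV closed_real_atLeastAtMost sets_completionI_sets sets_lborel)
  have "(\<lambda>p. if p \<in> {0..T} \<times> UNIV then case p of (t, z) \<Rightarrow> b t z else 0) \<in> borel_measurable lebesgue"
    using b borel_measurable_if[OF S] by blast
  from AE_section_lebesgue_measurable[OF this]
  have "AE z in lborel. (\<lambda>t. b t z) \<in> borel_measurable (lebesgue_on {0..T})"
    by eventually_elim (simp add: borel_measurable_if[of "{0..T}", symmetric] cong: if_cong)
  then obtain N where N: "N \<in> null_sets lborel"
    "{z. (\<lambda>t. b t z) \<notin> borel_measurable (lebesgue_on {0..T})} \<subseteq> N"
    by (auto simp: eventually_ae_filter)
  have neg: "negligible N"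
    using N(1) by (simp add: negligible_iff_null_sets null_sets_completionI)
  have "\<exists>z'. dist z z' < inverse (real (Suc n)) \<and> z' \<notin> N" for n
  proof (rule ccontr)
    assume "\<not> ?thesis"
    then have "ball z (inverse (real (Suc n))) \<subseteq> N" by auto
    then have "negligible (ball z (inverse (real (Suc n))))"
      using neg negligible_subset by blast
    then show False
      using open_not_negligible[of "ball z (inverse (real (Suc n)))"] by simp
  qed
  then obtain s where s: "\<And>n. dist z (s n) < inverse (real (Suc n))" "\<And>n. s n \<notin> N"
    by metis
  have "s \<longlonglongrightarrow> z"
    using s(1) by (intro metric_tendsto_imp_tendsto[OF LIMSEQ_inverse_real_of_nat])
      (auto simp: dist_commute intro!: always_eventually less_imp_le)
  show ?thesis
  proof (rule borel_measurable_LIMSEQ_metric)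
    show "(\<lambda>t. b t (s n)) \<in> borel_measurable (lebesgue_on {0..T})" for n
      using s(2)[of n] N(2) by blast
    show "(\<lambda>n. b t (s n)) \<longlonglongrightarrow> b t z" if "t \<in> space (lebesgue_on {0..T})" for t
      using cont[of t] that \<open>s \<longlonglongrightarrow> z\<close>
      by (intro continuous_on_tendsto_compose[of UNIV "b t" s z]) auto
  qed
qed

text \<open>Along a simple function only finitely many fixed sections occur; continuity passes to
  the limit of simple functions.\<close>

lemma caratheodory_measurable:
  fixes b :: "real \<Rightarrow> 'a::euclidean_space \<Rightarrow> 'b::euclidean_space"
  assumes b: "(\<lambda>(t, z). b t z) \<in> borel_measurable (lebesgue_on ({0..T} \<times> UNIV))"
    and cont: "\<And>t. t \<in> {0..T} \<Longrightarrow> continuous_on UNIV (b t)"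
    and \<zeta>: "\<zeta> \<in> borel_measurable (lebesgue_on {0..T})"
  shows "(\<lambda>t. b t (\<zeta> t)) \<in> borel_measurable (lebesgue_on {0..T})"
proof -
  obtain s where s: "\<And>n. simple_function (lebesgue_on {0..T}) (s n)"
    and lim: "\<And>t. t \<in> space (lebesgue_on {0..T}) \<Longrightarrow> (\<lambda>n. s n t) \<longlonglongrightarrow> \<zeta> t"
    using borel_measurable_implies_sequence_metric[OF \<zeta>, of 0] by blast
  show ?thesis
  proof (rule borel_measurable_LIMSEQ_metric)
    show "(\<lambda>t. b t (s n t)) \<in> borel_measurable (lebesgue_on {0..T})" for n
    proof (rule measurable_compose_countable'[where f="\<lambda>z t. b t z" and g="s n" and I="s n ` space (lebesgue_on {0..T})"])
      show "s n \<in> measurable (lebesgue_on {0..T}) (count_space (s n ` space (lebesgue_on {0..T})))"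
        using s[of n] by (simp add: simple_function_def measurable_count_space_eq2)
      show "countable (s n ` space (lebesgue_on {0..T}))"
        using s[of n] by (auto simp: simple_function_def countable_finite)
    qed (rule caratheodory_section_measurable[OF b cont])
    show "(\<lambda>n. b t (s n t)) \<longlonglongrightarrow> b t (\<zeta> t)" if "t \<in> space (lebesgue_on {0..T})" for t
      using cont[of t] that lim[OF that]
      by (intro continuous_on_tendsto_compose[of UNIV "b t" "\<lambda>n. s n t"]) auto
  qed
qed

section \<open>Measurability of derivatives along measurable curves\<close>

lemma has_derivative_difference_quotient:
  fixes \<phi> :: "'a::real_normed_vector \<Rightarrow> 'b::real_normed_vector"
  assumes "(\<phi> has_derivative D) (at z)"
  shows "(\<lambda>n. real (Suc n) *\<^sub>R (\<phi> (z + inverse (real (Suc n)) *\<^sub>R h) - \<phi> z)) \<longlonglongrightarrow> D h"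
proof -
  have "((\<lambda>s. \<phi> (z + s *\<^sub>R h)) has_derivative (\<lambda>s. D (s *\<^sub>R h))) (at 0)"
    by (rule has_derivative_compose[of "\<lambda>s. z + s *\<^sub>R h" "\<lambda>s. s *\<^sub>R h" 0 UNIV \<phi> D]) (auto intro!: derivative_eq_intros assms)
  moreover have "(\<lambda>s. D (s *\<^sub>R h)) = (\<lambda>s. s *\<^sub>R D h)"
    using assms by (simp add: linear_scale has_derivative_linear)
  ultimately have "((\<lambda>s. \<phi> (z + s *\<^sub>R h)) has_vector_derivative D h) (at 0)"
    by (simp add: has_vector_derivative_def)
  then have "((\<lambda>s. norm (\<phi> (z + s *\<^sub>R h) - \<phi> z - s *\<^sub>R D h) / norm s) \<longlongrightarrow> 0) (at 0)"
    by (simp add: has_vector_derivative_def has_derivative_at)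
  then have "(\<lambda>n. norm (\<phi> (z + inverse (real (Suc n)) *\<^sub>R h) - \<phi> z - inverse (real (Suc n)) *\<^sub>R D h) / norm (inverse (real (Suc n)))) \<longlonglongrightarrow> 0"
    by (rule filterlim_compose) (auto simp: filterlim_at LIMSEQ_inverse_real_of_nat simp del: of_nat_Suc)
  then have "(\<lambda>n. norm (real (Suc n) *\<^sub>R (\<phi> (z + inverse (real (Suc n)) *\<^sub>R h) - \<phi> z) - D h)) \<longlonglongrightarrow> 0"
  proof (rule Lim_transform_eventually, intro always_eventually allI)
    fix n
    have "norm (\<phi> (z + inverse (real (Suc n)) *\<^sub>R h) - \<phi> z - inverse (real (Suc n)) *\<^sub>R D h) / norm (inverse (real (Suc n)))
       = norm (real (Suc n) *\<^sub>R (\<phi> (z + inverse (real (Suc n)) *\<^sub>R h) - \<phi> z - inverse (real (Suc n)) *\<^sub>R D h))"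
      by (simp add: divide_inverse mult.commute del: of_nat_Suc)
    also have "\<dots> = norm (real (Suc n) *\<^sub>R (\<phi> (z + inverse (real (Suc n)) *\<^sub>R h) - \<phi> z) - D h)"
      by (simp add: scaleR_diff_right del: of_nat_Suc)
    finally show "norm (\<phi> (z + inverse (real (Suc n)) *\<^sub>R h) - \<phi> z - inverse (real (Suc n)) *\<^sub>R D h) / norm (inverse (real (Suc n)))
       = norm (real (Suc n) *\<^sub>R (\<phi> (z + inverse (real (Suc n)) *\<^sub>R h) - \<phi> z) - D h)" .
  qed
  then show ?thesis
    by (rule LIM_zero_cancel[OF tendsto_norm_zero_cancel])
qed

text \<open>A limit of difference quotients of superpositions, taken in a direction
  \<open>h t\<close> that itself varies measurably.\<close>

lemma first_derivative_measurable:
  fixes b :: "real \<Rightarrow> 'a::euclidean_space \<Rightarrow> 'b::euclidean_space"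
  assumes b: "(\<lambda>(t, z). b t z) \<in> borel_measurable (lebesgue_on ({0..T} \<times> UNIV))"
    and td: "\<And>t. t \<in> {0..T} \<Longrightarrow> twice_differentiable (b t)"
    and \<zeta>: "\<zeta> \<in> borel_measurable (lebesgue_on {0..T})" and h: "h \<in> borel_measurable (lebesgue_on {0..T})"
  shows "(\<lambda>t. frechet_derivative (b t) (at (\<zeta> t)) (h t)) \<in> borel_measurable (lebesgue_on {0..T})"
proof -
  have cont: "continuous_on UNIV (b t)" if "t \<in> {0..T}" for t
    by (intro continuous_at_imp_continuous_on ballI
        has_derivative_continuous[OF twice_differentiableD(1)[OF td[OF that]]])
  show ?thesis
  proof (rule borel_measurable_LIMSEQ_metric)
    show "(\<lambda>t. real (Suc n) *\<^sub>R (b t (\<zeta> t + inverse (real (Suc n)) *\<^sub>R h t) - b t (\<zeta> t)))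
        \<in> borel_measurable (lebesgue_on {0..T})" for n
      using \<zeta> h by (intro borel_measurable_scaleR borel_measurable_diff borel_measurable_add borel_measurable_const
          caratheodory_measurable[OF b cont])
    show "(\<lambda>n. real (Suc n) *\<^sub>R (b t (\<zeta> t + inverse (real (Suc n)) *\<^sub>R h t) - b t (\<zeta> t)))
        \<longlonglongrightarrow> frechet_derivative (b t) (at (\<zeta> t)) (h t)" if "t \<in> space (lebesgue_on {0..T})" for t
      using that by (intro has_derivative_difference_quotient twice_differentiableD(1) td) simp
  qed
qed

lemma second_derivative_measurable:
  fixes b :: "real \<Rightarrow> 'a::euclidean_space \<Rightarrow> 'b::euclidean_space"
  assumes b: "(\<lambda>(t, z). b t z) \<in> borel_measurable (lebesgue_on ({0..T} \<times> UNIV))"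
    and td: "\<And>t. t \<in> {0..T} \<Longrightarrow> twice_differentiable (b t)"
    and \<zeta>: "\<zeta> \<in> borel_measurable (lebesgue_on {0..T})" and h: "h \<in> borel_measurable (lebesgue_on {0..T})"
    and k: "k \<in> borel_measurable (lebesgue_on {0..T})"
  shows "(\<lambda>t. second_deriv_array (b t) (\<zeta> t) (h t) (k t)) \<in> borel_measurable (lebesgue_on {0..T})"
proof (rule borel_measurable_LIMSEQ_metric)
  show "(\<lambda>t. real (Suc n) *\<^sub>R (frechet_derivative (b t) (at (\<zeta> t + inverse (real (Suc n)) *\<^sub>R k t)) (h t)
        - frechet_derivative (b t) (at (\<zeta> t)) (h t))) \<in> borel_measurable (lebesgue_on {0..T})" for n
  proof -
    have "(\<lambda>t. \<zeta> t + inverse (real (Suc n)) *\<^sub>R k t) \<in> borel_measurable (lebesgue_on {0..T})"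
      using \<zeta> k by (intro borel_measurable_add borel_measurable_scaleR borel_measurable_const)
    from first_derivative_measurable[OF b td this h] first_derivative_measurable[OF b td \<zeta> h]
    show ?thesis
      by (intro borel_measurable_scaleR borel_measurable_diff borel_measurable_const)
  qed
  show "(\<lambda>n. real (Suc n) *\<^sub>R (frechet_derivative (b t) (at (\<zeta> t + inverse (real (Suc n)) *\<^sub>R k t)) (h t)
        - frechet_derivative (b t) (at (\<zeta> t)) (h t)))
      \<longlonglongrightarrow> second_deriv_array (b t) (\<zeta> t) (h t) (k t)" if "t \<in> space (lebesgue_on {0..T})" for t
    using that by (intro has_derivative_difference_quotient[OF twice_differentiableD(2)[OF td]]) simp
qed

section \<open>The control problem in the joint variable \<open>(x,u)\<close>\<close>

text \<open>Turns estimates for scalar linear forms into estimates for their representing vectors,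
  by testing with \<open>v\<close> itself. All bounds for the gradient of the Hamiltonian are
  obtained this way.\<close>

lemma norm_le_if_inner_le:
  fixes v :: "'a::euclidean_space"
  assumes "\<And>h. v \<bullet> h \<le> B * norm h"
  shows "norm v \<le> B"
proof (cases "v = 0")
  \<comment> \<open>Testing with \<open>v\<close> says nothing here; a basis vector shows that
    \<open>B\<close> is nonnegative.\<close>
  case True
  obtain e :: 'a where "e \<in> Basis"
    using nonempty_Basis by blast
  then show ?thesis
    using assms[of e] True by simp
next
  case False
  have "norm v * norm v \<le> B * norm v"
    using assms[of v] by (simp add: power2_norm_eq_inner [symmetric] power2_eq_square)
  then show ?thesis using False by simp
qed

definition riesz :: "('a::euclidean_space \<Rightarrow> real) \<Rightarrow> 'a" where
  "riesz l = (\<Sum>i\<in>Basis. l i *\<^sub>R i)"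

lemma inner_riesz: "linear l \<Longrightarrow> riesz l \<bullet> h = l h"
proof -
  assume l: "linear l"
  have "l h = l (\<Sum>i\<in>Basis. (h \<bullet> i) *\<^sub>R i)"
    by (simp add: euclidean_representation)
  also have "\<dots> = (\<Sum>i\<in>Basis. (h \<bullet> i) * l i)"
    by (simp only: linear_sum[OF l] linear_scale[OF l] real_scaleR_def)
  finally show ?thesis
    by (simp add: riesz_def inner_sum_left inner_commute[of h] mult.commute)
qed

lemma solves_ode_ae_unique:
  fixes x y :: "real \<Rightarrow> 'a::euclidean_space"
  assumes x: "solves_ode_ae T F x" and y: "solves_ode_ae T F y" and "K > 0"
    and lip: "\<And>t \<xi> \<eta>. t \<in> {0..T} \<Longrightarrow> norm (F t \<xi> - F t \<eta>) \<le> K * norm (\<xi> - \<eta>)"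
    and eq: "x (if fwd then 0 else T) = y (if fwd then 0 else T)" and t: "t \<in> {0..T}"
  shows "x t = y t"
proof -
  have "norm (x t - y t) \<le> 2 * exp (2 * K * T) * (norm (x (if fwd then 0 else T) - y (if fwd then 0 else T)) + (LINT t|lebesgue_on {0..T}. 0))"
    using lip by (intro solves_ode_ae_bound[OF solves_ode_ae_diff[OF x y] \<open>K > 0\<close> _ _ _ t] AE_I2) auto
  then show ?thesis using eq by simp
qed

lemma continuous_on_imp_measurable_lebesgue_on:
  fixes w :: "real \<Rightarrow> 'a::euclidean_space"
  shows "continuous_on {0..T} w \<Longrightarrow> w \<in> borel_measurable (lebesgue_on {0..T})"
  by (rule continuous_imp_measurable_on_sets_lebesgue) auto

lemma continuous_on_Icc_bounded:
  fixes w :: "real \<Rightarrow> 'a::euclidean_space"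
  assumes "continuous_on {0..T} w"
  obtains B where "B \<ge> 0" "\<forall>t\<in>{0..T}. norm (w t) \<le> B"
proof -
  have "bounded (w ` {0..T})"
    by (intro compact_imp_bounded compact_continuous_image assms) auto
  then obtain B where "\<forall>t\<in>{0..T}. norm (w t) \<le> B"
    unfolding bounded_iff by blast
  then show ?thesis
    by (intro that[of "max 0 B"]) (auto intro: max.coboundedI2 simp del: atLeastAtMost_iff)
qed

lemma inner_le_mult: "norm v \<le> B \<Longrightarrow> w \<bullet> v \<le> norm w * B"
  for v w :: "'b::real_inner"
  by (rule order_trans[OF norm_cauchy_schwarz mult_left_mono]) simp_all

lemma AE_lebesgue_onI: "(\<And>t. t \<in> {0..T} \<Longrightarrow> P t) \<Longrightarrow> AE t in lebesgue_on {0..T}. P t"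
  by (rule AE_I2) auto

lemma solves_ode_ae_cong:
  fixes z :: "real \<Rightarrow> 'a::euclidean_space"
  assumes "solves_ode_ae T F z" "\<And>t. t \<in> {0..T} \<Longrightarrow> F t (z t) = F' t (z t)"
  shows "solves_ode_ae T F' z"
proof -
  have "AE t in lebesgue_on {0..T}. F t (z t) = F' t (z t)"
    by (rule AE_lebesgue_onI) (rule assms(2))
  moreover have "AE t in lebesgue_on {0..T}. (z has_vector_derivative F t (z t)) (at t within {0..T})"
    using assms(1) by (simp add: solves_ode_ae_def)
  ultimately have "AE t in lebesgue_on {0..T}. (z has_vector_derivative F' t (z t)) (at t within {0..T})"
    by eventually_elim simp
  then show ?thesis
    using assms(1) by (simp add: solves_ode_ae_def)
qed

lemma LINT_eq_has_integral:
  fixes h :: "real \<Rightarrow> real"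
  assumes "integrable (lebesgue_on {0..T}) h" "(h has_integral i) {0..T}"
  shows "(LINT t|lebesgue_on {0..T}. h t) = i"
  using lebesgue_integral_eq_integral[OF assms(1)] assms(2) by (simp add: integral_unique)

lemma integrable_lebesgue_on_bound:
  fixes h :: "real \<Rightarrow> 'a::euclidean_space"
  assumes "h \<in> borel_measurable (lebesgue_on {0..T})" "integrable (lebesgue_on {0..T}) k"
    and "\<And>t. t \<in> {0..T} \<Longrightarrow> norm (h t) \<le> k t"
  shows "integrable (lebesgue_on {0..T}) h"
proof (rule Bochner_Integration.integrable_bound[OF assms(2,1)], rule AE_I2)
  fix t assume "t \<in> space (lebesgue_on {0..T})"
  then have "norm (h t) \<le> k t"
    by (intro assms(3)) simp
  then show "norm (h t) \<le> norm (k t)"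
    by simp
qed

lemma norm_fst_le_norm: "norm (fst z) \<le> norm z" and norm_snd_le_norm: "norm (snd z) \<le> norm z"
  using norm_fst_le[of "fst z" "snd z"] norm_snd_le[of "snd z" "fst z"] by simp_all

lemma fst_snd_measurable:
  fixes z :: "'c \<Rightarrow> 'a::euclidean_space \<times> 'b::euclidean_space"
  assumes "z \<in> borel_measurable M"
  shows "(\<lambda>t. fst (z t)) \<in> borel_measurable M" "(\<lambda>t. snd (z t)) \<in> borel_measurable M"
  by (intro borel_measurable_continuous_on[OF _ assms] continuous_intros)+

text \<open>State and control are merged into one variable, so that each Taylor estimate is made
  once and the blocks of the second derivative are separated only at the end. One constant
  \<open>C\<close> serves all bounds; the derivative of \<open>b\<close> is bounded, whereas that of
  \<open>f\<close> may grow linearly.\<close>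

locale control_problem =
  fixes T C :: real
    and b :: "real \<Rightarrow> 'x::euclidean_space \<times> 'u::euclidean_space \<Rightarrow> 'x"
    and f :: "real \<Rightarrow> 'x \<times> 'u \<Rightarrow> real"
    and g :: "'x \<Rightarrow> real"
    and x0 :: 'x
  assumes T_pos: "T > 0" and C_pos: "C > 0"
    and b_measurable: "(\<lambda>(t, z). b t z) \<in> borel_measurable (lebesgue_on ({0..T} \<times> UNIV))"
    and f_measurable: "(\<lambda>(t, z). f t z) \<in> borel_measurable (lebesgue_on ({0..T} \<times> UNIV))"
    and b_smooth: "t \<in> {0..T} \<Longrightarrow> lipschitz_second_derivative (b t) C"
    and f_smooth: "t \<in> {0..T} \<Longrightarrow> lipschitz_second_derivative (f t) C"
    and g_smooth: "lipschitz_second_derivative g C"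
    and b_growth: "t \<in> {0..T} \<Longrightarrow> norm (b t z) \<le> C * (1 + norm z)"
    and b'_bound: "t \<in> {0..T} \<Longrightarrow> norm (frechet_derivative (b t) (at z) h) \<le> C * norm h"
    and f_growth: "t \<in> {0..T} \<Longrightarrow> \<bar>f t z\<bar> \<le> C * (1 + (norm z)\<^sup>2)"
    and f'_bound: "t \<in> {0..T} \<Longrightarrow> \<bar>frechet_derivative (f t) (at z) h\<bar> \<le> C * (1 + norm z) * norm h"
begin

definition Db where "Db t z h = frechet_derivative (b t) (at z) h"
definition Df where "Df t z h = frechet_derivative (f t) (at z) h"
definition Dg where "Dg z h = frechet_derivative g (at z) h"
definition D2b where "D2b t z h k = second_deriv_array (b t) z h k"
definition D2f where "D2f t z h k = second_deriv_array (f t) z h k"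
definition D2g where "D2g z h k = second_deriv_array g z h k"

text \<open>In terms of the Hamiltonian \<open>H(t,z,p)\<close> with \<open>z = (x,u)\<close>: \<open>grad_ham\<close> is the gradient of \<open>H\<close> in \<open>z\<close>,
  and \<open>grad_ham_lin\<close> the linearization of \<open>grad_ham\<close> in the direction \<open>(k, \<psi>)\<close> of \<open>(z, p)\<close>.
  The adjoint equation is \<open>p' = - fst grad_ham\<close>, and \<open>J'(u) = snd grad_ham\<close>.\<close>

definition grad_ham where
  "grad_ham t z p = riesz (\<lambda>h. p \<bullet> Db t z h + Df t z h)"
definition grad_ham_lin where
  "grad_ham_lin t z p k \<psi> = riesz (\<lambda>h. \<psi> \<bullet> Db t z h + p \<bullet> D2b t z h k + D2f t z h k)"
definition grad_g where "grad_g z = riesz (Dg z)"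
definition hess_g where "hess_g z k = riesz (\<lambda>h. D2g z h k)"

lemma linear_Db: "t \<in> {0..T} \<Longrightarrow> linear (Db t z)"
  using lipschitz_second_derivative.linear_first[OF b_smooth] by (simp add: Db_def [abs_def])
lemma linear_Df: "t \<in> {0..T} \<Longrightarrow> linear (Df t z)"
  using lipschitz_second_derivative.linear_first[OF f_smooth] by (simp add: Df_def [abs_def])
lemma linear_Dg: "linear (Dg z)"
  using lipschitz_second_derivative.linear_first[OF g_smooth] by (simp add: Dg_def [abs_def])
lemma linear_D2b: "t \<in> {0..T} \<Longrightarrow> linear (\<lambda>h. D2b t z h k)" "t \<in> {0..T} \<Longrightarrow> linear (D2b t z h)"
  using lipschitz_second_derivative.linear_second1[OF b_smooth] lipschitz_second_derivative.linear_second2[OF b_smooth]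
  by (simp_all add: D2b_def [abs_def])
lemma linear_D2f: "t \<in> {0..T} \<Longrightarrow> linear (\<lambda>h. D2f t z h k)" "t \<in> {0..T} \<Longrightarrow> linear (D2f t z h)"
  using lipschitz_second_derivative.linear_second1[OF f_smooth] lipschitz_second_derivative.linear_second2[OF f_smooth]
  by (simp_all add: D2f_def [abs_def])
lemma linear_D2g: "linear (\<lambda>h. D2g z h k)" "linear (D2g z h)"
  using lipschitz_second_derivative.linear_second1[OF g_smooth] lipschitz_second_derivative.linear_second2[OF g_smooth]
  by (simp_all add: D2g_def [abs_def])

lemma inner_grad_ham: "t \<in> {0..T} \<Longrightarrow> grad_ham t z p \<bullet> h = p \<bullet> Db t z h + Df t z h"
  unfolding grad_ham_def
  by (subst inner_riesz) (auto intro!: linear_compose_add linear_Df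
      linear_compose[OF linear_Db bounded_linear.linear[OF bounded_linear_inner_right], unfolded o_def])

lemma inner_grad_ham_lin:
  "t \<in> {0..T} \<Longrightarrow> grad_ham_lin t z p k \<psi> \<bullet> h = \<psi> \<bullet> Db t z h + p \<bullet> D2b t z h k + D2f t z h k"
  unfolding grad_ham_lin_def
  by (subst inner_riesz) (auto intro!: linear_compose_add linear_D2f
      linear_compose[OF linear_Db bounded_linear.linear[OF bounded_linear_inner_right], unfolded o_def]
      linear_compose[OF linear_D2b(1) bounded_linear.linear[OF bounded_linear_inner_right], unfolded o_def])

lemma inner_grad_g: "grad_g z \<bullet> h = Dg z h"
  unfolding grad_g_def by (rule inner_riesz[OF linear_Dg])

lemma inner_hess_g: "hess_g z k \<bullet> h = D2g z h k"
  unfolding hess_g_def by (rule inner_riesz[OF linear_D2g(1)])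

lemma Db_bound: "t \<in> {0..T} \<Longrightarrow> norm (Db t z h) \<le> C * norm h"
  unfolding Db_def by (rule b'_bound)
lemma Df_bound: "t \<in> {0..T} \<Longrightarrow> \<bar>Df t z h\<bar> \<le> C * (1 + norm z) * norm h"
  unfolding Df_def by (rule f'_bound)
lemma D2b_bound: "t \<in> {0..T} \<Longrightarrow> norm (D2b t z h k) \<le> C * norm h * norm k"
  unfolding D2b_def by (rule lipschitz_second_derivative.second_bound[OF b_smooth])
lemma D2f_bound: "t \<in> {0..T} \<Longrightarrow> \<bar>D2f t z h k\<bar> \<le> C * norm h * norm k"
  unfolding D2f_def using lipschitz_second_derivative.second_bound[OF f_smooth] by fastforce
lemma D2g_bound: "\<bar>D2g z h k\<bar> \<le> C * norm h * norm k"
  unfolding D2g_def using lipschitz_second_derivative.second_bound[OF g_smooth] by fastforce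

lemma b_lipschitz: "t \<in> {0..T} \<Longrightarrow> norm (b t z' - b t z) \<le> C * norm (z' - z)"
proof (rule differentiable_bound[where S=UNIV and f'="\<lambda>\<zeta>. Db t \<zeta>"])
  fix \<zeta> assume "t \<in> {0..T}"
  then show "(b t has_derivative Db t \<zeta>) (at \<zeta> within UNIV)"
    using lipschitz_second_derivative.first_has_derivative[OF b_smooth] by (simp add: Db_def [abs_def])
  show "onorm (Db t \<zeta>) \<le> C"
    using C_pos Db_bound[OF \<open>t \<in> {0..T}\<close>] by (intro onorm_bound) auto
qed auto

lemma b_taylor: "t \<in> {0..T} \<Longrightarrow> norm (b t z' - b t z - Db t z (z' - z)) \<le> C * (norm (z' - z))\<^sup>2"
  unfolding Db_def by (rule lipschitz_second_derivative.taylor_zero[OF b_smooth])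

lemma f_taylor: "t \<in> {0..T} \<Longrightarrow> \<bar>f t z' - f t z - Df t z (z' - z)\<bar> \<le> C * (norm (z' - z))\<^sup>2"
  unfolding Df_def using lipschitz_second_derivative.taylor_zero[OF f_smooth] by fastforce

lemma g_taylor: "\<bar>g z' - g z - Dg z (z' - z)\<bar> \<le> C * (norm (z' - z))\<^sup>2"
  unfolding Dg_def using lipschitz_second_derivative.taylor_zero[OF g_smooth] by fastforce

section \<open>Bounds and Taylor estimates for the gradient of the Hamiltonian\<close>

lemma grad_ham_bound:
  assumes t: "t \<in> {0..T}"
  shows "norm (grad_ham t z p) \<le> C * norm p + C * (1 + norm z)"
proof (rule norm_le_if_inner_le)
  fix h
  have "p \<bullet> Db t z h \<le> norm p * (C * norm h)" "Df t z h \<le> C * (1 + norm z) * norm h"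
    using inner_le_mult[OF Db_bound[OF t]] Df_bound[OF t, of z h] by auto
  then show "grad_ham t z p \<bullet> h \<le> (C * norm p + C * (1 + norm z)) * norm h"
    unfolding inner_grad_ham[OF t] by (simp add: algebra_simps)
qed

lemma grad_ham_lipschitz_p:
  assumes t: "t \<in> {0..T}"
  shows "norm (grad_ham t z p' - grad_ham t z p) \<le> C * norm (p' - p)"
proof (rule norm_le_if_inner_le)
  fix h
  have "(p' - p) \<bullet> Db t z h \<le> norm (p' - p) * (C * norm h)"
    by (rule inner_le_mult[OF Db_bound[OF t]])
  then show "(grad_ham t z p' - grad_ham t z p) \<bullet> h \<le> C * norm (p' - p) * norm h"
    unfolding inner_diff_left inner_grad_ham[OF t] by (simp add: algebra_simps)
qed

lemma Db_lipschitz: "t \<in> {0..T} \<Longrightarrow> norm (Db t z' h - Db t z h) \<le> C * norm (z' - z) * norm h"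
  unfolding Db_def by (rule lipschitz_second_derivative.first_lipschitz[OF b_smooth])

lemma Df_lipschitz: "t \<in> {0..T} \<Longrightarrow> \<bar>Df t z' h - Df t z h\<bar> \<le> C * norm (z' - z) * norm h"
  unfolding Df_def using lipschitz_second_derivative.first_lipschitz[OF f_smooth] by fastforce

text \<open>The factor \<open>1 + norm p\<close> arises because \<open>p\<close> weights the second
  derivative of \<open>b\<close>. Perturbations in \<open>z\<close> are therefore measured at the
  unperturbed adjoint, whose bound does not depend on \<epsilon>.\<close>

lemma grad_ham_lipschitz_z:
  assumes t: "t \<in> {0..T}"
  shows "norm (grad_ham t z' p - grad_ham t z p) \<le> C * (1 + norm p) * norm (z' - z)"
proof (rule norm_le_if_inner_le)
  fix h
  have "p \<bullet> (Db t z' h - Db t z h) \<le> norm p * (C * norm (z' - z) * norm h)"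
    by (rule inner_le_mult[OF Db_lipschitz[OF t]])
  moreover have "Df t z' h - Df t z h \<le> C * norm (z' - z) * norm h"
    using Df_lipschitz[OF t, of z' h z] by auto
  ultimately show "(grad_ham t z' p - grad_ham t z p) \<bullet> h \<le> C * (1 + norm p) * norm (z' - z) * norm h"
    unfolding inner_diff_left inner_grad_ham[OF t] by (simp add: algebra_simps)
qed

lemma grad_ham_lin_bound:
  assumes t: "t \<in> {0..T}"
  shows "norm (grad_ham_lin t z p k \<psi>) \<le> C * norm \<psi> + C * (1 + norm p) * norm k"
proof (rule norm_le_if_inner_le)
  fix h
  have "\<psi> \<bullet> Db t z h \<le> norm \<psi> * (C * norm h)" "p \<bullet> D2b t z h k \<le> norm p * (C * norm h * norm k)"
    "D2f t z h k \<le> C * norm h * norm k"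
    using inner_le_mult[OF Db_bound[OF t]] inner_le_mult[OF D2b_bound[OF t]] D2f_bound[OF t, of z h k] by auto
  then show "grad_ham_lin t z p k \<psi> \<bullet> h \<le> (C * norm \<psi> + C * (1 + norm p) * norm k) * norm h"
    unfolding inner_grad_ham_lin[OF t] by (simp add: algebra_simps)
qed

lemma grad_ham_lin_linear:
  assumes t: "t \<in> {0..T}"
  shows "grad_ham_lin t z p (k + c *\<^sub>R k') (\<psi> + c *\<^sub>R \<psi>') = grad_ham_lin t z p k \<psi> + c *\<^sub>R grad_ham_lin t z p k' \<psi>'"
  by (rule vector_eq_rdot[THEN iffD1])
    (auto simp: inner_grad_ham_lin[OF t] inner_add_left inner_add_right linear_add[OF linear_D2b(2)[OF t]] linear_add[OF linear_D2f(2)[OF t]]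
        linear_scale[OF linear_D2b(2)[OF t]] linear_scale[OF linear_D2f(2)[OF t]] algebra_simps)

text \<open>Here \<open>k\<close> and \<psi> are arbitrary approximations of the increments
  \<open>z' - z\<close> and \<open>p' - p\<close>. Besides their defects, the error contains the
  squared increment of \<open>z\<close> and, because the coefficient of \<open>p\<close> varies with
  \<open>z\<close>, the product of the two increments.\<close>

lemma grad_ham_taylor:
  assumes t: "t \<in> {0..T}"
  shows "norm (grad_ham t z' p' - grad_ham t z p - grad_ham_lin t z p k \<psi>)
    \<le> C * norm (p' - p - \<psi>) + C * norm (z' - z) * norm (p' - p)
      + C * (1 + norm p) * (norm (z' - z))\<^sup>2 + C * (1 + norm p) * norm (z' - z - k)"
proof (rule norm_le_if_inner_le)
  fix h
  let ?\<Delta> = "z' - z"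
  have b1: "norm (Db t z' h - Db t z h - D2b t z h ?\<Delta>) \<le> C * norm h * (norm ?\<Delta>)\<^sup>2"
    unfolding Db_def D2b_def by (rule lipschitz_second_derivative.taylor_first[OF b_smooth[OF t]])
  have f1: "\<bar>Df t z' h - Df t z h - D2f t z h ?\<Delta>\<bar> \<le> C * norm h * (norm ?\<Delta>)\<^sup>2"
    unfolding Df_def D2f_def using lipschitz_second_derivative.taylor_first[OF f_smooth[OF t]] by fastforce
  \<comment> \<open>An exact splitting into six terms: the defect of \<psi>, the product of the
    increments, the Taylor remainders of \<open>Db\<close> and \<open>Df\<close>, and the defect of
    \<open>k\<close> under the two second derivatives.\<close>
  have "(grad_ham t z' p' - grad_ham t z p - grad_ham_lin t z p k \<psi>) \<bullet> h
    = (p' - p - \<psi>) \<bullet> Db t z h + (p' - p) \<bullet> (Db t z' h - Db t z h)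
      + p \<bullet> (Db t z' h - Db t z h - D2b t z h ?\<Delta>) + (Df t z' h - Df t z h - D2f t z h ?\<Delta>)
      + p \<bullet> D2b t z h (?\<Delta> - k) + D2f t z h (?\<Delta> - k)"
    unfolding inner_diff_left inner_grad_ham[OF t] inner_grad_ham_lin[OF t]
      linear_diff[OF linear_D2b(2)[OF t]] linear_diff[OF linear_D2f(2)[OF t]]
    by (simp add: algebra_simps)
  also have "\<dots> \<le> norm (p' - p - \<psi>) * (C * norm h) + norm (p' - p) * (C * norm ?\<Delta> * norm h)
      + norm p * (C * norm h * (norm ?\<Delta>)\<^sup>2) + C * norm h * (norm ?\<Delta>)\<^sup>2
      + norm p * (C * norm h * norm (?\<Delta> - k)) + C * norm h * norm (?\<Delta> - k)"
    using f1 D2f_bound[OF t, of z h "?\<Delta> - k"]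
    by (intro add_mono inner_le_mult Db_bound[OF t] Db_lipschitz[OF t] b1 D2b_bound[OF t]) auto
  finally show "(grad_ham t z' p' - grad_ham t z p - grad_ham_lin t z p k \<psi>) \<bullet> h
      \<le> (C * norm (p' - p - \<psi>) + C * norm ?\<Delta> * norm (p' - p)
      + C * (1 + norm p) * (norm ?\<Delta>)\<^sup>2 + C * (1 + norm p) * norm (?\<Delta> - k)) * norm h"
    by (simp add: algebra_simps)
qed

lemma grad_g_lipschitz: "norm (grad_g z' - grad_g z) \<le> C * norm (z' - z)"
proof (rule norm_le_if_inner_le)
  fix h
  have "Dg z' h - Dg z h \<le> C * norm (z' - z) * norm h"
    unfolding Dg_def using lipschitz_second_derivative.first_lipschitz[OF g_smooth, of z' h z] by auto
  then show "(grad_g z' - grad_g z) \<bullet> h \<le> C * norm (z' - z) * norm h"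
    by (simp add: inner_diff_left inner_grad_g)
qed

lemma hess_g_bound: "norm (hess_g z k) \<le> C * norm k"
proof (rule norm_le_if_inner_le)
  fix h show "hess_g z k \<bullet> h \<le> C * norm k * norm h"
    using D2g_bound[of z h k] by (simp add: inner_hess_g mult_ac)
qed

lemma hess_g_linear: "hess_g z (k + c *\<^sub>R k') = hess_g z k + c *\<^sub>R hess_g z k'"
  by (rule vector_eq_rdot[THEN iffD1])
    (auto simp: inner_hess_g inner_add_left linear_add[OF linear_D2g(2)] linear_scale[OF linear_D2g(2)])

lemma grad_g_taylor:
  "norm (grad_g z' - grad_g z - hess_g z k) \<le> C * (norm (z' - z))\<^sup>2 + C * norm (z' - z - k)"
proof (rule norm_le_if_inner_le)
  fix h
  have "Dg z' h - Dg z h - D2g z h (z' - z) \<le> C * norm h * (norm (z' - z))\<^sup>2"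
    unfolding Dg_def D2g_def using lipschitz_second_derivative.taylor_first[OF g_smooth, of z' h z] by auto
  moreover have "D2g z h (z' - z - k) \<le> C * norm h * norm (z' - z - k)"
    using D2g_bound[of z h "z' - z - k"] by auto
  ultimately show "(grad_g z' - grad_g z - hess_g z k) \<bullet> h \<le> (C * (norm (z' - z))\<^sup>2 + C * norm (z' - z - k)) * norm h"
    using linear_diff[OF linear_D2g(2), of z h "z' - z" k]
    unfolding inner_diff_left inner_grad_g inner_hess_g by (simp add: algebra_simps)
qed

lemma b_measurable_comp: "\<zeta> \<in> borel_measurable (lebesgue_on {0..T}) \<Longrightarrow> (\<lambda>t. b t (\<zeta> t)) \<in> borel_measurable (lebesgue_on {0..T})"
  by (rule caratheodory_measurable[OF b_measurable])
    (auto intro!: continuous_at_imp_continuous_on has_derivative_continuous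
        lipschitz_second_derivative.first_has_derivative[OF b_smooth])

lemma f_measurable_comp: "\<zeta> \<in> borel_measurable (lebesgue_on {0..T}) \<Longrightarrow> (\<lambda>t. f t (\<zeta> t)) \<in> borel_measurable (lebesgue_on {0..T})"
  by (rule caratheodory_measurable[OF f_measurable])
    (auto intro!: continuous_at_imp_continuous_on has_derivative_continuous
        lipschitz_second_derivative.first_has_derivative[OF f_smooth])

lemmas b_twice_diff = lipschitz_second_derivative.twice_diff[OF b_smooth]
lemmas f_twice_diff = lipschitz_second_derivative.twice_diff[OF f_smooth]

lemma Db_measurable:
  assumes "\<zeta> \<in> borel_measurable (lebesgue_on {0..T})" "h \<in> borel_measurable (lebesgue_on {0..T})"
  shows "(\<lambda>t. Db t (\<zeta> t) (h t)) \<in> borel_measurable (lebesgue_on {0..T})"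
  unfolding Db_def by (rule first_derivative_measurable[OF b_measurable b_twice_diff assms])

lemma Df_measurable:
  assumes "\<zeta> \<in> borel_measurable (lebesgue_on {0..T})" "h \<in> borel_measurable (lebesgue_on {0..T})"
  shows "(\<lambda>t. Df t (\<zeta> t) (h t)) \<in> borel_measurable (lebesgue_on {0..T})"
  unfolding Df_def by (rule first_derivative_measurable[OF f_measurable f_twice_diff assms])

lemma grad_ham_measurable:
  assumes "\<zeta> \<in> borel_measurable (lebesgue_on {0..T})" "p \<in> borel_measurable (lebesgue_on {0..T})"
  shows "(\<lambda>t. grad_ham t (\<zeta> t) (p t)) \<in> borel_measurable (lebesgue_on {0..T})"
  unfolding grad_ham_def riesz_def
  by (intro borel_measurable_sum borel_measurable_scaleR borel_measurable_add borel_measurable_inner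
      borel_measurable_const Db_measurable Df_measurable assms)

lemma grad_ham_lin_measurable:
  assumes "\<zeta> \<in> borel_measurable (lebesgue_on {0..T})" "p \<in> borel_measurable (lebesgue_on {0..T})"
    "k \<in> borel_measurable (lebesgue_on {0..T})" "\<psi> \<in> borel_measurable (lebesgue_on {0..T})"
  shows "(\<lambda>t. grad_ham_lin t (\<zeta> t) (p t) (k t) (\<psi> t)) \<in> borel_measurable (lebesgue_on {0..T})"
  unfolding grad_ham_lin_def riesz_def D2b_def D2f_def
  by (intro borel_measurable_sum borel_measurable_scaleR borel_measurable_add borel_measurable_inner
      borel_measurable_const Db_measurable assms
      second_derivative_measurable[OF b_measurable b_twice_diff]
      second_derivative_measurable[OF f_measurable f_twice_diff])

section \<open>The four differential equations: existence and uniqueness\<close>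

definition state_of where
  "state_of u x \<longleftrightarrow> solves_ode_ae T (\<lambda>t \<xi>. b t (\<xi>, u t)) x \<and> x 0 = x0"
definition adjoint_of where
  "adjoint_of u x p \<longleftrightarrow> solves_ode_ae T (\<lambda>t \<pi>. - fst (grad_ham t (x t, u t) \<pi>)) p \<and> p T = grad_g (x T)"
definition state_var_of where
  "state_var_of u x v y \<longleftrightarrow> solves_ode_ae T (\<lambda>t \<eta>. Db t (x t, u t) (\<eta>, v t)) y \<and> y 0 = 0"
definition adjoint_var_of where
  "adjoint_var_of u x p v y \<psi> \<longleftrightarrow>
    solves_ode_ae T (\<lambda>t \<eta>. - fst (grad_ham_lin t (x t, u t) (p t) (y t, v t) \<eta>)) \<psi> \<and> \<psi> T = hess_g (x T) (y T)"

lemma state_of_continuous: "state_of u x \<Longrightarrow> continuous_on {0..T} x"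
  unfolding state_of_def by (rule solves_ode_ae_imp_continuous_on[OF conjunct1])
lemma adjoint_of_continuous: "adjoint_of u x p \<Longrightarrow> continuous_on {0..T} p"
  unfolding adjoint_of_def by (rule solves_ode_ae_imp_continuous_on[OF conjunct1])
lemma state_var_of_continuous: "state_var_of u x v y \<Longrightarrow> continuous_on {0..T} y"
  unfolding state_var_of_def by (rule solves_ode_ae_imp_continuous_on[OF conjunct1])
lemma adjoint_var_of_continuous: "adjoint_var_of u x p v y \<psi> \<Longrightarrow> continuous_on {0..T} \<psi>"
  unfolding adjoint_var_of_def by (rule solves_ode_ae_imp_continuous_on[OF conjunct1])

lemma Pair_measurable:
  fixes x :: "real \<Rightarrow> 'x" and u :: "real \<Rightarrow> 'u"
  assumes "continuous_on {0..T} x" "u \<in> Lspace T 2"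
  shows "(\<lambda>t. (x t, u t)) \<in> borel_measurable (lebesgue_on {0..T})"
  by (rule borel_measurable_Pair[OF continuous_on_imp_measurable_lebesgue_on[OF assms(1)] Lspace_measurable[OF assms(2)]])

lemma state_rhs_lipschitz:
  "t \<in> {0..T} \<Longrightarrow> norm (b t (\<xi>, \<mu>) - b t (\<eta>, \<mu>)) \<le> C * norm (\<xi> - \<eta>)"
  using b_lipschitz[of t "(\<xi>, \<mu>)" "(\<eta>, \<mu>)"] by simp

lemma adjoint_rhs_lipschitz:
  "t \<in> {0..T} \<Longrightarrow> norm (- fst (grad_ham t z \<pi>) - - fst (grad_ham t z \<rho>)) \<le> C * norm (\<pi> - \<rho>)"
  using order_trans[OF norm_fst_le_norm grad_ham_lipschitz_p[of t z \<rho> \<pi>]]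
  by (simp add: norm_minus_commute)

lemma state_var_rhs_lipschitz:
  assumes "t \<in> {0..T}"
  shows "norm (Db t z (\<xi>, \<mu>) - Db t z (\<eta>, \<mu>)) \<le> C * norm (\<xi> - \<eta>)"
  using Db_bound[OF assms, of z "(\<xi> - \<eta>, 0)"] linear_diff[OF linear_Db[OF assms], of z "(\<xi>, \<mu>)" "(\<eta>, \<mu>)"] by simp

lemma grad_ham_lin_diff:
  "t \<in> {0..T} \<Longrightarrow> grad_ham_lin t z p k \<psi> - grad_ham_lin t z p k' \<psi>' = grad_ham_lin t z p (k - k') (\<psi> - \<psi>')"
  using grad_ham_lin_linear[of t z p k "-1" k' \<psi> \<psi>'] by simp

lemma adjoint_var_rhs_lipschitz:
  assumes "t \<in> {0..T}"
  shows "norm (- fst (grad_ham_lin t z p k \<xi>) - - fst (grad_ham_lin t z p k \<eta>)) \<le> C * norm (\<xi> - \<eta>)"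
proof -
  have "- fst (grad_ham_lin t z p k \<xi>) - - fst (grad_ham_lin t z p k \<eta>) = - fst (grad_ham_lin t z p 0 (\<xi> - \<eta>))"
    using arg_cong[OF grad_ham_lin_diff[OF assms, of z p k \<xi> k \<eta>], of fst]
    by (simp add: algebra_simps)
  then show ?thesis
    using order_trans[OF norm_fst_le_norm grad_ham_lin_bound[OF assms, of z p 0 "\<xi> - \<eta>"]] by simp
qed

lemma state_exists:
  assumes u: "u \<in> Lspace T 2"
  shows "\<exists>x. state_of u x"
proof -
  \<comment> \<open>The constant condition matches the direction flag of
    \<open>solves_ode_ae_exists\<close>; the adjoint equations use \<open>False\<close>.\<close>
  have "\<exists>x. solves_ode_ae T (\<lambda>t \<xi>. b t (\<xi>, u t)) x \<and> x (if True then 0 else T) = x0"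
  proof (rule solves_ode_ae_exists[OF _ C_pos])
    fix w :: "real \<Rightarrow> 'x" assume w: "continuous_on {0..T} w"
    obtain B where B: "\<forall>t\<in>{0..T}. norm (w t) \<le> B"
      by (rule continuous_on_Icc_bounded[OF w])
    show "integrable (lebesgue_on {0..T}) (\<lambda>t. b t (w t, u t))"
    proof (rule integrable_lebesgue_on_bound)
      show "(\<lambda>t. b t (w t, u t)) \<in> borel_measurable (lebesgue_on {0..T})"
        by (rule b_measurable_comp[OF Pair_measurable[OF w u]])
      show "integrable (lebesgue_on {0..T}) (\<lambda>t. C * (1 + (B + norm (u t))))"
        using Lspace_2_integrable[OF u] by simp
      fix t assume t: "t \<in> {0..T}"
      have "norm (w t, u t) \<le> B + norm (u t)"
        using B t norm_Pair_le[of "w t" "u t"] by fastforce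
      then show "norm (b t (w t, u t)) \<le> C * (1 + (B + norm (u t)))"
        using b_growth[OF t, of "(w t, u t)"] C_pos by (meson add_left_mono less_imp_le mult_left_mono order_trans)
    qed
  qed (rule less_imp_le[OF T_pos], rule state_rhs_lipschitz)
  then show ?thesis unfolding state_of_def by simp
qed

lemma adjoint_exists:
  assumes u: "u \<in> Lspace T 2" and x: "state_of u x"
  shows "\<exists>p. adjoint_of u x p"
proof -
  have xc: "continuous_on {0..T} x" by (rule state_of_continuous[OF x])
  obtain A where A: "\<forall>t\<in>{0..T}. norm (x t) \<le> A"
    by (rule continuous_on_Icc_bounded[OF xc])
  have "\<exists>p. solves_ode_ae T (\<lambda>t \<pi>. - fst (grad_ham t (x t, u t) \<pi>)) p \<and> p (if False then 0 else T) = grad_g (x T)"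
  proof (rule solves_ode_ae_exists[OF _ C_pos])
    fix w :: "real \<Rightarrow> 'x" assume w: "continuous_on {0..T} w"
    obtain B where B: "\<forall>t\<in>{0..T}. norm (w t) \<le> B"
      by (rule continuous_on_Icc_bounded[OF w])
    show "integrable (lebesgue_on {0..T}) (\<lambda>t. - fst (grad_ham t (x t, u t) (w t)))"
    proof (rule integrable_lebesgue_on_bound)
      have "(\<lambda>t. grad_ham t (x t, u t) (w t)) \<in> borel_measurable (lebesgue_on {0..T})"
        by (rule grad_ham_measurable[OF Pair_measurable[OF xc u] continuous_on_imp_measurable_lebesgue_on[OF w]])
      then show "(\<lambda>t. - fst (grad_ham t (x t, u t) (w t))) \<in> borel_measurable (lebesgue_on {0..T})"
        by (intro borel_measurable_uminus fst_snd_measurable)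
      show "integrable (lebesgue_on {0..T}) (\<lambda>t. C * B + C * (1 + (A + norm (u t))))"
        using Lspace_2_integrable[OF u] by simp
      fix t assume t: "t \<in> {0..T}"
      have 1: "norm (x t, u t) \<le> A + norm (u t)" "norm (w t) \<le> B"
        using A B t norm_Pair_le[of "x t" "u t"] by fastforce+
      have "norm (- fst (grad_ham t (x t, u t) (w t))) \<le> C * norm (w t) + C * (1 + norm (x t, u t))"
        using order_trans[OF norm_fst_le_norm grad_ham_bound[OF t]] by simp
      also have "\<dots> \<le> C * B + C * (1 + (A + norm (u t)))"
        using 1 C_pos by (intro add_mono mult_left_mono) auto
      finally show "norm (- fst (grad_ham t (x t, u t) (w t))) \<le> C * B + C * (1 + (A + norm (u t)))" .
    qed
  qed (rule less_imp_le[OF T_pos], rule adjoint_rhs_lipschitz)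
  then show ?thesis unfolding adjoint_of_def by simp
qed

lemma state_var_exists:
  assumes u: "u \<in> Lspace T 2" and xc: "continuous_on {0..T} x" and v: "v \<in> Lspace T 2"
  shows "\<exists>y. state_var_of u x v y"
proof -
  have "\<exists>y. solves_ode_ae T (\<lambda>t \<eta>. Db t (x t, u t) (\<eta>, v t)) y \<and> y (if True then 0 else T) = 0"
  proof (rule solves_ode_ae_exists[OF _ C_pos])
    fix w :: "real \<Rightarrow> 'x" assume w: "continuous_on {0..T} w"
    obtain B where B: "\<forall>t\<in>{0..T}. norm (w t) \<le> B"
      by (rule continuous_on_Icc_bounded[OF w])
    show "integrable (lebesgue_on {0..T}) (\<lambda>t. Db t (x t, u t) (w t, v t))"
    proof (rule integrable_lebesgue_on_bound)
      show "(\<lambda>t. Db t (x t, u t) (w t, v t)) \<in> borel_measurable (lebesgue_on {0..T})"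
        by (rule Db_measurable[OF Pair_measurable[OF xc u] Pair_measurable[OF w v]])
      show "integrable (lebesgue_on {0..T}) (\<lambda>t. C * (B + norm (v t)))"
        using Lspace_2_integrable[OF v] by simp
      fix t assume t: "t \<in> {0..T}"
      have "norm (w t, v t) \<le> B + norm (v t)"
        using B t norm_Pair_le[of "w t" "v t"] by fastforce
      then show "norm (Db t (x t, u t) (w t, v t)) \<le> C * (B + norm (v t))"
        using Db_bound[OF t, of "(x t, u t)" "(w t, v t)"] C_pos by (meson less_imp_le mult_left_mono order_trans)
    qed
  qed (rule less_imp_le[OF T_pos], rule state_var_rhs_lipschitz)
  then show ?thesis unfolding state_var_of_def by simp
qed

lemma adjoint_var_exists:
  assumes u: "u \<in> Lspace T 2" and xc: "continuous_on {0..T} x" and pc: "continuous_on {0..T} p"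
    and v: "v \<in> Lspace T 2" and yc: "continuous_on {0..T} y"
  shows "\<exists>\<psi>. adjoint_var_of u x p v y \<psi>"
proof -
  obtain A where A: "A \<ge> 0" "\<forall>t\<in>{0..T}. norm (y t) \<le> A"
    by (rule continuous_on_Icc_bounded[OF yc])
  obtain P where P: "P \<ge> 0" "\<forall>t\<in>{0..T}. norm (p t) \<le> P"
    by (rule continuous_on_Icc_bounded[OF pc])
  have "\<exists>\<psi>. solves_ode_ae T (\<lambda>t \<eta>. - fst (grad_ham_lin t (x t, u t) (p t) (y t, v t) \<eta>)) \<psi> \<and>
      \<psi> (if False then 0 else T) = hess_g (x T) (y T)"
  proof (rule solves_ode_ae_exists[OF _ C_pos])
    fix w :: "real \<Rightarrow> 'x" assume w: "continuous_on {0..T} w"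
    obtain B where B: "\<forall>t\<in>{0..T}. norm (w t) \<le> B"
      by (rule continuous_on_Icc_bounded[OF w])
    show "integrable (lebesgue_on {0..T}) (\<lambda>t. - fst (grad_ham_lin t (x t, u t) (p t) (y t, v t) (w t)))"
    proof (rule integrable_lebesgue_on_bound)
      have "(\<lambda>t. grad_ham_lin t (x t, u t) (p t) (y t, v t) (w t)) \<in> borel_measurable (lebesgue_on {0..T})"
        by (intro grad_ham_lin_measurable Pair_measurable xc u yc v continuous_on_imp_measurable_lebesgue_on pc w)
      then show "(\<lambda>t. - fst (grad_ham_lin t (x t, u t) (p t) (y t, v t) (w t))) \<in> borel_measurable (lebesgue_on {0..T})"
        by (intro borel_measurable_uminus fst_snd_measurable)
      show "integrable (lebesgue_on {0..T}) (\<lambda>t. C * B + C * (1 + P) * (A + norm (v t)))"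
        using Lspace_2_integrable[OF v] by simp
      fix t assume t: "t \<in> {0..T}"
      have 1: "norm (y t, v t) \<le> A + norm (v t)" "norm (w t) \<le> B" "norm (p t) \<le> P"
        using A B P t norm_Pair_le[of "y t" "v t"] by fastforce+
      have "norm (- fst (grad_ham_lin t (x t, u t) (p t) (y t, v t) (w t)))
          \<le> C * norm (w t) + C * (1 + norm (p t)) * norm (y t, v t)"
        using order_trans[OF norm_fst_le_norm grad_ham_lin_bound[OF t]] by simp
      also have "\<dots> \<le> C * B + C * (1 + P) * (A + norm (v t))"
        using 1 C_pos P(1) by (intro add_mono mult_mono) auto
      finally show "norm (- fst (grad_ham_lin t (x t, u t) (p t) (y t, v t) (w t)))
          \<le> C * B + C * (1 + P) * (A + norm (v t))" .
    qed
  qed (rule less_imp_le[OF T_pos], rule adjoint_var_rhs_lipschitz)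
  then show ?thesis unfolding adjoint_var_of_def by simp
qed

lemma state_unique:
  assumes x: "state_of u x" and x': "state_of u x'" and t: "t \<in> {0..T}"
  shows "x t = x' t"
  using solves_ode_ae_unique[OF x[unfolded state_of_def, THEN conjunct1] x'[unfolded state_of_def, THEN conjunct1]
      C_pos state_rhs_lipschitz _ t, where fwd=True] x x'
  by (simp add: state_of_def)

lemma state_var_unique:
  assumes y: "state_var_of u x v y" and y': "state_var_of u x v y'" and t: "t \<in> {0..T}"
  shows "y t = y' t"
  using solves_ode_ae_unique[OF y[unfolded state_var_of_def, THEN conjunct1] y'[unfolded state_var_of_def, THEN conjunct1]
      C_pos state_var_rhs_lipschitz _ t, where fwd=True] y y'
  by (simp add: state_var_of_def)

text \<open>States are determined on [0,T] only, so the two adjoint equations may be formulated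
  along functions that differ elsewhere.\<close>

lemma adjoint_unique:
  assumes p: "adjoint_of u x p" and p': "adjoint_of u x' p'" and x: "\<And>t. t \<in> {0..T} \<Longrightarrow> x t = x' t"
    and t: "t \<in> {0..T}"
  shows "p t = p' t"
proof -
  have "solves_ode_ae T (\<lambda>t \<pi>. - fst (grad_ham t (x t, u t) \<pi>)) p'"
    using x by (intro solves_ode_ae_cong[OF p'[unfolded adjoint_of_def, THEN conjunct1]]) simp
  moreover have "p T = p' T"
    using p p' x[of T] T_pos by (simp add: adjoint_of_def)
  ultimately show ?thesis
    using solves_ode_ae_unique[OF p[unfolded adjoint_of_def, THEN conjunct1] _ C_pos adjoint_rhs_lipschitz _ t, where fwd=False]
    by simp
qed

lemma adjoint_var_unique:
  assumes \<psi>: "adjoint_var_of u x p v y \<psi>" and \<psi>': "adjoint_var_of u x p v y' \<psi>'"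
    and y: "\<And>t. t \<in> {0..T} \<Longrightarrow> y t = y' t" and t: "t \<in> {0..T}"
  shows "\<psi> t = \<psi>' t"
proof -
  have "solves_ode_ae T (\<lambda>t \<eta>. - fst (grad_ham_lin t (x t, u t) (p t) (y t, v t) \<eta>)) \<psi>'"
    using y by (intro solves_ode_ae_cong[OF \<psi>'[unfolded adjoint_var_of_def, THEN conjunct1]]) simp
  moreover have "\<psi> T = \<psi>' T"
    using \<psi> \<psi>' y[of T] T_pos by (simp add: adjoint_var_of_def)
  ultimately show ?thesis
    using solves_ode_ae_unique[OF \<psi>[unfolded adjoint_var_of_def, THEN conjunct1] _ C_pos adjoint_var_rhs_lipschitz _ t, where fwd=False]
    by simp
qed

section \<open>Perturbation estimates\<close>

text \<open>The control moves by exactly \<epsilon> v, so its linearization has no error and the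
  remainder of the pair sits in the state component alone.\<close>

lemma pair_perturbation:
  fixes y :: "'x" and v u :: "'u"
  assumes "norm (x' - x) \<le> c * \<bar>\<epsilon>\<bar>" "c \<ge> 0"
  shows "norm ((x', u + \<epsilon> *\<^sub>R v) - (x, u)) \<le> \<bar>\<epsilon>\<bar> * (c + norm v)"
    and "(norm ((x', u + \<epsilon> *\<^sub>R v) - (x, u)))\<^sup>2 \<le> \<epsilon>\<^sup>2 * (c\<^sup>2 + (norm v)\<^sup>2)"
    and "(x', u + \<epsilon> *\<^sub>R v) - (x, u) - \<epsilon> *\<^sub>R (y, v) = (x' - x - \<epsilon> *\<^sub>R y, 0)"
proof -
  show "norm ((x', u + \<epsilon> *\<^sub>R v) - (x, u)) \<le> \<bar>\<epsilon>\<bar> * (c + norm v)"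
    using assms norm_Pair_le[of "x' - x" "\<epsilon> *\<^sub>R v"] by (simp add: algebra_simps)
  have "(norm (x' - x))\<^sup>2 \<le> (c * \<bar>\<epsilon>\<bar>)\<^sup>2"
    using assms by (intro power_mono) auto
  then show "(norm ((x', u + \<epsilon> *\<^sub>R v) - (x, u)))\<^sup>2 \<le> \<epsilon>\<^sup>2 * (c\<^sup>2 + (norm v)\<^sup>2)"
    by (simp add: norm_Pair power_mult_distrib algebra_simps)
  show "(x', u + \<epsilon> *\<^sub>R v) - (x, u) - \<epsilon> *\<^sub>R (y, v) = (x' - x - \<epsilon> *\<^sub>R y, 0)"
    by simp
qed

lemma cost_integrable:
  assumes u: "u \<in> Lspace T 2" and xc: "continuous_on {0..T} x"
  shows "integrable (lebesgue_on {0..T}) (\<lambda>t. f t (x t, u t))"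
proof -
  obtain A where A: "A \<ge> 0" "\<forall>t\<in>{0..T}. norm (x t) \<le> A"
    by (rule continuous_on_Icc_bounded[OF xc])
  show ?thesis
  proof (rule integrable_lebesgue_on_bound)
    show "(\<lambda>t. f t (x t, u t)) \<in> borel_measurable (lebesgue_on {0..T})"
      by (rule f_measurable_comp[OF Pair_measurable[OF xc u]])
    show "integrable (lebesgue_on {0..T}) (\<lambda>t. C * (1 + (A\<^sup>2 + (norm (u t))\<^sup>2)))"
      using u by (simp add: Lspace_2_iff)
    fix t assume t: "t \<in> {0..T}"
    have "(norm (x t, u t))\<^sup>2 \<le> A\<^sup>2 + (norm (u t))\<^sup>2"
      using A t by (auto simp: norm_Pair intro!: power_mono)
    then show "norm (f t (x t, u t)) \<le> C * (1 + (A\<^sup>2 + (norm (u t))\<^sup>2))"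
      using order_trans[OF f_growth[OF t, of "(x t, u t)"] mult_left_mono] C_pos by simp
  qed
qed

context
  fixes u v :: "real \<Rightarrow> 'u" and x p y \<psi> :: "real \<Rightarrow> 'x"
  assumes u: "u \<in> Lspace T 2" and v: "v \<in> Lspace T 2"
    and x: "state_of u x" and p: "adjoint_of u x p"
    and y: "state_var_of u x v y" and \<psi>: "adjoint_var_of u x p v y \<psi>"
begin

lemma integrable_norms:
  "integrable (lebesgue_on {0..T}) (\<lambda>t. norm (v t))" "integrable (lebesgue_on {0..T}) (\<lambda>t. (norm (v t))\<^sup>2)"
  "integrable (lebesgue_on {0..T}) (\<lambda>t. norm (u t))"
  using Lspace_2_integrable[OF v] Lspace_2_integrable[OF u] v by (auto simp: Lspace_2_iff)

text \<open>Gronwall with forcing term \<open>C * (\<bar>\<epsilon>\<bar> * norm (v t))\<close> and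
  equal initial values. The constant is fixed before \<epsilon> and \<open>x'\<close>, so the bound
  is uniform in the perturbation.\<close>

lemma state_perturbation_lipschitz:
  obtains c where "c \<ge> 0"
    "\<forall>\<epsilon> x'. state_of (\<lambda>s. u s + \<epsilon> *\<^sub>R v s) x' \<longrightarrow> (\<forall>t\<in>{0..T}. norm (x' t - x t) \<le> c * \<bar>\<epsilon>\<bar>)"
proof (rule that; (intro allI impI ballI)?)
  let ?V = "LINT t|lebesgue_on {0..T}. norm (v t)"
  show "2 * exp (2 * C * T) * (C * ?V) \<ge> 0"
    using C_pos by simp
  fix \<epsilon> x' t assume x': "state_of (\<lambda>s. u s + \<epsilon> *\<^sub>R v s) x'" and t: "t \<in> {0..T}"
  have sol: "solves_ode_ae T (\<lambda>t _. b t (x' t, u t + \<epsilon> *\<^sub>R v t) - b t (x t, u t)) (\<lambda>t. x' t - x t)"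
    by (rule solves_ode_ae_diff[OF x'[unfolded state_of_def, THEN conjunct1] x[unfolded state_of_def, THEN conjunct1]])
  have "norm (x' t - x t) \<le> 2 * exp (2 * C * T) * (norm (x' (if True then 0 else T) - x (if True then 0 else T))
      + (LINT t|lebesgue_on {0..T}. C * (\<bar>\<epsilon>\<bar> * norm (v t))))"
  proof (rule solves_ode_ae_bound[OF sol C_pos _ _ _ t])
    show "integrable (lebesgue_on {0..T}) (\<lambda>t. C * (\<bar>\<epsilon>\<bar> * norm (v t)))"
      using integrable_norms by simp
    show "0 \<le> C * (\<bar>\<epsilon>\<bar> * norm (v t))" for t
      using C_pos by simp
    show "AE t in lebesgue_on {0..T}. norm (b t (x' t, u t + \<epsilon> *\<^sub>R v t) - b t (x t, u t))
        \<le> C * norm (x' t - x t) + C * (\<bar>\<epsilon>\<bar> * norm (v t))"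
    proof (rule AE_lebesgue_onI)
      fix t assume t: "t \<in> {0..T}"
      have "norm (b t (x' t, u t + \<epsilon> *\<^sub>R v t) - b t (x t, u t)) \<le> C * norm (x' t - x t, \<epsilon> *\<^sub>R v t)"
        using b_lipschitz[OF t, of "(x' t, u t + \<epsilon> *\<^sub>R v t)" "(x t, u t)"] by simp
      also have "\<dots> \<le> C * (norm (x' t - x t) + norm (\<epsilon> *\<^sub>R v t))"
        using C_pos by (intro mult_left_mono norm_Pair_le) auto
      finally show "norm (b t (x' t, u t + \<epsilon> *\<^sub>R v t) - b t (x t, u t))
          \<le> C * norm (x' t - x t) + C * (\<bar>\<epsilon>\<bar> * norm (v t))"
        by (simp add: algebra_simps)
    qed
  qed
  then show "norm (x' t - x t) \<le> 2 * exp (2 * C * T) * (C * ?V) * \<bar>\<epsilon>\<bar>"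
    using x x' by (simp add: state_of_def mult_ac)
qed

text \<open>The linear part of the error acts on the remainder itself and is absorbed by Gronwall;
  what is left is quadratic in the increments and integrable because v is square integrable.\<close>

lemma state_perturbation_taylor:
  obtains c where "c \<ge> 0"
    "\<forall>\<epsilon> x'. state_of (\<lambda>s. u s + \<epsilon> *\<^sub>R v s) x' \<longrightarrow> (\<forall>t\<in>{0..T}. norm (x' t - x t - \<epsilon> *\<^sub>R y t) \<le> c * \<epsilon>\<^sup>2)"
proof -
  obtain c1 where c1: "c1 \<ge> 0"
    "\<forall>\<epsilon> x'. state_of (\<lambda>s. u s + \<epsilon> *\<^sub>R v s) x' \<longrightarrow> (\<forall>t\<in>{0..T}. norm (x' t - x t) \<le> c1 * \<bar>\<epsilon>\<bar>)"
    by (rule state_perturbation_lipschitz)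
  define k where "k t = C * (c1\<^sup>2 + (norm (v t))\<^sup>2)" for t
  have k: "integrable (lebesgue_on {0..T}) k" "k t \<ge> 0" for t
    using integrable_norms C_pos by (auto simp: k_def [abs_def])
  show ?thesis
  proof (rule that; (intro allI impI ballI)?)
    show "2 * exp (2 * C * T) * (LINT t|lebesgue_on {0..T}. k t) \<ge> 0"
      using k(2) by simp
    fix \<epsilon> x' t assume x': "state_of (\<lambda>s. u s + \<epsilon> *\<^sub>R v s) x'" and t: "t \<in> {0..T}"
    have "solves_ode_ae T (\<lambda>t _. b t (x' t, u t + \<epsilon> *\<^sub>R v t) - b t (x t, u t)) (\<lambda>t. x' t - x t)"
      by (rule solves_ode_ae_diff[OF x'[unfolded state_of_def, THEN conjunct1] x[unfolded state_of_def, THEN conjunct1]])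
    from solves_ode_ae_linear_combination[OF this y[unfolded state_var_of_def, THEN conjunct1], of "-\<epsilon>"]
    have sol: "solves_ode_ae T (\<lambda>t _. b t (x' t, u t + \<epsilon> *\<^sub>R v t) - b t (x t, u t) - \<epsilon> *\<^sub>R Db t (x t, u t) (y t, v t))
        (\<lambda>t. x' t - x t - \<epsilon> *\<^sub>R y t)"
      by simp
    have "norm (x' t - x t - \<epsilon> *\<^sub>R y t) \<le> 2 * exp (2 * C * T) *
        (norm (x' (if True then 0 else T) - x (if True then 0 else T) - \<epsilon> *\<^sub>R y (if True then 0 else T))
        + (LINT t|lebesgue_on {0..T}. \<epsilon>\<^sup>2 * k t))"
    proof (rule solves_ode_ae_bound[OF sol C_pos _ _ _ t])
      show "integrable (lebesgue_on {0..T}) (\<lambda>t. \<epsilon>\<^sup>2 * k t)" "0 \<le> \<epsilon>\<^sup>2 * k t" for t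
        using k by auto
      show "AE t in lebesgue_on {0..T}. norm (b t (x' t, u t + \<epsilon> *\<^sub>R v t) - b t (x t, u t) - \<epsilon> *\<^sub>R Db t (x t, u t) (y t, v t))
          \<le> C * norm (x' t - x t - \<epsilon> *\<^sub>R y t) + \<epsilon>\<^sup>2 * k t"
      proof (rule AE_lebesgue_onI)
        fix t assume t: "t \<in> {0..T}"
        let ?z = "(x t, u t)" and ?z' = "(x' t, u t + \<epsilon> *\<^sub>R v t)"
        have n: "norm (x' t - x t) \<le> c1 * \<bar>\<epsilon>\<bar>"
          using c1(2) x' t by blast
        \<comment> \<open>By linearity the derivative is applied to the remainder of the pair, whose
          control component is 0.\<close>
        have lin: "Db t ?z (?z' - ?z) - \<epsilon> *\<^sub>R Db t ?z (y t, v t) = Db t ?z (x' t - x t - \<epsilon> *\<^sub>R y t, 0)"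
          unfolding linear_scale[OF linear_Db[OF t], symmetric] linear_diff[OF linear_Db[OF t], symmetric]
          by (simp only: pair_perturbation(3)[OF n c1(1)])
        have "norm (b t ?z' - b t ?z - \<epsilon> *\<^sub>R Db t ?z (y t, v t))
            \<le> norm (b t ?z' - b t ?z - Db t ?z (?z' - ?z)) + norm (Db t ?z (?z' - ?z) - \<epsilon> *\<^sub>R Db t ?z (y t, v t))"
          using norm_triangle_ineq[of "b t ?z' - b t ?z - Db t ?z (?z' - ?z)" "Db t ?z (?z' - ?z) - \<epsilon> *\<^sub>R Db t ?z (y t, v t)"]
          by (simp del: diff_Pair)
        also have "\<dots> \<le> C * (\<epsilon>\<^sup>2 * (c1\<^sup>2 + (norm (v t))\<^sup>2)) + C * norm (x' t - x t - \<epsilon> *\<^sub>R y t)"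
        proof (rule add_mono)
          show "norm (b t ?z' - b t ?z - Db t ?z (?z' - ?z)) \<le> C * (\<epsilon>\<^sup>2 * (c1\<^sup>2 + (norm (v t))\<^sup>2))"
            using b_taylor[OF t, of ?z' ?z] mult_left_mono[OF pair_perturbation(2)[OF n c1(1), of "u t" "v t"], of C] C_pos
            by linarith
          show "norm (Db t ?z (?z' - ?z) - \<epsilon> *\<^sub>R Db t ?z (y t, v t)) \<le> C * norm (x' t - x t - \<epsilon> *\<^sub>R y t)"
            unfolding lin using Db_bound[OF t, of ?z "(x' t - x t - \<epsilon> *\<^sub>R y t, 0)"] by simp
        qed
        finally show "norm (b t ?z' - b t ?z - \<epsilon> *\<^sub>R Db t ?z (y t, v t)) \<le> C * norm (x' t - x t - \<epsilon> *\<^sub>R y t) + \<epsilon>\<^sup>2 * k t"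
          by (simp add: k_def algebra_simps)
      qed
    qed
    then show "norm (x' t - x t - \<epsilon> *\<^sub>R y t) \<le> 2 * exp (2 * C * T) * (LINT t|lebesgue_on {0..T}. k t) * \<epsilon>\<^sup>2"
      using x x' y by (simp add: state_of_def state_var_of_def mult_ac)
  qed
qed

text \<open>At time T the increment is that of the gradient of \<open>g\<close>, which the state
  increment bounds; from there Gronwall runs backwards.\<close>

lemma adjoint_perturbation_lipschitz:
  obtains c where "c \<ge> 0"
    "\<forall>\<epsilon> x' p'. state_of (\<lambda>s. u s + \<epsilon> *\<^sub>R v s) x' \<longrightarrow> adjoint_of (\<lambda>s. u s + \<epsilon> *\<^sub>R v s) x' p' \<longrightarrow>
      (\<forall>t\<in>{0..T}. norm (p' t - p t) \<le> c * \<bar>\<epsilon>\<bar>)"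
proof -
  obtain c1 where c1: "c1 \<ge> 0"
    "\<forall>\<epsilon> x'. state_of (\<lambda>s. u s + \<epsilon> *\<^sub>R v s) x' \<longrightarrow> (\<forall>t\<in>{0..T}. norm (x' t - x t) \<le> c1 * \<bar>\<epsilon>\<bar>)"
    by (rule state_perturbation_lipschitz)
  obtain P where P: "P \<ge> 0" "\<forall>t\<in>{0..T}. norm (p t) \<le> P"
    by (rule continuous_on_Icc_bounded[OF adjoint_of_continuous[OF p]])
  define k where "k t = C * (1 + P) * (c1 + norm (v t))" for t
  have k: "integrable (lebesgue_on {0..T}) k" "k t \<ge> 0" for t
    using integrable_norms C_pos P(1) c1(1) by (auto simp: k_def [abs_def])
  show ?thesis
  proof (rule that; (intro allI impI ballI)?)
    show "2 * exp (2 * C * T) * (C * c1 + (LINT t|lebesgue_on {0..T}. k t)) \<ge> 0"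
      using k(2) C_pos c1(1) by simp
    fix \<epsilon> x' p' t assume x': "state_of (\<lambda>s. u s + \<epsilon> *\<^sub>R v s) x'"
      and p': "adjoint_of (\<lambda>s. u s + \<epsilon> *\<^sub>R v s) x' p'" and t: "t \<in> {0..T}"
    have sol: "solves_ode_ae T (\<lambda>t _. - fst (grad_ham t (x' t, u t + \<epsilon> *\<^sub>R v t) (p' t)) - - fst (grad_ham t (x t, u t) (p t)))
        (\<lambda>t. p' t - p t)"
      by (rule solves_ode_ae_diff[OF p'[unfolded adjoint_of_def, THEN conjunct1] p[unfolded adjoint_of_def, THEN conjunct1]])
    have "norm (p' t - p t) \<le> 2 * exp (2 * C * T) *
        (norm (p' (if False then 0 else T) - p (if False then 0 else T)) + (LINT t|lebesgue_on {0..T}. \<bar>\<epsilon>\<bar> * k t))"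
    proof (rule solves_ode_ae_bound[OF sol C_pos _ _ _ t])
      show "integrable (lebesgue_on {0..T}) (\<lambda>t. \<bar>\<epsilon>\<bar> * k t)" "0 \<le> \<bar>\<epsilon>\<bar> * k t" for t
        using k by auto
      show "AE t in lebesgue_on {0..T}.
          norm (- fst (grad_ham t (x' t, u t + \<epsilon> *\<^sub>R v t) (p' t)) - - fst (grad_ham t (x t, u t) (p t)))
          \<le> C * norm (p' t - p t) + \<bar>\<epsilon>\<bar> * k t"
      proof (rule AE_lebesgue_onI)
        fix t assume t: "t \<in> {0..T}"
        let ?z = "(x t, u t)" and ?z' = "(x' t, u t + \<epsilon> *\<^sub>R v t)"
        have n: "norm (x' t - x t) \<le> c1 * \<bar>\<epsilon>\<bar>"
          using c1(2) x' t by blast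
        have Pt: "norm (p t) \<le> P"
          using P(2) t by blast
        have "norm (- fst (grad_ham t ?z' (p' t)) - - fst (grad_ham t ?z (p t)))
            = norm (fst (grad_ham t ?z' (p' t) - grad_ham t ?z (p t)))"
          by (simp add: norm_minus_commute)
        also have "\<dots> \<le> norm (grad_ham t ?z' (p' t) - grad_ham t ?z (p t))"
          by (rule norm_fst_le_norm)
        \<comment> \<open>The change in \<open>z\<close> is measured at the unperturbed
          \<open>p\<close>, so that its bound \<open>P\<close> takes the place of an a priori bound
          for \<open>p'\<close>.\<close>
        also have "\<dots> \<le> norm (grad_ham t ?z' (p' t) - grad_ham t ?z' (p t)) + norm (grad_ham t ?z' (p t) - grad_ham t ?z (p t))"
          using norm_triangle_ineq[of "grad_ham t ?z' (p' t) - grad_ham t ?z' (p t)" "grad_ham t ?z' (p t) - grad_ham t ?z (p t)"] by simp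
        also have "\<dots> \<le> C * norm (p' t - p t) + C * (1 + P) * (\<bar>\<epsilon>\<bar> * (c1 + norm (v t)))"
        proof (rule add_mono[OF grad_ham_lipschitz_p[OF t] order_trans[OF grad_ham_lipschitz_z[OF t]]])
          show "C * (1 + norm (p t)) * norm (?z' - ?z) \<le> C * (1 + P) * (\<bar>\<epsilon>\<bar> * (c1 + norm (v t)))"
            using C_pos Pt P(1) by (intro mult_mono pair_perturbation(1)[OF n c1(1)]) auto
        qed
        finally show "norm (- fst (grad_ham t ?z' (p' t)) - - fst (grad_ham t ?z (p t))) \<le> C * norm (p' t - p t) + \<bar>\<epsilon>\<bar> * k t"
          by (simp add: k_def mult_ac)
      qed
    qed
    also have "norm (p' (if False then 0 else T) - p (if False then 0 else T)) \<le> C * (c1 * \<bar>\<epsilon>\<bar>)"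
    proof -
      have "norm (x' T - x T) \<le> c1 * \<bar>\<epsilon>\<bar>"
        using c1(2) x' T_pos by simp
      then have "C * norm (x' T - x T) \<le> C * (c1 * \<bar>\<epsilon>\<bar>)"
        using C_pos by (intro mult_left_mono) auto
      then show ?thesis
        using p p' order_trans[OF grad_g_lipschitz[of "x' T" "x T"]] by (simp add: adjoint_of_def)
    qed
    finally show "norm (p' t - p t) \<le> 2 * exp (2 * C * T) * (C * c1 + (LINT t|lebesgue_on {0..T}. k t)) * \<bar>\<epsilon>\<bar>"
      by (simp add: algebra_simps)
  qed
qed

text \<open>The source of the majorant for the difference quotients: \<open>1 + norm (v t)\<close>
  is square integrable, whereas a quadratic weight in v in general is not.\<close>

lemma grad_ham_perturbation_lipschitz:
  obtains c where "c \<ge> 0"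
    "\<forall>\<epsilon> x' p'. state_of (\<lambda>s. u s + \<epsilon> *\<^sub>R v s) x' \<longrightarrow> adjoint_of (\<lambda>s. u s + \<epsilon> *\<^sub>R v s) x' p' \<longrightarrow>
      (\<forall>t\<in>{0..T}. norm (grad_ham t (x' t, u t + \<epsilon> *\<^sub>R v t) (p' t) - grad_ham t (x t, u t) (p t)) \<le> \<bar>\<epsilon>\<bar> * (c * (1 + norm (v t))))"
proof -
  obtain c1 where c1: "c1 \<ge> 0"
    "\<forall>\<epsilon> x'. state_of (\<lambda>s. u s + \<epsilon> *\<^sub>R v s) x' \<longrightarrow> (\<forall>t\<in>{0..T}. norm (x' t - x t) \<le> c1 * \<bar>\<epsilon>\<bar>)"
    by (rule state_perturbation_lipschitz)
  obtain c3 where c3: "c3 \<ge> 0"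
    "\<forall>\<epsilon> x' p'. state_of (\<lambda>s. u s + \<epsilon> *\<^sub>R v s) x' \<longrightarrow> adjoint_of (\<lambda>s. u s + \<epsilon> *\<^sub>R v s) x' p' \<longrightarrow>
      (\<forall>t\<in>{0..T}. norm (p' t - p t) \<le> c3 * \<bar>\<epsilon>\<bar>)"
    by (rule adjoint_perturbation_lipschitz)
  obtain P where P: "P \<ge> 0" "\<forall>t\<in>{0..T}. norm (p t) \<le> P"
    by (rule continuous_on_Icc_bounded[OF adjoint_of_continuous[OF p]])
  show ?thesis
  proof (rule that; (intro allI impI ballI)?)
    show "C * c3 + C * (1 + P) * (c1 + 1) \<ge> 0"
      using C_pos c1(1) c3(1) P(1) by simp
    fix \<epsilon> x' p' t assume x': "state_of (\<lambda>s. u s + \<epsilon> *\<^sub>R v s) x'"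
      and p': "adjoint_of (\<lambda>s. u s + \<epsilon> *\<^sub>R v s) x' p'" and t: "t \<in> {0..T}"
    let ?z = "(x t, u t)" and ?z' = "(x' t, u t + \<epsilon> *\<^sub>R v t)"
    have n: "norm (x' t - x t) \<le> c1 * \<bar>\<epsilon>\<bar>"
      using c1(2) x' t by blast
    have n3: "norm (p' t - p t) \<le> c3 * \<bar>\<epsilon>\<bar>"
      using c3(2) x' p' t by blast
    have Pt: "norm (p t) \<le> P"
      using P(2) t by blast
    have "norm (grad_ham t ?z' (p' t) - grad_ham t ?z (p t))
        \<le> norm (grad_ham t ?z' (p' t) - grad_ham t ?z' (p t)) + norm (grad_ham t ?z' (p t) - grad_ham t ?z (p t))"
      using norm_triangle_ineq[of "grad_ham t ?z' (p' t) - grad_ham t ?z' (p t)" "grad_ham t ?z' (p t) - grad_ham t ?z (p t)"] by simp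
    also have "\<dots> \<le> C * norm (p' t - p t) + C * (1 + norm (p t)) * norm (?z' - ?z)"
      by (rule add_mono[OF grad_ham_lipschitz_p[OF t] grad_ham_lipschitz_z[OF t]])
    also have "\<dots> \<le> C * (c3 * \<bar>\<epsilon>\<bar>) + C * (1 + P) * (\<bar>\<epsilon>\<bar> * (c1 + norm (v t)))"
      using C_pos Pt P(1) by (intro add_mono mult_mono pair_perturbation(1)[OF n c1(1)] n3) auto
    also have "\<dots> = \<bar>\<epsilon>\<bar> * (C * c3 + C * (1 + P) * (c1 + norm (v t)))"
      by (simp add: algebra_simps)
    also have "\<dots> \<le> \<bar>\<epsilon>\<bar> * ((C * c3 + C * (1 + P) * (c1 + 1)) * (1 + norm (v t)))"
    proof (rule mult_left_mono)
      have "C * c3 * 1 \<le> C * c3 * (1 + norm (v t))"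
        using C_pos c3(1) by (intro mult_left_mono) auto
      moreover have "C * (1 + P) * (c1 + norm (v t)) \<le> C * (1 + P) * ((c1 + 1) * (1 + norm (v t)))"
        using C_pos c1(1) P(1) by (intro mult_left_mono) (auto simp: algebra_simps)
      ultimately show "C * c3 + C * (1 + P) * (c1 + norm (v t)) \<le> (C * c3 + C * (1 + P) * (c1 + 1)) * (1 + norm (v t))"
        by (simp add: distrib_right mult.assoc)
    qed simp
    finally show "norm (grad_ham t ?z' (p' t) - grad_ham t ?z (p t))
        \<le> \<bar>\<epsilon>\<bar> * ((C * c3 + C * (1 + P) * (c1 + 1)) * (1 + norm (v t)))" .
  qed
qed

text \<open>One pointwise estimate, \<open>main\<close>, serves twice: its state component drives
  Gronwall for the adjoint remainder, and with the resulting bound it yields the expansion of the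
  full gradient. The weight \<open>k\<close> contains \<open>(norm (v t))\<^sup>2\<close>, so that
  integrability is all that is claimed for it.\<close>

lemma grad_ham_perturbation_taylor:
  obtains k where "integrable (lebesgue_on {0..T}) k" "\<forall>t. k t \<ge> 0"
    "\<forall>\<epsilon> x' p'. state_of (\<lambda>s. u s + \<epsilon> *\<^sub>R v s) x' \<longrightarrow> adjoint_of (\<lambda>s. u s + \<epsilon> *\<^sub>R v s) x' p' \<longrightarrow>
      (\<forall>t\<in>{0..T}. norm (grad_ham t (x' t, u t + \<epsilon> *\<^sub>R v t) (p' t) - grad_ham t (x t, u t) (p t)
        - \<epsilon> *\<^sub>R grad_ham_lin t (x t, u t) (p t) (y t, v t) (\<psi> t)) \<le> \<epsilon>\<^sup>2 * k t)"
proof -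
  obtain c1 where c1: "c1 \<ge> 0"
    "\<forall>\<epsilon> x'. state_of (\<lambda>s. u s + \<epsilon> *\<^sub>R v s) x' \<longrightarrow> (\<forall>t\<in>{0..T}. norm (x' t - x t) \<le> c1 * \<bar>\<epsilon>\<bar>)"
    by (rule state_perturbation_lipschitz)
  obtain c2 where c2: "c2 \<ge> 0"
    "\<forall>\<epsilon> x'. state_of (\<lambda>s. u s + \<epsilon> *\<^sub>R v s) x' \<longrightarrow> (\<forall>t\<in>{0..T}. norm (x' t - x t - \<epsilon> *\<^sub>R y t) \<le> c2 * \<epsilon>\<^sup>2)"
    by (rule state_perturbation_taylor)
  obtain c3 where c3: "c3 \<ge> 0"
    "\<forall>\<epsilon> x' p'. state_of (\<lambda>s. u s + \<epsilon> *\<^sub>R v s) x' \<longrightarrow> adjoint_of (\<lambda>s. u s + \<epsilon> *\<^sub>R v s) x' p' \<longrightarrow>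
      (\<forall>t\<in>{0..T}. norm (p' t - p t) \<le> c3 * \<bar>\<epsilon>\<bar>)"
    by (rule adjoint_perturbation_lipschitz)
  obtain P where P: "P \<ge> 0" "\<forall>t\<in>{0..T}. norm (p t) \<le> P"
    by (rule continuous_on_Icc_bounded[OF adjoint_of_continuous[OF p]])
  \<comment> \<open>The three summands stem from the product of the increments of \<open>z\<close>
    and \<open>p\<close>, the squared increment of \<open>z\<close>, and the remainder of the
    state.\<close>
  define \<rho> where "\<rho> t = C * (c1 + norm (v t)) * c3 + C * (1 + P) * (c1\<^sup>2 + (norm (v t))\<^sup>2) + C * (1 + P) * c2" for t
  have \<rho>: "integrable (lebesgue_on {0..T}) \<rho>" "\<rho> t \<ge> 0" for t
    using integrable_norms C_pos P(1) c1(1) c2(1) c3(1) by (auto simp: \<rho>_def [abs_def])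
  define c4 where "c4 = 2 * exp (2 * C * T) * ((C * c1\<^sup>2 + C * c2) + (LINT t|lebesgue_on {0..T}. \<rho> t))"
  have c4: "c4 \<ge> 0"
    using C_pos c2(1) \<rho>(2) by (simp add: c4_def)
  have main: "norm (grad_ham t (x' t, u t + \<epsilon> *\<^sub>R v t) (p' t) - grad_ham t (x t, u t) (p t)
        - \<epsilon> *\<^sub>R grad_ham_lin t (x t, u t) (p t) (y t, v t) (\<psi> t)) \<le> C * norm (p' t - p t - \<epsilon> *\<^sub>R \<psi> t) + \<epsilon>\<^sup>2 * \<rho> t"
    if x': "state_of (\<lambda>s. u s + \<epsilon> *\<^sub>R v s) x'" and p': "adjoint_of (\<lambda>s. u s + \<epsilon> *\<^sub>R v s) x' p'" and t: "t \<in> {0..T}"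
    for \<epsilon> x' p' t
  proof -
    let ?z = "(x t, u t)" and ?z' = "(x' t, u t + \<epsilon> *\<^sub>R v t)"
    have n: "norm (x' t - x t) \<le> c1 * \<bar>\<epsilon>\<bar>"
      using c1(2) x' t by blast
    have n2: "norm (x' t - x t - \<epsilon> *\<^sub>R y t) \<le> c2 * \<epsilon>\<^sup>2"
      using c2(2) x' t by blast
    have n3: "norm (p' t - p t) \<le> c3 * \<bar>\<epsilon>\<bar>"
      using c3(2) x' p' t by blast
    have Pt: "norm (p t) \<le> P"
      using P(2) t by blast
    have n4: "norm (?z' - ?z - \<epsilon> *\<^sub>R (y t, v t)) \<le> c2 * \<epsilon>\<^sup>2"
      using n2 unfolding pair_perturbation(3)[OF n c1(1)] by simp
    \<comment> \<open>Homogeneity is linearity based at the origin; that the linearization vanishes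
      there follows from its norm bound.\<close>
    have lin: "\<epsilon> *\<^sub>R grad_ham_lin t ?z (p t) (y t, v t) (\<psi> t) = grad_ham_lin t ?z (p t) (\<epsilon> *\<^sub>R (y t, v t)) (\<epsilon> *\<^sub>R \<psi> t)"
      using grad_ham_lin_linear[OF t, of ?z "p t" 0 \<epsilon> "(y t, v t)" 0 "\<psi> t"] grad_ham_lin_bound[OF t, of ?z "p t" 0 0]
      by simp
    have "norm (grad_ham t ?z' (p' t) - grad_ham t ?z (p t) - \<epsilon> *\<^sub>R grad_ham_lin t ?z (p t) (y t, v t) (\<psi> t))
      \<le> C * norm (p' t - p t - \<epsilon> *\<^sub>R \<psi> t) + C * norm (?z' - ?z) * norm (p' t - p t)
      + C * (1 + norm (p t)) * (norm (?z' - ?z))\<^sup>2 + C * (1 + norm (p t)) * norm (?z' - ?z - \<epsilon> *\<^sub>R (y t, v t))"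
      unfolding lin by (rule grad_ham_taylor[OF t])
    also have "\<dots> \<le> C * norm (p' t - p t - \<epsilon> *\<^sub>R \<psi> t) + C * (\<bar>\<epsilon>\<bar> * (c1 + norm (v t))) * (c3 * \<bar>\<epsilon>\<bar>)
      + C * (1 + P) * (\<epsilon>\<^sup>2 * (c1\<^sup>2 + (norm (v t))\<^sup>2)) + C * (1 + P) * (c2 * \<epsilon>\<^sup>2)"
      using C_pos P(1) Pt c1(1)
      by (intro add_mono mult_mono order_refl pair_perturbation(1)[OF n c1(1)] pair_perturbation(2)[OF n c1(1)] n3 n4)
        (auto intro!: mult_nonneg_nonneg add_nonneg_nonneg)
    also have "\<dots> = C * norm (p' t - p t - \<epsilon> *\<^sub>R \<psi> t) + \<epsilon>\<^sup>2 * \<rho> t"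
    proof -
      have "C * (\<bar>\<epsilon>\<bar> * (c1 + norm (v t))) * (c3 * \<bar>\<epsilon>\<bar>) = (\<bar>\<epsilon>\<bar> * \<bar>\<epsilon>\<bar>) * (C * (c1 + norm (v t)) * c3)"
        by (simp only: mult_ac)
      also have "\<bar>\<epsilon>\<bar> * \<bar>\<epsilon>\<bar> = \<epsilon>\<^sup>2"
        by (simp add: power2_eq_square)
      finally show ?thesis
        by (simp add: \<rho>_def algebra_simps)
    qed
    finally show ?thesis .
  qed
  have n5: "norm (p' t - p t - \<epsilon> *\<^sub>R \<psi> t) \<le> c4 * \<epsilon>\<^sup>2"
    if x': "state_of (\<lambda>s. u s + \<epsilon> *\<^sub>R v s) x'" and p': "adjoint_of (\<lambda>s. u s + \<epsilon> *\<^sub>R v s) x' p'" and t: "t \<in> {0..T}"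
    for \<epsilon> x' p' t
  proof -
    have "solves_ode_ae T (\<lambda>t _. - fst (grad_ham t (x' t, u t + \<epsilon> *\<^sub>R v t) (p' t)) - - fst (grad_ham t (x t, u t) (p t)))
        (\<lambda>t. p' t - p t)"
      by (rule solves_ode_ae_diff[OF p'[unfolded adjoint_of_def, THEN conjunct1] p[unfolded adjoint_of_def, THEN conjunct1]])
    from solves_ode_ae_linear_combination[OF this \<psi>[unfolded adjoint_var_of_def, THEN conjunct1], of "-\<epsilon>"]
    have sol: "solves_ode_ae T (\<lambda>t _. - fst (grad_ham t (x' t, u t + \<epsilon> *\<^sub>R v t) (p' t) - grad_ham t (x t, u t) (p t)
        - \<epsilon> *\<^sub>R grad_ham_lin t (x t, u t) (p t) (y t, v t) (\<psi> t))) (\<lambda>t. p' t - p t - \<epsilon> *\<^sub>R \<psi> t)"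
      by (simp add: algebra_simps)
    have "norm (p' t - p t - \<epsilon> *\<^sub>R \<psi> t) \<le> 2 * exp (2 * C * T) *
        (norm (p' (if False then 0 else T) - p (if False then 0 else T) - \<epsilon> *\<^sub>R \<psi> (if False then 0 else T))
        + (LINT t|lebesgue_on {0..T}. \<epsilon>\<^sup>2 * \<rho> t))"
    proof (rule solves_ode_ae_bound[OF sol C_pos _ _ _ t])
      show "integrable (lebesgue_on {0..T}) (\<lambda>t. \<epsilon>\<^sup>2 * \<rho> t)" "0 \<le> \<epsilon>\<^sup>2 * \<rho> t" for t
        using \<rho> by auto
      show "AE t in lebesgue_on {0..T}. norm (- fst (grad_ham t (x' t, u t + \<epsilon> *\<^sub>R v t) (p' t) - grad_ham t (x t, u t) (p t)
          - \<epsilon> *\<^sub>R grad_ham_lin t (x t, u t) (p t) (y t, v t) (\<psi> t))) \<le> C * norm (p' t - p t - \<epsilon> *\<^sub>R \<psi> t) + \<epsilon>\<^sup>2 * \<rho> t"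
        unfolding norm_minus_cancel
        by (rule AE_lebesgue_onI, rule order_trans[OF norm_fst_le_norm main[OF x' p']])
    qed
    \<comment> \<open>Terminal values: the Taylor estimate for the gradient of \<open>g\<close>,
      with \<open>\<epsilon> *\<^sub>R y T\<close> as approximate increment of the state.\<close>
    also have "norm (p' (if False then 0 else T) - p (if False then 0 else T) - \<epsilon> *\<^sub>R \<psi> (if False then 0 else T))
        \<le> C * (c1\<^sup>2 * \<epsilon>\<^sup>2) + C * (c2 * \<epsilon>\<^sup>2)"
    proof -
      have T: "T \<in> {0..T}" using T_pos by simp
      have 1: "(norm (x' T - x T))\<^sup>2 \<le> c1\<^sup>2 * \<epsilon>\<^sup>2"
      proof -
        have "norm (x' T - x T) \<le> c1 * \<bar>\<epsilon>\<bar>"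
          using c1(2) x' T by blast
        then have "(norm (x' T - x T))\<^sup>2 \<le> (c1 * \<bar>\<epsilon>\<bar>)\<^sup>2"
          by (intro power_mono) auto
        then show ?thesis by (simp add: power_mult_distrib)
      qed
      have 2: "norm (x' T - x T - \<epsilon> *\<^sub>R y T) \<le> c2 * \<epsilon>\<^sup>2"
        using c2(2) x' T by blast
      have "\<epsilon> *\<^sub>R hess_g (x T) (y T) = hess_g (x T) (\<epsilon> *\<^sub>R y T)"
        using hess_g_linear[of "x T" 0 \<epsilon> "y T"] hess_g_bound[of "x T" 0] by simp
      then have "norm (p' T - p T - \<epsilon> *\<^sub>R \<psi> T) \<le> C * (norm (x' T - x T))\<^sup>2 + C * norm (x' T - x T - \<epsilon> *\<^sub>R y T)"
        using p p' \<psi> grad_g_taylor[of "x' T" "x T" "\<epsilon> *\<^sub>R y T"] by (simp add: adjoint_of_def adjoint_var_of_def)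
      also have "\<dots> \<le> C * (c1\<^sup>2 * \<epsilon>\<^sup>2) + C * (c2 * \<epsilon>\<^sup>2)"
        using 1 2 C_pos by (intro add_mono mult_left_mono) auto
      finally show ?thesis by simp
    qed
    finally show ?thesis
      by (simp add: c4_def algebra_simps)
  qed
  show ?thesis
  proof (rule that[of "\<lambda>t. C * c4 + \<rho> t"]; (intro allI impI ballI)?)
    show "integrable (lebesgue_on {0..T}) (\<lambda>t. C * c4 + \<rho> t)" "0 \<le> C * c4 + \<rho> t" for t
      using \<rho> C_pos c4 by auto
    fix \<epsilon> x' p' t assume *: "state_of (\<lambda>s. u s + \<epsilon> *\<^sub>R v s) x'" "adjoint_of (\<lambda>s. u s + \<epsilon> *\<^sub>R v s) x' p'" "t \<in> {0..T}"
    have "C * norm (p' t - p t - \<epsilon> *\<^sub>R \<psi> t) \<le> C * (c4 * \<epsilon>\<^sup>2)"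
      using n5[OF *] C_pos by (intro mult_left_mono) auto
    then show "norm (grad_ham t (x' t, u t + \<epsilon> *\<^sub>R v t) (p' t) - grad_ham t (x t, u t) (p t)
        - \<epsilon> *\<^sub>R grad_ham_lin t (x t, u t) (p t) (y t, v t) (\<psi> t)) \<le> \<epsilon>\<^sup>2 * (C * c4 + \<rho> t)"
      using main[OF *] by (simp add: algebra_simps)
  qed
qed

end

section \<open>Derivatives of the cost\<close>

lemma state_var_cong:
  assumes "state_var_of u x v y" "\<And>t. t \<in> {0..T} \<Longrightarrow> x t = x' t"
  shows "state_var_of u x' v y"
  unfolding state_var_of_def
proof
  show "solves_ode_ae T (\<lambda>t \<eta>. Db t (x' t, u t) (\<eta>, v t)) y"
    using assms(2) by (intro solves_ode_ae_cong[OF assms(1)[unfolded state_var_of_def, THEN conjunct1]]) simp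
  show "y 0 = 0"
    using assms by (simp add: state_var_of_def)
qed

lemma adjoint_var_cong:
  assumes "adjoint_var_of u x p v y \<psi>" "\<And>t. t \<in> {0..T} \<Longrightarrow> x t = x' t" "\<And>t. t \<in> {0..T} \<Longrightarrow> p t = p' t"
    "\<And>t. t \<in> {0..T} \<Longrightarrow> y t = y' t"
  shows "adjoint_var_of u x' p' v y' \<psi>"
  unfolding adjoint_var_of_def
proof
  show "solves_ode_ae T (\<lambda>t \<eta>. - fst (grad_ham_lin t (x' t, u t) (p' t) (y' t, v t) \<eta>)) \<psi>"
    using assms(2-4) by (intro solves_ode_ae_cong[OF assms(1)[unfolded adjoint_var_of_def, THEN conjunct1]]) simp
  show "\<psi> T = hess_g (x' T) (y' T)"
    using assms T_pos by (simp add: adjoint_var_of_def)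
qed

section \<open>Selected solutions and the candidates for the derivatives\<close>

definition the_state where "the_state u = (SOME x. state_of u x)"
definition the_adjoint where "the_adjoint u = (SOME p. adjoint_of u (the_state u) p)"
definition the_state_var where "the_state_var u v = (SOME y. state_var_of u (the_state u) v y)"
definition the_adjoint_var where
  "the_adjoint_var u v = (SOME \<psi>. adjoint_var_of u (the_state u) (the_adjoint u) v (the_state_var u v) \<psi>)"

definition cost_of where
  "cost_of u = (LINT t|lebesgue_on {0..T}. f t (the_state u t, u t)) + g (the_state u T)"
definition gradient_of where
  "gradient_of u t = snd (grad_ham t (the_state u t, u t) (the_adjoint u t))"
definition hessian_of where
  "hessian_of u v t =
    snd (grad_ham_lin t (the_state u t, u t) (the_adjoint u t) (the_state_var u v t, v t) (the_adjoint_var u v t))"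

lemma the_state: "u \<in> Lspace T 2 \<Longrightarrow> state_of u (the_state u)"
  unfolding the_state_def by (rule someI_ex[OF state_exists])

lemma the_adjoint: "u \<in> Lspace T 2 \<Longrightarrow> adjoint_of u (the_state u) (the_adjoint u)"
  unfolding the_adjoint_def by (rule someI_ex[OF adjoint_exists[OF _ the_state]])

lemma the_state_var: "u \<in> Lspace T 2 \<Longrightarrow> v \<in> Lspace T 2 \<Longrightarrow> state_var_of u (the_state u) v (the_state_var u v)"
  unfolding the_state_var_def by (rule someI_ex[OF state_var_exists[OF _ state_of_continuous[OF the_state]]])

lemma the_adjoint_var:
  "u \<in> Lspace T 2 \<Longrightarrow> v \<in> Lspace T 2 \<Longrightarrow>
    adjoint_var_of u (the_state u) (the_adjoint u) v (the_state_var u v) (the_adjoint_var u v)"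
  unfolding the_adjoint_var_def
  by (rule someI_ex[OF adjoint_var_exists[OF _ state_of_continuous[OF the_state] adjoint_of_continuous[OF the_adjoint]
          _ state_var_of_continuous[OF the_state_var]]])

lemmas the_continuous = state_of_continuous[OF the_state] adjoint_of_continuous[OF the_adjoint]
  state_var_of_continuous[OF the_state_var] adjoint_var_of_continuous[OF the_adjoint_var]

text \<open>All four functions are unique on [0,T], so the value does not depend on the selected
  solutions and can be computed along any given state, adjoint and variations.\<close>

lemma hessian_of_eq:
  assumes u: "u \<in> Lspace T 2" and v: "v \<in> Lspace T 2"
    and x: "state_of u x" and p: "adjoint_of u x p"
    and y: "state_var_of u x v y" and \<psi>: "adjoint_var_of u x p v y \<psi>" and t: "t \<in> {0..T}"
  shows "hessian_of u v t = snd (grad_ham_lin t (x t, u t) (p t) (y t, v t) (\<psi> t))"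
proof -
  have 1: "x t = the_state u t" if "t \<in> {0..T}" for t
    by (rule state_unique[OF x the_state[OF u] that])
  have 2: "p t = the_adjoint u t" if "t \<in> {0..T}" for t
    by (rule adjoint_unique[OF p the_adjoint[OF u] 1 that])
  have 3: "y t = the_state_var u v t" if "t \<in> {0..T}" for t
    by (rule state_var_unique[OF state_var_cong[OF y 1] the_state_var[OF u v] that])
  have 4: "\<psi> t = the_adjoint_var u v t"
    by (rule adjoint_var_unique[OF adjoint_var_cong[OF \<psi> 1 2 3] the_adjoint_var[OF u v] refl t])
  show ?thesis
    using 1[OF t] 2[OF t] 3[OF t] 4 by (simp add: hessian_of_def)
qed

lemma gradient_of_Lspace:
  assumes u: "u \<in> Lspace T 2"
  shows "gradient_of u \<in> Lspace T 2"
proof -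
  note xc = the_continuous(1)[OF u] and pc = the_continuous(2)[OF u]
  obtain A where A: "A \<ge> 0" "\<forall>t\<in>{0..T}. norm (the_state u t) \<le> A"
    by (rule continuous_on_Icc_bounded[OF xc])
  obtain P where P: "P \<ge> 0" "\<forall>t\<in>{0..T}. norm (the_adjoint u t) \<le> P"
    by (rule continuous_on_Icc_bounded[OF pc])
  show ?thesis
  proof (rule Lspace_2_dominated)
    have "(\<lambda>t. grad_ham t (the_state u t, u t) (the_adjoint u t)) \<in> borel_measurable (lebesgue_on {0..T})"
      by (rule grad_ham_measurable[OF Pair_measurable[OF xc u] continuous_on_imp_measurable_lebesgue_on[OF pc]])
    then show "gradient_of u \<in> borel_measurable (lebesgue_on {0..T})"
      unfolding gradient_of_def [abs_def] by (rule fst_snd_measurable)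
    show "integrable (lebesgue_on {0..T}) (\<lambda>t. ((C * P + C * (1 + A)) + C * norm (u t))\<^sup>2)"
      using Lspace_2_affine_norm[OF u, of "C * P + C * (1 + A)" C] by (simp add: Lspace_2_iff)
    show "AE t in lebesgue_on {0..T}. norm (gradient_of u t) \<le> 1 * \<bar>(C * P + C * (1 + A)) + C * norm (u t)\<bar>"
    proof (rule AE_lebesgue_onI)
      fix t assume t: "t \<in> {0..T}"
      have "norm (gradient_of u t) \<le> C * norm (the_adjoint u t) + C * (1 + norm (the_state u t, u t))"
        unfolding gradient_of_def by (rule order_trans[OF norm_snd_le_norm grad_ham_bound[OF t]])
      also have "\<dots> \<le> C * P + C * (1 + (A + norm (u t)))"
      proof (intro add_mono mult_left_mono order_refl)
        show "norm (the_state u t, u t) \<le> A + norm (u t)"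
          by (rule order_trans[OF norm_Pair_le add_right_mono]) (use A t in blast)
      qed (use P t C_pos in auto)
      also have "\<dots> = (C * P + C * (1 + A)) + C * norm (u t)"
        by (simp add: algebra_simps)
      also have "\<dots> \<le> 1 * \<bar>(C * P + C * (1 + A)) + C * norm (u t)\<bar>"
        by simp
      finally show "norm (gradient_of u t) \<le> 1 * \<bar>(C * P + C * (1 + A)) + C * norm (u t)\<bar>" .
    qed
  qed
qed

lemma pair_Lspace_2:
  fixes y :: "real \<Rightarrow> 'x" and v :: "real \<Rightarrow> 'u"
  assumes yc: "continuous_on {0..T} y" and v: "v \<in> Lspace T 2"
  shows "(\<lambda>t. (y t, v t)) \<in> Lspace T 2"
proof -
  obtain A where A: "A \<ge> 0" "\<forall>t\<in>{0..T}. norm (y t) \<le> A"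
    by (rule continuous_on_Icc_bounded[OF yc])
  show ?thesis
  proof (rule Lspace_2_dominated[OF Pair_measurable[OF yc v]])
    show "integrable (lebesgue_on {0..T}) (\<lambda>t. (A + 1 * norm (v t))\<^sup>2)"
      using Lspace_2_affine_norm[OF v, of A 1] by (simp add: Lspace_2_iff)
    show "AE t in lebesgue_on {0..T}. norm (y t, v t) \<le> 1 * \<bar>A + 1 * norm (v t)\<bar>"
    proof (rule AE_lebesgue_onI)
      fix t assume "t \<in> {0..T}"
      then have "norm (y t, v t) \<le> A + norm (v t)"
        using A by (intro order_trans[OF norm_Pair_le add_right_mono]) blast
      then show "norm (y t, v t) \<le> 1 * \<bar>A + 1 * norm (v t)\<bar>"
        by simp
    qed
  qed
qed

text \<open>Integrate \<open>(p \<bullet> y)'\<close> over \<open>[0,T]\<close>.\<close>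

lemma gradient_duality:
  assumes u: "u \<in> Lspace T 2" and v: "v \<in> Lspace T 2"
    and x: "state_of u x" and p: "adjoint_of u x p" and y: "state_var_of u x v y"
  shows "integrable (lebesgue_on {0..T}) (\<lambda>t. Df t (x t, u t) (y t, v t))"
    and "integrable (lebesgue_on {0..T}) (\<lambda>t. snd (grad_ham t (x t, u t) (p t)) \<bullet> v t)"
    and "(LINT t|lebesgue_on {0..T}. snd (grad_ham t (x t, u t) (p t)) \<bullet> v t)
      = (LINT t|lebesgue_on {0..T}. Df t (x t, u t) (y t, v t)) + Dg (x T) (y T)"
proof -
  note xc = state_of_continuous[OF x] and pc = adjoint_of_continuous[OF p] and yc = state_var_of_continuous[OF y]
  note z2 = pair_Lspace_2[OF xc u] and k2 = pair_Lspace_2[OF yc v]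
  show Df: "integrable (lebesgue_on {0..T}) (\<lambda>t. Df t (x t, u t) (y t, v t))"
  proof (rule integrable_lebesgue_on_bound)
    show "(\<lambda>t. Df t (x t, u t) (y t, v t)) \<in> borel_measurable (lebesgue_on {0..T})"
      by (rule Df_measurable[OF Pair_measurable[OF xc u] Pair_measurable[OF yc v]])
    have "integrable (lebesgue_on {0..T}) (\<lambda>t. norm (1 + 1 * norm (x t, u t)) * norm (y t, v t))"
      by (rule Lspace_2_integrable_mult[OF Lspace_2_affine_norm[OF z2] k2])
    then show "integrable (lebesgue_on {0..T}) (\<lambda>t. C * (norm (1 + 1 * norm (x t, u t)) * norm (y t, v t)))"
      by simp
    fix t assume t: "t \<in> {0..T}"
    have "norm (Df t (x t, u t) (y t, v t)) \<le> C * (1 + norm (x t, u t)) * norm (y t, v t)"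
      using Df_bound[OF t] by simp
    then show "norm (Df t (x t, u t) (y t, v t)) \<le> C * (norm (1 + 1 * norm (x t, u t)) * norm (y t, v t))"
      by (simp add: mult.assoc abs_of_nonneg add_nonneg_nonneg)
  qed
  have xeq: "x t = the_state u t" if "t \<in> {0..T}" for t
    by (rule state_unique[OF x the_state[OF u] that])
  have peq: "p t = the_adjoint u t" if "t \<in> {0..T}" for t
    by (rule adjoint_unique[OF p the_adjoint[OF u] xeq that])
  have "integrable (lebesgue_on {0..T}) (\<lambda>t. gradient_of u t \<bullet> v t)"
    by (rule Lspace_2_integrable_inner[OF gradient_of_Lspace[OF u] v])
  moreover have "gradient_of u t \<bullet> v t = snd (grad_ham t (x t, u t) (p t)) \<bullet> v t" if "t \<in> {0..T}" for t
    using xeq[OF that] peq[OF that] by (simp add: gradient_of_def)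
  ultimately show G: "integrable (lebesgue_on {0..T}) (\<lambda>t. snd (grad_ham t (x t, u t) (p t)) \<bullet> v t)"
    by (subst (asm) Bochner_Integration.integrable_cong) auto
  have sol: "solves_ode_ae T (\<lambda>t _. p t \<bullet> Db t (x t, u t) (y t, v t) + - fst (grad_ham t (x t, u t) (p t)) \<bullet> y t) (\<lambda>t. p t \<bullet> y t)"
    by (rule solves_ode_ae_inner[OF p[unfolded adjoint_of_def, THEN conjunct1] y[unfolded state_var_of_def, THEN conjunct1]])
  have "((\<lambda>t. p t \<bullet> Db t (x t, u t) (y t, v t) + - fst (grad_ham t (x t, u t) (p t)) \<bullet> y t)
      has_integral p T \<bullet> y T - p 0 \<bullet> y 0) {0..T}"
    using solves_ode_ae_imp_has_integral[OF sol, of 0 T] T_pos by simp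
  \<comment> \<open>Testing the gradient with \<open>(y t, v t)\<close> splits it into state and
    control components; the state component cancels against the adjoint equation.\<close>
  moreover have "p t \<bullet> Db t (x t, u t) (y t, v t) + - fst (grad_ham t (x t, u t) (p t)) \<bullet> y t
      = snd (grad_ham t (x t, u t) (p t)) \<bullet> v t - Df t (x t, u t) (y t, v t)" if t: "t \<in> {0..T}" for t
    using inner_grad_ham[OF t, of "(x t, u t)" "p t" "(y t, v t)"] by (simp add: inner_prod_def)
  ultimately have "((\<lambda>t. snd (grad_ham t (x t, u t) (p t)) \<bullet> v t - Df t (x t, u t) (y t, v t))
      has_integral p T \<bullet> y T - p 0 \<bullet> y 0) {0..T}"
    by (rule has_integral_eq[rotated])
  moreover have "p T \<bullet> y T - p 0 \<bullet> y 0 = Dg (x T) (y T)"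
    using p y by (simp add: adjoint_of_def state_var_of_def inner_grad_g)
  ultimately have "(LINT t|lebesgue_on {0..T}. snd (grad_ham t (x t, u t) (p t)) \<bullet> v t - Df t (x t, u t) (y t, v t)) = Dg (x T) (y T)"
    using G Df by (intro LINT_eq_has_integral) auto
  then show "(LINT t|lebesgue_on {0..T}. snd (grad_ham t (x t, u t) (p t)) \<bullet> v t)
      = (LINT t|lebesgue_on {0..T}. Df t (x t, u t) (y t, v t)) + Dg (x T) (y T)"
    using G Df by simp
qed

text \<open>Integrate \<open>(\<psi> \<bullet> y')'\<close> over \<open>[0,T]\<close>, where \<open>y'\<close> is the state variation in direction \<open>w\<close>.\<close>

lemma hessian_duality:
  assumes u: "u \<in> Lspace T 2" and v: "v \<in> Lspace T 2" and w: "w \<in> Lspace T 2"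
    and x: "state_of u x" and p: "adjoint_of u x p" and y: "state_var_of u x v y"
    and \<psi>: "adjoint_var_of u x p v y \<psi>" and yw: "state_var_of u x w y'"
    and hw: "integrable (lebesgue_on {0..T}) (\<lambda>t. snd (grad_ham_lin t (x t, u t) (p t) (y t, v t) (\<psi> t)) \<bullet> w t)"
  shows "(LINT t|lebesgue_on {0..T}. snd (grad_ham_lin t (x t, u t) (p t) (y t, v t) (\<psi> t)) \<bullet> w t)
      = (LINT t|lebesgue_on {0..T}. grad_ham_lin t (x t, u t) (p t) (y t, v t) 0 \<bullet> (y' t, w t)) + hess_g (x T) (y T) \<bullet> y' T"
proof -
  note xc = state_of_continuous[OF x] and pc = adjoint_of_continuous[OF p] and yc = state_var_of_continuous[OF y]
    and ywc = state_var_of_continuous[OF yw]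
  let ?Q = "\<lambda>t. grad_ham_lin t (x t, u t) (p t) (y t, v t)"
  note k2 = pair_Lspace_2[OF yc v] and k2' = pair_Lspace_2[OF ywc w]
  obtain P where P: "P \<ge> 0" "\<forall>t\<in>{0..T}. norm (p t) \<le> P"
    by (rule continuous_on_Icc_bounded[OF pc])
  have S: "integrable (lebesgue_on {0..T}) (\<lambda>t. ?Q t 0 \<bullet> (y' t, w t))"
  proof (rule integrable_lebesgue_on_bound)
    show "(\<lambda>t. ?Q t 0 \<bullet> (y' t, w t)) \<in> borel_measurable (lebesgue_on {0..T})"
      by (intro borel_measurable_inner grad_ham_lin_measurable borel_measurable_const
          Pair_measurable[OF xc u] Pair_measurable[OF yc v] Pair_measurable[OF ywc w]
          continuous_on_imp_measurable_lebesgue_on[OF pc])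
    show "integrable (lebesgue_on {0..T}) (\<lambda>t. C * (1 + P) * (norm (y t, v t) * norm (y' t, w t)))"
      using Lspace_2_integrable_mult[OF k2 k2'] by simp
    fix t assume t: "t \<in> {0..T}"
    have "norm (?Q t 0 \<bullet> (y' t, w t)) \<le> norm (?Q t 0) * norm (y' t, w t)"
      by (simp add: Cauchy_Schwarz_ineq2)
    also have "\<dots> \<le> (C * (1 + P) * norm (y t, v t)) * norm (y' t, w t)"
    proof (rule mult_right_mono)
      have "norm (?Q t 0) \<le> C * (1 + norm (p t)) * norm (y t, v t)"
        using grad_ham_lin_bound[OF t, of "(x t, u t)" "p t" "(y t, v t)" 0] by simp
      also have "\<dots> \<le> C * (1 + P) * norm (y t, v t)"
        using P t C_pos by (intro mult_right_mono mult_left_mono) auto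
      finally show "norm (?Q t 0) \<le> C * (1 + P) * norm (y t, v t)" .
    qed simp
    finally show "norm (?Q t 0 \<bullet> (y' t, w t)) \<le> C * (1 + P) * (norm (y t, v t) * norm (y' t, w t))"
      by (simp add: mult_ac)
  qed
  have sol: "solves_ode_ae T (\<lambda>t _. \<psi> t \<bullet> Db t (x t, u t) (y' t, w t) + - fst (?Q t (\<psi> t)) \<bullet> y' t) (\<lambda>t. \<psi> t \<bullet> y' t)"
    by (rule solves_ode_ae_inner[OF \<psi>[unfolded adjoint_var_of_def, THEN conjunct1] yw[unfolded state_var_of_def, THEN conjunct1]])
  have "((\<lambda>t. \<psi> t \<bullet> Db t (x t, u t) (y' t, w t) + - fst (?Q t (\<psi> t)) \<bullet> y' t)
      has_integral \<psi> T \<bullet> y' T - \<psi> 0 \<bullet> y' 0) {0..T}"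
    using solves_ode_ae_imp_has_integral[OF sol, of 0 T] T_pos by simp
  \<comment> \<open>The linearization tested with \<open>(y' t, w t)\<close> is its second-order
    part, obtained at \<psi> = 0, plus the term in \<open>\<psi> t\<close>; the state component
    cancels against the adjoint variation equation.\<close>
  moreover have "\<psi> t \<bullet> Db t (x t, u t) (y' t, w t) + - fst (?Q t (\<psi> t)) \<bullet> y' t
      = snd (?Q t (\<psi> t)) \<bullet> w t - ?Q t 0 \<bullet> (y' t, w t)" if t: "t \<in> {0..T}" for t
  proof -
    have "?Q t (\<psi> t) \<bullet> (y' t, w t) = \<psi> t \<bullet> Db t (x t, u t) (y' t, w t) + ?Q t 0 \<bullet> (y' t, w t)"
      by (simp only: inner_grad_ham_lin[OF t] inner_zero_left)
    moreover have "?Q t (\<psi> t) \<bullet> (y' t, w t) = fst (?Q t (\<psi> t)) \<bullet> y' t + snd (?Q t (\<psi> t)) \<bullet> w t"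
      by (simp add: inner_prod_def)
    ultimately show ?thesis by simp
  qed
  ultimately have "((\<lambda>t. snd (?Q t (\<psi> t)) \<bullet> w t - ?Q t 0 \<bullet> (y' t, w t)) has_integral \<psi> T \<bullet> y' T - \<psi> 0 \<bullet> y' 0) {0..T}"
    by (rule has_integral_eq[rotated])
  moreover have "\<psi> T \<bullet> y' T - \<psi> 0 \<bullet> y' 0 = hess_g (x T) (y T) \<bullet> y' T"
    using \<psi> yw by (simp add: adjoint_var_of_def state_var_of_def)
  ultimately have "(LINT t|lebesgue_on {0..T}. snd (?Q t (\<psi> t)) \<bullet> w t - ?Q t 0 \<bullet> (y' t, w t)) = hess_g (x T) (y T) \<bullet> y' T"
    using hw S by (intro LINT_eq_has_integral) auto
  then show ?thesis
    using hw S by simp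
qed

text \<open>Both \<open>f\<close> and \<open>g\<close> are expanded to first order along the state
  variation; \<open>gradient_duality\<close> then replaces the sum of their linear terms by the
  pairing of v with the control component of the Hamiltonian's gradient.\<close>

lemma cost_expansion:
  assumes u: "u \<in> Lspace T 2" and v: "v \<in> Lspace T 2"
    and x: "state_of u x" and p: "adjoint_of u x p"
  obtains c where "\<forall>\<epsilon> x'. state_of (\<lambda>s. u s + \<epsilon> *\<^sub>R v s) x' \<longrightarrow>
    \<bar>((LINT t|lebesgue_on {0..T}. f t (x' t, u t + \<epsilon> *\<^sub>R v t)) + g (x' T))
      - ((LINT t|lebesgue_on {0..T}. f t (x t, u t)) + g (x T))
      - \<epsilon> * (LINT t|lebesgue_on {0..T}. snd (grad_ham t (x t, u t) (p t)) \<bullet> v t)\<bar> \<le> c * \<epsilon>\<^sup>2"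
proof -
  note xc = state_of_continuous[OF x] and pc = adjoint_of_continuous[OF p]
  obtain y where y: "state_var_of u x v y"
    using state_var_exists[OF u xc v] by blast
  obtain \<psi> where \<psi>: "adjoint_var_of u x p v y \<psi>"
    using adjoint_var_exists[OF u xc pc v state_var_of_continuous[OF y]] by blast
  obtain c1 where c1: "c1 \<ge> 0"
    "\<forall>\<epsilon> x'. state_of (\<lambda>s. u s + \<epsilon> *\<^sub>R v s) x' \<longrightarrow> (\<forall>t\<in>{0..T}. norm (x' t - x t) \<le> c1 * \<bar>\<epsilon>\<bar>)"
    by (rule state_perturbation_lipschitz[OF u v x p y \<psi>])
  obtain c2 where c2: "c2 \<ge> 0"
    "\<forall>\<epsilon> x'. state_of (\<lambda>s. u s + \<epsilon> *\<^sub>R v s) x' \<longrightarrow> (\<forall>t\<in>{0..T}. norm (x' t - x t - \<epsilon> *\<^sub>R y t) \<le> c2 * \<epsilon>\<^sup>2)"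
    by (rule state_perturbation_taylor[OF u v x p y \<psi>])
  obtain A where A: "A \<ge> 0" "\<forall>t\<in>{0..T}. norm (x t) \<le> A"
    by (rule continuous_on_Icc_bounded[OF xc])
  \<comment> \<open>The first summand is the Taylor remainder of \<open>f\<close>. In the second,
    the derivative of \<open>f\<close> acts on the state remainder, and its linear growth produces
    the factor \<open>1 + (A + norm (u t))\<close>.\<close>
  define k where "k t = C * (c1\<^sup>2 + (norm (v t))\<^sup>2) + C * (1 + (A + norm (u t))) * c2" for t
  have k: "integrable (lebesgue_on {0..T}) k"
    unfolding k_def using v Lspace_2_integrable[OF u] by (auto simp: Lspace_2_iff)
  define c where "c = (LINT t|lebesgue_on {0..T}. k t) + (C * c1\<^sup>2 + norm (grad_g (x T)) * c2)"
  show ?thesis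
  proof (rule that[of c]; intro allI impI)
    fix \<epsilon> x' assume x': "state_of (\<lambda>s. u s + \<epsilon> *\<^sub>R v s) x'"
    note x'c = state_of_continuous[OF x']
    have n: "norm (x' t - x t) \<le> c1 * \<bar>\<epsilon>\<bar>" if "t \<in> {0..T}" for t
      using c1(2) x' that by blast
    have n2: "norm (x' t - x t - \<epsilon> *\<^sub>R y t) \<le> c2 * \<epsilon>\<^sup>2" if "t \<in> {0..T}" for t
      using c2(2) x' that by blast
    let ?z = "\<lambda>t. (x t, u t)" and ?z' = "\<lambda>t. (x' t, u t + \<epsilon> *\<^sub>R v t)"
    have pw: "norm (f t (?z' t) - f t (?z t) - \<epsilon> * Df t (?z t) (y t, v t)) \<le> \<epsilon>\<^sup>2 * k t" if t: "t \<in> {0..T}" for t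
    proof -
      let ?\<Delta> = "?z' t - ?z t"
      have lin: "Df t (?z t) ?\<Delta> - \<epsilon> * Df t (?z t) (y t, v t) = Df t (?z t) (x' t - x t - \<epsilon> *\<^sub>R y t, 0)"
      proof -
        have "Df t (?z t) ?\<Delta> - \<epsilon> *\<^sub>R Df t (?z t) (y t, v t) = Df t (?z t) (?\<Delta> - \<epsilon> *\<^sub>R (y t, v t))"
          unfolding linear_scale[OF linear_Df[OF t], symmetric] linear_diff[OF linear_Df[OF t], symmetric] ..
        then show ?thesis
          unfolding pair_perturbation(3)[OF n[OF t] c1(1)] by simp
      qed
      have "norm (f t (?z' t) - f t (?z t) - \<epsilon> * Df t (?z t) (y t, v t))
          \<le> \<bar>f t (?z' t) - f t (?z t) - Df t (?z t) ?\<Delta>\<bar> + \<bar>Df t (?z t) ?\<Delta> - \<epsilon> * Df t (?z t) (y t, v t)\<bar>"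
        unfolding real_norm_def by linarith
      also have "\<dots> \<le> C * (\<epsilon>\<^sup>2 * (c1\<^sup>2 + (norm (v t))\<^sup>2)) + C * (1 + (A + norm (u t))) * (c2 * \<epsilon>\<^sup>2)"
      proof (rule add_mono)
        show "\<bar>f t (?z' t) - f t (?z t) - Df t (?z t) ?\<Delta>\<bar> \<le> C * (\<epsilon>\<^sup>2 * (c1\<^sup>2 + (norm (v t))\<^sup>2))"
          using C_pos by (intro order_trans[OF f_taylor[OF t] mult_left_mono] pair_perturbation(2)[OF n[OF t] c1(1)]) auto
        have "\<bar>Df t (?z t) (x' t - x t - \<epsilon> *\<^sub>R y t, 0)\<bar> \<le> C * (1 + norm (?z t)) * norm (x' t - x t - \<epsilon> *\<^sub>R y t, 0::'u)"
          by (rule Df_bound[OF t])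
        also have "\<dots> \<le> C * (1 + (A + norm (u t))) * (c2 * \<epsilon>\<^sup>2)"
        proof (intro mult_mono)
          show "1 + norm (?z t) \<le> 1 + (A + norm (u t))"
            using A t by (intro add_left_mono order_trans[OF norm_Pair_le add_right_mono]) blast
          show "norm (x' t - x t - \<epsilon> *\<^sub>R y t, 0::'u) \<le> c2 * \<epsilon>\<^sup>2"
            using n2[OF t] by simp
        qed (use C_pos A(1) in auto)
        finally show "\<bar>Df t (?z t) ?\<Delta> - \<epsilon> * Df t (?z t) (y t, v t)\<bar> \<le> C * (1 + (A + norm (u t))) * (c2 * \<epsilon>\<^sup>2)"
          unfolding lin .
      qed
      finally show ?thesis
        by (simp add: k_def algebra_simps)
    qed
    have u': "(\<lambda>s. u s + \<epsilon> *\<^sub>R v s) \<in> Lspace T 2"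
      by (intro Lspace_2_add Lspace_2_scaleR u v)
    note int = cost_integrable[OF u' x'c] cost_integrable[OF u xc] gradient_duality(1)[OF u v x p y]
    have "norm (LINT t|lebesgue_on {0..T}. f t (?z' t) - f t (?z t) - \<epsilon> * Df t (?z t) (y t, v t))
        \<le> (LINT t|lebesgue_on {0..T}. \<epsilon>\<^sup>2 * k t)"
      using int k pw by (intro Bochner_Integration.integral_norm_bound_integral) auto
    then have F: "\<bar>(LINT t|lebesgue_on {0..T}. f t (?z' t)) - (LINT t|lebesgue_on {0..T}. f t (?z t))
        - \<epsilon> * (LINT t|lebesgue_on {0..T}. Df t (?z t) (y t, v t))\<bar> \<le> \<epsilon>\<^sup>2 * (LINT t|lebesgue_on {0..T}. k t)"
      using int by simp
    have T: "T \<in> {0..T}" using T_pos by simp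
    have "(norm (x' T - x T))\<^sup>2 \<le> (c1 * \<bar>\<epsilon>\<bar>)\<^sup>2"
      using n[OF T] by (intro power_mono) auto
    then have "C * (norm (x' T - x T))\<^sup>2 \<le> C * (c1\<^sup>2 * \<epsilon>\<^sup>2)"
      using C_pos by (intro mult_left_mono) (auto simp: power_mult_distrib)
    then have G1: "\<bar>g (x' T) - g (x T) - Dg (x T) (x' T - x T)\<bar> \<le> C * (c1\<^sup>2 * \<epsilon>\<^sup>2)"
      by (rule order_trans[OF g_taylor])
    have "Dg (x T) (x' T - x T) - \<epsilon> * Dg (x T) (y T) = grad_g (x T) \<bullet> (x' T - x T - \<epsilon> *\<^sub>R y T)"
      by (simp add: inner_grad_g [symmetric] inner_diff_right)
    then have "\<bar>Dg (x T) (x' T - x T) - \<epsilon> * Dg (x T) (y T)\<bar> \<le> norm (grad_g (x T)) * norm (x' T - x T - \<epsilon> *\<^sub>R y T)"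
      by (simp add: Cauchy_Schwarz_ineq2)
    also have "\<dots> \<le> norm (grad_g (x T)) * (c2 * \<epsilon>\<^sup>2)"
      using n2[OF T] by (intro mult_left_mono) auto
    finally have G2: "\<bar>Dg (x T) (x' T - x T) - \<epsilon> * Dg (x T) (y T)\<bar> \<le> norm (grad_g (x T)) * (c2 * \<epsilon>\<^sup>2)" .
    have c_eq: "c * \<epsilon>\<^sup>2 = \<epsilon>\<^sup>2 * (LINT t|lebesgue_on {0..T}. k t) + C * (c1\<^sup>2 * \<epsilon>\<^sup>2) + norm (grad_g (x T)) * (c2 * \<epsilon>\<^sup>2)"
      by (simp add: c_def algebra_simps)
    show "\<bar>((LINT t|lebesgue_on {0..T}. f t (?z' t)) + g (x' T)) - ((LINT t|lebesgue_on {0..T}. f t (?z t)) + g (x T))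
      - \<epsilon> * (LINT t|lebesgue_on {0..T}. snd (grad_ham t (?z t) (p t)) \<bullet> v t)\<bar> \<le> c * \<epsilon>\<^sup>2"
      unfolding gradient_duality(3)[OF u v x p y] c_eq distrib_left using F G1 G2 by linarith
  qed
qed

lemma gradient_is_first_derivative:
  assumes u: "u \<in> Lspace T 2"
  shows "is_first_derivative T cost_of u (gradient_of u)"
  unfolding is_first_derivative_def functional_gateaux_derivative_def
proof (intro conjI exI[of _ "L2_inner T (gradient_of u)"] ballI)
  show G: "gradient_of u \<in> Lspace T 2"
    by (rule gradient_of_Lspace[OF u])
  show "bounded_functional_L2 T (L2_inner T (gradient_of u))"
    by (rule bounded_functional_L2_inner[OF G])
  fix v :: "real \<Rightarrow> 'u" assume v: "v \<in> Lspace T 2"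
  obtain c where c: "\<forall>\<epsilon> x'. state_of (\<lambda>s. u s + \<epsilon> *\<^sub>R v s) x' \<longrightarrow>
    \<bar>((LINT t|lebesgue_on {0..T}. f t (x' t, u t + \<epsilon> *\<^sub>R v t)) + g (x' T))
      - ((LINT t|lebesgue_on {0..T}. f t (the_state u t, u t)) + g (the_state u T))
      - \<epsilon> * (LINT t|lebesgue_on {0..T}. snd (grad_ham t (the_state u t, u t) (the_adjoint u t)) \<bullet> v t)\<bar> \<le> c * \<epsilon>\<^sup>2"
    by (rule cost_expansion[OF u v the_state[OF u] the_adjoint[OF u]])
  have le: "norm ((cost_of (\<lambda>s. u s + \<epsilon> *\<^sub>R v s) - cost_of u) / \<epsilon> - L2_inner T (gradient_of u) v) \<le> c * \<bar>\<epsilon>\<bar>"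
    if "\<epsilon> \<noteq> 0" for \<epsilon>
  proof -
    have "(\<lambda>s. u s + \<epsilon> *\<^sub>R v s) \<in> Lspace T 2"
      by (intro Lspace_2_add Lspace_2_scaleR u v)
    then have "\<bar>cost_of (\<lambda>s. u s + \<epsilon> *\<^sub>R v s) - cost_of u - \<epsilon> * L2_inner T (gradient_of u) v\<bar> \<le> c * \<epsilon>\<^sup>2"
      using c[rule_format, OF the_state] by (simp add: cost_of_def L2_inner_def gradient_of_def)
    then have "norm (cost_of (\<lambda>s. u s + \<epsilon> *\<^sub>R v s) - cost_of u - \<epsilon> *\<^sub>R L2_inner T (gradient_of u) v) \<le> \<epsilon>\<^sup>2 * c"
      by (simp add: mult.commute)
    from norm_difference_quotient_le(1)[OF that this] show ?thesis
      by (simp add: divide_inverse mult.commute)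
  qed
  have "((\<lambda>\<epsilon>. c * \<bar>\<epsilon>\<bar>) \<longlongrightarrow> c * \<bar>0\<bar>) (at 0)"
    by (intro tendsto_intros)
  then have "((\<lambda>\<epsilon>. c * \<bar>\<epsilon>\<bar>) \<longlongrightarrow> 0) (at 0)" by simp
  then have "((\<lambda>\<epsilon>. (cost_of (\<lambda>s. u s + \<epsilon> *\<^sub>R v s) - cost_of u) / \<epsilon> - L2_inner T (gradient_of u) v) \<longlongrightarrow> 0) (at 0)"
    by (rule Lim_null_comparison[rotated]) (use le in \<open>simp add: eventually_at_filter\<close>)
  then show "((\<lambda>\<epsilon>. (cost_of (\<lambda>s. u s + \<epsilon> *\<^sub>R v s) - cost_of u) / \<epsilon>) \<longlongrightarrow> L2_inner T (gradient_of u) v) (at 0)"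
    by (rule LIM_zero_cancel)
qed simp

section \<open>The second derivative as a bounded operator\<close>

lemma state_var_linear:
  assumes y: "state_var_of u x v y" and y': "state_var_of u x w y'"
  shows "state_var_of u x (\<lambda>t. v t + c *\<^sub>R w t) (\<lambda>t. y t + c *\<^sub>R y' t)"
  unfolding state_var_of_def
proof
  have sol: "solves_ode_ae T (\<lambda>t _. Db t (x t, u t) (y t, v t) + c *\<^sub>R Db t (x t, u t) (y' t, w t)) (\<lambda>t. y t + c *\<^sub>R y' t)"
    by (rule solves_ode_ae_linear_combination[OF y[unfolded state_var_of_def, THEN conjunct1] y'[unfolded state_var_of_def, THEN conjunct1]])
  show "solves_ode_ae T (\<lambda>t \<eta>. Db t (x t, u t) (\<eta>, v t + c *\<^sub>R w t)) (\<lambda>t. y t + c *\<^sub>R y' t)"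
  proof (rule solves_ode_ae_cong[OF sol])
    fix t assume t: "t \<in> {0..T}"
    show "Db t (x t, u t) (y t, v t) + c *\<^sub>R Db t (x t, u t) (y' t, w t) = Db t (x t, u t) (y t + c *\<^sub>R y' t, v t + c *\<^sub>R w t)"
      unfolding linear_scale[OF linear_Db[OF t], symmetric] linear_add[OF linear_Db[OF t], symmetric] by simp
  qed
  show "y 0 + c *\<^sub>R y' 0 = 0"
    using y y' by (simp add: state_var_of_def)
qed

lemma adjoint_var_linear:
  assumes \<psi>: "adjoint_var_of u x p v y \<psi>" and \<psi>': "adjoint_var_of u x p w y' \<psi>'"
  shows "adjoint_var_of u x p (\<lambda>t. v t + c *\<^sub>R w t) (\<lambda>t. y t + c *\<^sub>R y' t) (\<lambda>t. \<psi> t + c *\<^sub>R \<psi>' t)"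
  unfolding adjoint_var_of_def
proof
  let ?Q = "\<lambda>t. grad_ham_lin t (x t, u t) (p t)"
  have sol: "solves_ode_ae T (\<lambda>t _. - fst (?Q t (y t, v t) (\<psi> t)) + c *\<^sub>R - fst (?Q t (y' t, w t) (\<psi>' t))) (\<lambda>t. \<psi> t + c *\<^sub>R \<psi>' t)"
    by (rule solves_ode_ae_linear_combination[OF \<psi>[unfolded adjoint_var_of_def, THEN conjunct1] \<psi>'[unfolded adjoint_var_of_def, THEN conjunct1]])
  show "solves_ode_ae T (\<lambda>t \<eta>. - fst (?Q t (y t + c *\<^sub>R y' t, v t + c *\<^sub>R w t) \<eta>)) (\<lambda>t. \<psi> t + c *\<^sub>R \<psi>' t)"
  proof (rule solves_ode_ae_cong[OF sol])
    fix t assume t: "t \<in> {0..T}"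
    have "?Q t (y t + c *\<^sub>R y' t, v t + c *\<^sub>R w t) (\<psi> t + c *\<^sub>R \<psi>' t) = ?Q t (y t, v t) (\<psi> t) + c *\<^sub>R ?Q t (y' t, w t) (\<psi>' t)"
      using grad_ham_lin_linear[OF t, of "(x t, u t)" "p t" "(y t, v t)" c "(y' t, w t)" "\<psi> t" "\<psi>' t"] by simp
    then show "- fst (?Q t (y t, v t) (\<psi> t)) + c *\<^sub>R - fst (?Q t (y' t, w t) (\<psi>' t))
        = - fst (?Q t (y t + c *\<^sub>R y' t, v t + c *\<^sub>R w t) (\<psi> t + c *\<^sub>R \<psi>' t))"
      by simp
  qed
  show "\<psi> T + c *\<^sub>R \<psi>' T = hess_g (x T) (y T + c *\<^sub>R y' T)"
    using \<psi> \<psi>' by (simp add: adjoint_var_of_def hess_g_linear)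
qed

text \<open>Superpositions solve the variation equations for the direction v + c w, and by
  uniqueness the value may be computed from them.\<close>

lemma hessian_of_linear:
  assumes u: "u \<in> Lspace T 2" and v: "v \<in> Lspace T 2" and w: "w \<in> Lspace T 2" and t: "t \<in> {0..T}"
  shows "hessian_of u (\<lambda>t. v t + c *\<^sub>R w t) t = hessian_of u v t + c *\<^sub>R hessian_of u w t"
proof -
  have vw: "(\<lambda>t. v t + c *\<^sub>R w t) \<in> Lspace T 2"
    by (intro Lspace_2_add Lspace_2_scaleR v w)
  have "hessian_of u (\<lambda>t. v t + c *\<^sub>R w t) t = snd (grad_ham_lin t (the_state u t, u t) (the_adjoint u t)
      (the_state_var u v t + c *\<^sub>R the_state_var u w t, v t + c *\<^sub>R w t) (the_adjoint_var u v t + c *\<^sub>R the_adjoint_var u w t))"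
    by (rule hessian_of_eq[OF u vw the_state[OF u] the_adjoint[OF u]
          state_var_linear[OF the_state_var[OF u v] the_state_var[OF u w]]
          adjoint_var_linear[OF the_adjoint_var[OF u v] the_adjoint_var[OF u w]] t])
  then show ?thesis
    using grad_ham_lin_linear[OF t, of "(the_state u t, u t)" "the_adjoint u t" "(the_state_var u v t, v t)" c
        "(the_state_var u w t, w t)" "the_adjoint_var u v t" "the_adjoint_var u w t"]
    by (simp add: hessian_of_def)
qed

lemma hessian_of_measurable:
  assumes u: "u \<in> Lspace T 2" and v: "v \<in> Lspace T 2"
  shows "hessian_of u v \<in> borel_measurable (lebesgue_on {0..T})"
proof -
  have "(\<lambda>t. grad_ham_lin t (the_state u t, u t) (the_adjoint u t) (the_state_var u v t, v t) (the_adjoint_var u v t))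
      \<in> borel_measurable (lebesgue_on {0..T})"
    by (intro grad_ham_lin_measurable Pair_measurable continuous_on_imp_measurable_lebesgue_on the_continuous u v)
  then show ?thesis
    unfolding hessian_of_def [abs_def] by (rule fst_snd_measurable)
qed

text \<open>Gronwall forwards for the state variation, then backwards for the adjoint variation;
  both bounds are multiples of the integral \<open>V\<close> of |v|, and the pointwise |v(t)| enters
  only through the linearized gradient.\<close>

lemma hessian_of_bound:
  assumes u: "u \<in> Lspace T 2"
  obtains K where "K \<ge> 0" "\<forall>v\<in>Lspace T 2. \<forall>t\<in>{0..T}.
      norm (hessian_of u v t) \<le> K * (norm (v t) + (LINT s|lebesgue_on {0..T}. norm (v s)))"
proof -
  obtain P where P: "P \<ge> 0" "\<forall>t\<in>{0..T}. norm (the_adjoint u t) \<le> P"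
    by (rule continuous_on_Icc_bounded[OF the_continuous(2)[OF u]])
  define E where "E = 2 * exp (2 * C * T)"
  have E: "E \<ge> 0" by (simp add: E_def)
  \<comment> \<open>The Gronwall factor times the coefficient of the forcing term
    \<open>C * norm (v s)\<close>.\<close>
  define cy where "cy = E * C"
  have cy: "cy \<ge> 0" using E C_pos by (simp add: cy_def)
  \<comment> \<open>The summand \<open>C * cy\<close> bounds the terminal value; the other one is
    the forcing term integrated over [0,T], where the bound for the state variation is constant in
    time and contributes \<open>T * cy\<close>.\<close>
  define cp where "cp = E * (C * cy + C * (1 + P) * (T * cy + 1))"
  have cp: "cp \<ge> 0" using E C_pos cy P(1) T_pos by (simp add: cp_def)
  show ?thesis
  proof (rule that; (intro ballI)?)
    show "C * cp + C * (1 + P) * (cy + 1) \<ge> 0"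
      using C_pos cp cy P(1) by simp
    fix v :: "real \<Rightarrow> 'u" and t assume v: "v \<in> Lspace T 2" and t: "t \<in> {0..T}"
    define V where "V = (LINT s|lebesgue_on {0..T}. norm (v s))"
    have V: "V \<ge> 0" by (simp add: V_def)
    have vi: "integrable (lebesgue_on {0..T}) (\<lambda>s. norm (v s))"
      using Lspace_2_integrable[OF v] by simp
    let ?x = "the_state u" and ?p = "the_adjoint u" and ?y = "the_state_var u v" and ?\<psi> = "the_adjoint_var u v"
    have y: "norm (?y t) \<le> cy * V" if t: "t \<in> {0..T}" for t
    proof -
      have "norm (?y t) \<le> 2 * exp (2 * C * T) * (norm (?y (if True then 0 else T)) + (LINT s|lebesgue_on {0..T}. C * norm (v s)))"
      proof (rule solves_ode_ae_bound[OF the_state_var[OF u v, unfolded state_var_of_def, THEN conjunct1] C_pos _ _ _ t])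
        show "AE t in lebesgue_on {0..T}. norm (Db t (?x t, u t) (?y t, v t)) \<le> C * norm (?y t) + C * norm (v t)"
        proof (rule AE_lebesgue_onI)
          fix t assume t: "t \<in> {0..T}"
          have "norm (Db t (?x t, u t) (?y t, v t)) \<le> C * (norm (?y t) + norm (v t))"
            using C_pos by (intro order_trans[OF Db_bound[OF t] mult_left_mono] norm_Pair_le) auto
          then show "norm (Db t (?x t, u t) (?y t, v t)) \<le> C * norm (?y t) + C * norm (v t)"
            by (simp add: algebra_simps)
        qed
      qed (use vi C_pos in auto)
      then show ?thesis
        using the_state_var[OF u v] by (simp add: state_var_of_def cy_def E_def V_def)
    qed
    have Q: "norm (grad_ham_lin t (?x t, u t) (?p t) (?y t, v t) (?\<psi> t)) \<le> C * norm (?\<psi> t) + C * (1 + P) * (cy * V + norm (v t))"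
      if t: "t \<in> {0..T}" for t
    proof -
      have "norm (grad_ham_lin t (?x t, u t) (?p t) (?y t, v t) (?\<psi> t))
          \<le> C * norm (?\<psi> t) + C * (1 + norm (?p t)) * norm (?y t, v t)"
        by (rule grad_ham_lin_bound[OF t])
      also have "\<dots> \<le> C * norm (?\<psi> t) + C * (1 + P) * (cy * V + norm (v t))"
        using C_pos P t order_trans[OF norm_Pair_le add_right_mono[OF y[OF t]]]
        by (intro add_left_mono mult_mono) auto
      finally show ?thesis .
    qed
    have \<psi>: "norm (?\<psi> t) \<le> cp * V" if t: "t \<in> {0..T}" for t
    proof -
      have T: "T \<in> {0..T}" using T_pos by simp
      have ki: "integrable (lebesgue_on {0..T}) (\<lambda>s. C * (1 + P) * (cy * V + norm (v s)))"
        using vi by simp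
      have kint: "(LINT s|lebesgue_on {0..T}. C * (1 + P) * (cy * V + norm (v s))) = C * (1 + P) * (T * (cy * V) + V)"
        using vi T_pos LINT_const_lebesgue_on_Icc[of T "cy * V"] by (simp add: V_def)
      have "norm (?\<psi> t) \<le> 2 * exp (2 * C * T) * (norm (?\<psi> (if False then 0 else T))
          + (LINT s|lebesgue_on {0..T}. C * (1 + P) * (cy * V + norm (v s))))"
      proof (rule solves_ode_ae_bound[OF the_adjoint_var[OF u v, unfolded adjoint_var_of_def, THEN conjunct1] C_pos ki _ _ t])
        show "AE t in lebesgue_on {0..T}. norm (- fst (grad_ham_lin t (?x t, u t) (?p t) (?y t, v t) (?\<psi> t)))
            \<le> C * norm (?\<psi> t) + C * (1 + P) * (cy * V + norm (v t))"
          unfolding norm_minus_cancel by (rule AE_lebesgue_onI, rule order_trans[OF norm_fst_le_norm Q])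
        show "0 \<le> C * (1 + P) * (cy * V + norm (v t))" for t
          using C_pos P(1) cy V by simp
      qed
      also have "\<dots> \<le> E * (C * (cy * V) + C * (1 + P) * (T * (cy * V) + V))"
      proof -
        have "norm (?\<psi> T) \<le> C * norm (?y T)"
          using the_adjoint_var[OF u v] hess_g_bound by (simp add: adjoint_var_of_def)
        also have "\<dots> \<le> C * (cy * V)"
          using C_pos y[OF T] by (intro mult_left_mono) auto
        finally show ?thesis
          unfolding kint E_def by (intro mult_left_mono add_right_mono) auto
      qed
      also have "\<dots> = cp * V"
        by (simp add: cp_def algebra_simps)
      finally show ?thesis .
    qed
    have "norm (hessian_of u v t) \<le> C * norm (?\<psi> t) + C * (1 + P) * (cy * V + norm (v t))"
      unfolding hessian_of_def by (rule order_trans[OF norm_snd_le_norm Q[OF t]])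
    also have "\<dots> \<le> C * (cp * (norm (v t) + V)) + C * (1 + P) * ((cy + 1) * (norm (v t) + V))"
    proof (intro add_mono mult_left_mono)
      have "cp * V \<le> cp * (norm (v t) + V)"
        using cp by (intro mult_left_mono) auto
      then show "norm (?\<psi> t) \<le> cp * (norm (v t) + V)"
        using \<psi>[OF t] by linarith
      show "cy * V + norm (v t) \<le> (cy + 1) * (norm (v t) + V)"
        using cy V by (simp add: algebra_simps)
    qed (use C_pos P(1) in auto)
    finally show "norm (hessian_of u v t) \<le> (C * cp + C * (1 + P) * (cy + 1)) * (norm (v t) + (LINT s|lebesgue_on {0..T}. norm (v s)))"
      by (simp add: V_def [symmetric] algebra_simps)
  qed
qed

lemma hessian_of_bounded_operator:
  assumes u: "u \<in> Lspace T 2" and \<beta>: "\<beta> \<ge> 2"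
  shows "bounded_operator T \<beta> (hessian_of u)"
proof -
  obtain K where K: "K \<ge> 0" "\<forall>v\<in>Lspace T 2. \<forall>t\<in>{0..T}.
      norm (hessian_of u v t) \<le> K * (norm (v t) + (LINT s|lebesgue_on {0..T}. norm (v s)))"
    by (rule hessian_of_bound[OF u])
  have zero: "(\<lambda>_. 0) \<in> Lspace T 2" by (rule Lspace_2_const)
  show ?thesis
  proof (rule bounded_operatorI[OF T_pos \<beta> K(1) hessian_of_measurable[OF u]])
    show "AE t in lebesgue_on {0..T}. hessian_of u (\<lambda>s. v s + w s) t = hessian_of u v t + hessian_of u w t"
      if "v \<in> Lspace T 2" "w \<in> Lspace T 2" for v w
      using hessian_of_linear[OF u that, of _ 1] by (intro AE_lebesgue_onI) simp
    show "AE t in lebesgue_on {0..T}. hessian_of u (\<lambda>s. c *\<^sub>R v s) t = c *\<^sub>R hessian_of u v t"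
      if "v \<in> Lspace T 2" for c v
    proof (rule AE_lebesgue_onI)
      fix t assume t: "t \<in> {0..T}"
      show "hessian_of u (\<lambda>s. c *\<^sub>R v s) t = c *\<^sub>R hessian_of u v t"
        \<comment> \<open>Combining the zero direction with itself under the factor -1 gives the
          value 0 there; homogeneity is then the case of a zero first summand.\<close>
        using hessian_of_linear[OF u zero that t, of c] hessian_of_linear[OF u zero zero t, of "-1"]
        by simp
    qed
    show "AE t in lebesgue_on {0..T}. norm (hessian_of u v t) \<le> K * (norm (v t) + (LINT s|lebesgue_on {0..T}. norm (v s)))"
      if "v \<in> Lspace T 2" for v
      using K(2) that by (intro AE_lebesgue_onI) blast
  qed
qed

lemma gradient_of_gateaux_derivative:
  assumes u: "u \<in> Lspace T 2" and v: "v \<in> Lspace T 2"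
  shows "((\<lambda>\<epsilon>. Lnorm T 2 (\<lambda>t. (gradient_of (\<lambda>s. u s + \<epsilon> *\<^sub>R v s) t - gradient_of u t) /\<^sub>R \<epsilon> - hessian_of u v t)) \<longlongrightarrow> 0) (at 0)"
proof -
  let ?u = "\<lambda>\<epsilon> s. u s + \<epsilon> *\<^sub>R v s"
  have u': "?u \<epsilon> \<in> Lspace T 2" for \<epsilon>
    by (intro Lspace_2_add Lspace_2_scaleR u v)
  note ctx = u v the_state[OF u] the_adjoint[OF u] the_state_var[OF u v] the_adjoint_var[OF u v]
  obtain k where k: "\<forall>\<epsilon> x' p'. state_of (?u \<epsilon>) x' \<longrightarrow> adjoint_of (?u \<epsilon>) x' p' \<longrightarrow>
      (\<forall>t\<in>{0..T}. norm (grad_ham t (x' t, u t + \<epsilon> *\<^sub>R v t) (p' t) - grad_ham t (the_state u t, u t) (the_adjoint u t)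
        - \<epsilon> *\<^sub>R grad_ham_lin t (the_state u t, u t) (the_adjoint u t) (the_state_var u v t, v t) (the_adjoint_var u v t)) \<le> \<epsilon>\<^sup>2 * k t)"
    by (rule grad_ham_perturbation_taylor[OF ctx])
  obtain c where c: "c \<ge> 0" "\<forall>\<epsilon> x' p'. state_of (?u \<epsilon>) x' \<longrightarrow> adjoint_of (?u \<epsilon>) x' p' \<longrightarrow>
      (\<forall>t\<in>{0..T}. norm (grad_ham t (x' t, u t + \<epsilon> *\<^sub>R v t) (p' t) - grad_ham t (the_state u t, u t) (the_adjoint u t)) \<le> \<bar>\<epsilon>\<bar> * (c * (1 + norm (v t))))"
    by (rule grad_ham_perturbation_lipschitz[OF ctx])
  have H: "hessian_of u v \<in> Lspace T 2"
    using bounded_operator_Lspace[OF hessian_of_bounded_operator[OF u order_refl] v] .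
  show ?thesis
  \<comment> \<open>The majorant adds the bound for the quotient and the norm of the candidate
    derivative; neither depends on \<epsilon>.\<close>
  proof (rule Lnorm_2_tendsto_0[where k=k and m="\<lambda>t. (c + c * norm (v t)) + (0 + 1 * norm (hessian_of u v t))"])
    show "(\<lambda>t. (gradient_of (?u \<epsilon>) t - gradient_of u t) /\<^sub>R \<epsilon> - hessian_of u v t) \<in> borel_measurable (lebesgue_on {0..T})" for \<epsilon>
      by (intro Lspace_measurable[of _ T 2] Lspace_2_diff Lspace_2_scaleR gradient_of_Lspace u u' H)
    show "(\<lambda>t. (c + c * norm (v t)) + (0 + 1 * norm (hessian_of u v t))) \<in> Lspace T 2"
      by (intro Lspace_2_add[OF Lspace_2_affine_norm[OF v] Lspace_2_affine_norm[OF H]])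
    fix \<epsilon> t :: real assume "\<epsilon> \<noteq> 0" and t: "t \<in> {0..T}"
    have "norm (grad_ham t (the_state (?u \<epsilon>) t, u t + \<epsilon> *\<^sub>R v t) (the_adjoint (?u \<epsilon>) t) - grad_ham t (the_state u t, u t) (the_adjoint u t)
        - \<epsilon> *\<^sub>R grad_ham_lin t (the_state u t, u t) (the_adjoint u t) (the_state_var u v t, v t) (the_adjoint_var u v t)) \<le> \<epsilon>\<^sup>2 * k t"
      using k the_state[OF u'] the_adjoint[OF u'] t by blast
    from order_trans[OF norm_snd_le_norm this]
    have "norm (gradient_of (?u \<epsilon>) t - gradient_of u t - \<epsilon> *\<^sub>R hessian_of u v t) \<le> \<epsilon>\<^sup>2 * k t"
      by (simp add: gradient_of_def hessian_of_def)
    then show "norm ((gradient_of (?u \<epsilon>) t - gradient_of u t) /\<^sub>R \<epsilon> - hessian_of u v t) \<le> \<bar>\<epsilon>\<bar> * k t"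
      by (rule norm_difference_quotient_le(1)[OF \<open>\<epsilon> \<noteq> 0\<close>])
    have "norm (grad_ham t (the_state (?u \<epsilon>) t, u t + \<epsilon> *\<^sub>R v t) (the_adjoint (?u \<epsilon>) t) - grad_ham t (the_state u t, u t) (the_adjoint u t))
        \<le> \<bar>\<epsilon>\<bar> * (c * (1 + norm (v t)))"
      using c(2) the_state[OF u'] the_adjoint[OF u'] t by blast
    from order_trans[OF norm_snd_le_norm this]
    have "norm (gradient_of (?u \<epsilon>) t - gradient_of u t) \<le> \<bar>\<epsilon>\<bar> * (c * (1 + norm (v t)))"
      by (simp add: gradient_of_def)
    then have "norm ((gradient_of (?u \<epsilon>) t - gradient_of u t) /\<^sub>R \<epsilon>) \<le> c * (1 + norm (v t))"
      by (rule norm_difference_quotient_le(2)[OF \<open>\<epsilon> \<noteq> 0\<close>])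
    then show "norm ((gradient_of (?u \<epsilon>) t - gradient_of u t) /\<^sub>R \<epsilon> - hessian_of u v t)
        \<le> (c + c * norm (v t)) + (0 + 1 * norm (hessian_of u v t))"
      using norm_triangle_ineq4[of "(gradient_of (?u \<epsilon>) t - gradient_of u t) /\<^sub>R \<epsilon>" "hessian_of u v t"]
      by (simp add: algebra_simps)
  qed
qed

text \<open>\<open>first_derivative\<close> is an arbitrary choice among representatives that agree
  almost everywhere, so it meets \<open>gradient_of\<close> only outside a null set that may depend
  on \<open>u\<close>.\<close>

lemma first_derivative_AE:
  assumes u: "u \<in> Lspace T 2"
  shows "is_first_derivative T cost_of u (first_derivative T cost_of u)"
    and "AE t in lebesgue_on {0..T}. first_derivative T cost_of u t = gradient_of u t"
proof -
  show 1: "is_first_derivative T cost_of u (first_derivative T cost_of u)"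
    unfolding first_derivative_def by (rule someI[where P="is_first_derivative T cost_of u", OF gradient_is_first_derivative[OF u]])
  show "AE t in lebesgue_on {0..T}. first_derivative T cost_of u t = gradient_of u t"
    by (rule is_first_derivative_unique[OF 1 gradient_is_first_derivative[OF u]])
qed

lemma first_derivative_Lspace: "u \<in> Lspace T 2 \<Longrightarrow> first_derivative T cost_of u \<in> Lspace T 2"
  using first_derivative_AE(1) by (simp add: is_first_derivative_def)

text \<open>For each \<epsilon> the two null sets on which the chosen representatives differ from
  \<open>gradient_of\<close> are discarded; the L^2 norm does not see them.\<close>

lemma hessian_is_second_derivative:
  assumes u: "u \<in> Lspace T 2"
  shows "operator_gateaux_derivative T (first_derivative T cost_of) u (hessian_of u)"
  unfolding operator_gateaux_derivative_def
proof (intro conjI ballI)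
  show "bounded_operator T 2 (hessian_of u)"
    by (rule hessian_of_bounded_operator[OF u order_refl])
  fix v :: "real \<Rightarrow> 'u" assume v: "v \<in> Lspace T 2"
  let ?u = "\<lambda>\<epsilon> s. u s + \<epsilon> *\<^sub>R v s"
  have u': "?u \<epsilon> \<in> Lspace T 2" for \<epsilon>
    by (intro Lspace_2_add Lspace_2_scaleR u v)
  have H: "hessian_of u v \<in> Lspace T 2"
    using bounded_operator_Lspace[OF hessian_of_bounded_operator[OF u order_refl] v] .
  have "Lnorm T 2 (\<lambda>t. (first_derivative T cost_of (?u \<epsilon>) t - first_derivative T cost_of u t) /\<^sub>R \<epsilon> - hessian_of u v t)
      = Lnorm T 2 (\<lambda>t. (gradient_of (?u \<epsilon>) t - gradient_of u t) /\<^sub>R \<epsilon> - hessian_of u v t)" for \<epsilon>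
  proof (rule Lnorm_2_cong_AE)
    show "AE t in lebesgue_on {0..T}. (first_derivative T cost_of (?u \<epsilon>) t - first_derivative T cost_of u t) /\<^sub>R \<epsilon> - hessian_of u v t
        = (gradient_of (?u \<epsilon>) t - gradient_of u t) /\<^sub>R \<epsilon> - hessian_of u v t"
      using first_derivative_AE(2)[OF u] first_derivative_AE(2)[OF u'[of \<epsilon>]] by eventually_elim simp
  qed (intro Lspace_measurable[of _ T 2] Lspace_2_diff Lspace_2_scaleR gradient_of_Lspace first_derivative_Lspace u u' H)+
  then show "((\<lambda>\<epsilon>. Lnorm T 2 (\<lambda>t. (first_derivative T cost_of (?u \<epsilon>) t - first_derivative T cost_of u t) /\<^sub>R \<epsilon> - hessian_of u v t)) \<longlongrightarrow> 0) (at 0)"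
    using gradient_of_gateaux_derivative[OF u v] by simp
qed

lemma cost_twice_gateaux_differentiable: "twice_gateaux_differentiable T cost_of"
  unfolding twice_gateaux_differentiable_def
proof (intro conjI ballI)
  fix u :: "real \<Rightarrow> 'u" assume u: "u \<in> Lspace T 2"
  show "\<exists>G. is_first_derivative T cost_of u G"
    using gradient_is_first_derivative[OF u] by (rule exI[of _ "gradient_of u"])
  show "\<exists>A. operator_gateaux_derivative T (first_derivative T cost_of) u A"
    using hessian_is_second_derivative[OF u] by (rule exI[of _ "hessian_of u"])
qed

lemma second_derivative_AE:
  assumes u: "u \<in> Lspace T 2"
  shows "operator_gateaux_derivative T (first_derivative T cost_of) u (second_derivative T cost_of u)"
    and "v \<in> Lspace T 2 \<Longrightarrow> AE t in lebesgue_on {0..T}. second_derivative T cost_of u v t = hessian_of u v t"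
proof -
  show 1: "operator_gateaux_derivative T (first_derivative T cost_of) u (second_derivative T cost_of u)"
    unfolding second_derivative_def by (rule someI[where P="operator_gateaux_derivative T (first_derivative T cost_of) u", OF hessian_is_second_derivative[OF u]])
  show "AE t in lebesgue_on {0..T}. second_derivative T cost_of u v t = hessian_of u v t" if "v \<in> Lspace T 2"
    by (rule operator_gateaux_derivative_unique[OF 1 hessian_is_second_derivative[OF u] first_derivative_Lspace u that])
qed

text \<open>The chosen operator is linear since it is a bounded operator on L^2, and it inherits the
  pointwise bound of \<open>hessian_of\<close> almost everywhere; together these give boundedness on
  L^\<beta>.\<close>

lemma second_derivative_bounded_operator:
  assumes u: "u \<in> Lspace T 2" and \<beta>: "\<beta> \<ge> 2"
  shows "bounded_operator T \<beta> (second_derivative T cost_of u)"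
proof -
  let ?A = "second_derivative T cost_of u"
  have A: "bounded_operator T 2 ?A"
    using second_derivative_AE(1)[OF u] by (simp add: operator_gateaux_derivative_def)
  obtain K where K: "K \<ge> 0" "\<forall>v\<in>Lspace T 2. \<forall>t\<in>{0..T}.
      norm (hessian_of u v t) \<le> K * (norm (v t) + (LINT s|lebesgue_on {0..T}. norm (v s)))"
    by (rule hessian_of_bound[OF u])
  show ?thesis
  proof (rule bounded_operatorI[OF T_pos \<beta> K(1)])
    fix v :: "real \<Rightarrow> 'u" assume v: "v \<in> Lspace T 2"
    show "?A v \<in> borel_measurable (lebesgue_on {0..T})"
      by (rule Lspace_measurable[OF bounded_operator_Lspace[OF A v]])
    show "AE t in lebesgue_on {0..T}. ?A (\<lambda>s. c *\<^sub>R v s) t = c *\<^sub>R ?A v t" for c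
      using A v by (simp add: bounded_operator_def)
    have "AE t in lebesgue_on {0..T}. norm (hessian_of u v t) \<le> K * (norm (v t) + (LINT s|lebesgue_on {0..T}. norm (v s)))"
      using K(2) v by (intro AE_lebesgue_onI) blast
    then show "AE t in lebesgue_on {0..T}. norm (?A v t) \<le> K * (norm (v t) + (LINT s|lebesgue_on {0..T}. norm (v s)))"
      using second_derivative_AE(2)[OF u v] by eventually_elim simp
    show "AE t in lebesgue_on {0..T}. ?A (\<lambda>s. v s + w s) t = ?A v t + ?A w t" if "w \<in> Lspace T 2" for w
      using A v that by (simp add: bounded_operator_def)
  qed
qed

lemma second_derivative_inner:
  assumes u: "u \<in> Lspace T 2" and v: "v \<in> Lspace T 2" and w: "w \<in> Lspace T 2"
    and x: "state_of u x" and p: "adjoint_of u x p" and y: "state_var_of u x v y"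
    and \<psi>: "adjoint_var_of u x p v y \<psi>" and yw: "state_var_of u x w y'"
  shows "L2_inner T (second_derivative T cost_of u v) w
      = (LINT t|lebesgue_on {0..T}. grad_ham_lin t (x t, u t) (p t) (y t, v t) 0 \<bullet> (y' t, w t)) + hess_g (x T) (y T) \<bullet> y' T"
proof -
  have H: "hessian_of u v \<in> Lspace T 2"
    using bounded_operator_Lspace[OF hessian_of_bounded_operator[OF u order_refl] v] .
  have A: "second_derivative T cost_of u v \<in> Lspace T 2"
    using bounded_operator_Lspace[OF second_derivative_bounded_operator[OF u order_refl] v] .
  have eq: "hessian_of u v t \<bullet> w t = snd (grad_ham_lin t (x t, u t) (p t) (y t, v t) (\<psi> t)) \<bullet> w t" if "t \<in> {0..T}" for t
    using hessian_of_eq[OF u v x p y \<psi> that] by simp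
  have int: "integrable (lebesgue_on {0..T}) (\<lambda>t. snd (grad_ham_lin t (x t, u t) (p t) (y t, v t) (\<psi> t)) \<bullet> w t)"
    using Lspace_2_integrable_inner[OF H w] eq by (subst (asm) Bochner_Integration.integrable_cong) auto
  have "AE t in lebesgue_on {0..T}. hessian_of u v t = snd (grad_ham_lin t (x t, u t) (p t) (y t, v t) (\<psi> t))"
    by (rule AE_lebesgue_onI) (rule hessian_of_eq[OF u v x p y \<psi>])
  then have "AE t in lebesgue_on {0..T}. second_derivative T cost_of u v t \<bullet> w t
      = snd (grad_ham_lin t (x t, u t) (p t) (y t, v t) (\<psi> t)) \<bullet> w t"
    using second_derivative_AE(2)[OF u v] by eventually_elim simp
  then have "L2_inner T (second_derivative T cost_of u v) w
      = (LINT t|lebesgue_on {0..T}. snd (grad_ham_lin t (x t, u t) (p t) (y t, v t) (\<psi> t)) \<bullet> w t)"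
    unfolding L2_inner_def using Lspace_2_integrable_inner[OF A w] int
    by (intro integral_cong_AE) (auto dest: borel_measurable_integrable)
  then show ?thesis
    using hessian_duality[OF u v w x p y \<psi> yw int] by simp
qed

end

section \<open>Jacobians, gradients and Hessians\<close>

lemma jacobian_mult:
  fixes F :: "real^'n \<Rightarrow> real^'m"
  assumes "(F has_derivative F') (at x)"
  shows "jacobian F (at x) *v h = F' h"
proof -
  have "(F has_derivative (\<lambda>h. jacobian F (at x) *v h)) (at x)"
    using assms jacobian_works[of F "at x"] differentiableI by blast
  from has_derivative_unique[OF this assms] show ?thesis
    by (simp add: fun_eq_iff)
qed

text \<open>\<open>gradient\<close> is a definite description, so existence and uniqueness of the
  representing vector are both shown.\<close>

lemma gradient_eq_riesz:
  fixes \<phi> :: "'a::euclidean_space \<Rightarrow> real"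
  assumes "(\<phi> has_derivative \<phi>') (at z)"
  shows "gradient \<phi> z = riesz \<phi>'"
  unfolding gradient_def
proof (rule the_equality)
  have lin: "linear \<phi>'"
    using assms by (rule has_derivative_linear)
  have "\<phi>' = (\<lambda>h. h \<bullet> riesz \<phi>')"
    using inner_riesz[OF lin] by (simp add: fun_eq_iff inner_commute)
  then show "GDERIV \<phi> z :> riesz \<phi>'"
    unfolding gderiv_def using assms by simp
  fix D assume "GDERIV \<phi> z :> D"
  then have "(\<phi> has_derivative (\<lambda>h. h \<bullet> D)) (at z)"
    by (simp add: gderiv_def)
  from has_derivative_unique[OF this assms] have "h \<bullet> D = h \<bullet> riesz \<phi>'" for h
    using inner_riesz[OF lin, of h] by (metis inner_commute)
  then show "D = riesz \<phi>'"
    by (intro vector_eq_ldot[THEN iffD1]) blast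
qed

lemma inner_gradient:
  fixes \<phi> :: "'a::euclidean_space \<Rightarrow> real"
  assumes "(\<phi> has_derivative \<phi>') (at z)"
  shows "gradient \<phi> z \<bullet> h = \<phi>' h"
  unfolding gradient_eq_riesz[OF assms] by (rule inner_riesz[OF has_derivative_linear[OF assms]])

lemma has_derivative_partial_fst:
  assumes "(\<phi> has_derivative \<phi>') (at (x, u))"
  shows "((\<lambda>\<xi>. \<phi> (\<xi>, u)) has_derivative (\<lambda>h. \<phi>' (h, 0))) (at x)"
  by (rule has_derivative_compose[where f="\<lambda>\<xi>. (\<xi>, u)" and f'="\<lambda>h. (h, 0)" and g=\<phi>, OF _ assms])
    (auto intro!: derivative_eq_intros)

lemma has_derivative_partial_snd:
  assumes "(\<phi> has_derivative \<phi>') (at (x, u))"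
  shows "((\<lambda>\<mu>. \<phi> (x, \<mu>)) has_derivative (\<lambda>h. \<phi>' (0, h))) (at u)"
  by (rule has_derivative_compose[where f="\<lambda>\<mu>. (x, \<mu>)" and f'="\<lambda>h. (0, h)" and g=\<phi>, OF _ assms])
    (auto intro!: derivative_eq_intros)

lemma inner_transpose_mult:
  fixes A :: "real^'m^'n"
  shows "(transpose A *v p) \<bullet> h = p \<bullet> (A *v h)"
  by (simp add: dot_lmul_matrix)

text \<open>Cauchy-Schwarz in each row; the norm of a matrix is the Euclidean norm of its entries,
  as in the standing assumptions.\<close>

lemma norm_matrix_vector_mult_le:
  fixes A :: "real^'m^'n"
  shows "norm (A *v x) \<le> norm A * norm x"
proof -
  have "norm (A *v x) = L2_set (\<lambda>i. norm ((A *v x) $ i)) UNIV"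
    by (simp add: norm_vec_def)
  also have "\<dots> \<le> L2_set (\<lambda>i. norm (A $ i) * norm x) UNIV"
    by (intro L2_set_mono) (auto simp: matrix_vector_mul_component Cauchy_Schwarz_ineq2)
  also have "\<dots> = norm A * norm x"
    by (simp add: norm_vec_def[of A] L2_set_left_distrib)
  finally show ?thesis .
qed

lemma has_derivative_gradient:
  fixes \<phi> :: "'a::euclidean_space \<Rightarrow> real"
  assumes td: "twice_differentiable \<phi>"
  shows "(gradient \<phi> has_derivative (\<lambda>k. riesz (\<lambda>h. second_deriv_array \<phi> z h k))) (at z)"
proof -
  have "gradient \<phi> = (\<lambda>\<zeta>. riesz (frechet_derivative \<phi> (at \<zeta>)))"
    by (rule ext) (rule gradient_eq_riesz[OF twice_differentiableD(1)[OF td]])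
  moreover have "((\<lambda>\<zeta>. riesz (frechet_derivative \<phi> (at \<zeta>))) has_derivative (\<lambda>k. riesz (\<lambda>h. second_deriv_array \<phi> z h k))) (at z)"
    unfolding riesz_def
    by (intro has_derivative_sum has_derivative_scaleR_left twice_differentiableD(2)[OF td])
  ultimately show ?thesis by simp
qed

lemma inner_hessian:
  fixes g :: "real^'n \<Rightarrow> real"
  assumes td: "twice_differentiable g"
  shows "(hessian g z *v k) \<bullet> h = second_deriv_array g z h k"
  unfolding hessian_def jacobian_mult[OF has_derivative_gradient[OF td]]
  by (rule inner_riesz[OF twice_differentiableD(3)[OF td]])

text \<open>The hypotheses on \<open>g\<close> concern the Hessian matrix, so the bilinear bounds
  follow from its norm without a power of the dimension.\<close>

lemma terminal_cost_lipschitz_second_derivative: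
  fixes g :: "real^'n \<Rightarrow> real"
  assumes "terminal_cost_assms g L" "L \<ge> 0" "L \<le> C"
  shows "lipschitz_second_derivative g C"
proof
  have td: "twice_differentiable g" and bd: "norm (hessian g x) \<le> L"
    and lip: "norm (hessian g x - hessian g x') \<le> L * norm (x - x')" for x x'
    using assms(1) by (auto simp: terminal_cost_assms_def)
  show "twice_differentiable g" "C \<ge> 0"
    using td assms by auto
  fix z z' h k :: "real^'n"
  have "norm (second_deriv_array g z h k) \<le> norm (hessian g z *v k) * norm h"
    by (simp add: inner_hessian[OF td, symmetric] Cauchy_Schwarz_ineq2)
  also have "\<dots> \<le> (norm (hessian g z) * norm k) * norm h"
    by (intro mult_right_mono norm_matrix_vector_mult_le) auto
  also have "\<dots> \<le> (C * norm k) * norm h"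
    using bd[of z] assms(3) by (intro mult_right_mono) auto
  finally show "norm (second_deriv_array g z h k) \<le> C * norm h * norm k"
    by (simp add: mult_ac)
  have "second_deriv_array g z h k - second_deriv_array g z' h k = ((hessian g z - hessian g z') *v k) \<bullet> h"
    by (simp add: inner_hessian[OF td, symmetric] matrix_vector_mult_diff_rdistrib inner_diff_left)
  then have "norm (second_deriv_array g z h k - second_deriv_array g z' h k) \<le> norm ((hessian g z - hessian g z') *v k) * norm h"
    by (simp add: Cauchy_Schwarz_ineq2)
  also have "\<dots> \<le> (norm (hessian g z - hessian g z') * norm k) * norm h"
    by (intro mult_right_mono norm_matrix_vector_mult_le) auto
  also have "\<dots> \<le> ((C * norm (z - z')) * norm k) * norm h"
    using order_trans[OF lip[of z z'] mult_right_mono[OF assms(3)]] by (intro mult_right_mono) auto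
  finally show "norm (second_deriv_array g z h k - second_deriv_array g z' h k) \<le> C * norm (z - z') * norm h * norm k"
    by (simp add: mult_ac)
qed

section \<open>From bounds on partial derivatives to the joint variable\<close>

lemma norm_fst_plus_norm_snd_le: "norm (fst z) + norm (snd z) \<le> 2 * norm z"
  using norm_fst_le_norm[of z] norm_snd_le_norm[of z] by linarith

text \<open>The factor 2 in the constant converts the sum of the norms of the two components into
  the norm of the pair.\<close>

lemma lipschitz_second_derivative_pairI:
  fixes \<phi> :: "real^'n \<Rightarrow> real^'m \<Rightarrow> 'b::euclidean_space"
  assumes td: "twice_differentiable (\<lambda>(x, u). \<phi> x u)" and "L \<ge> 0"
    and bd: "\<And>x u. array_norm (second_deriv_array (\<lambda>(\<xi>, \<mu>). \<phi> \<xi> \<mu>) (x, u)) \<le> L"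
    and lip: "\<And>x u x' u'. array_norm (\<lambda>h k. second_deriv_array (\<lambda>(\<xi>, \<mu>). \<phi> \<xi> \<mu>) (x, u) h k
                                    - second_deriv_array (\<lambda>(\<xi>, \<mu>). \<phi> \<xi> \<mu>) (x', u') h k)
                     \<le> L * (norm (x - x') + norm (u - u'))"
  shows "lipschitz_second_derivative (\<lambda>z. \<phi> (fst z) (snd z)) ((real DIM((real^'n) \<times> (real^'m)))\<^sup>2 * (2 * L))"
proof (rule lipschitz_second_derivativeI)
  have eq: "(\<lambda>(\<xi>, \<mu>). \<phi> \<xi> \<mu>) = (\<lambda>z. \<phi> (fst z) (snd z))"
    by auto
  show "twice_differentiable (\<lambda>z. \<phi> (fst z) (snd z))"
    using td unfolding eq .
  show "array_norm (second_deriv_array (\<lambda>z. \<phi> (fst z) (snd z)) z) \<le> 2 * L" for z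
    using bd[of "fst z" "snd z"] \<open>L \<ge> 0\<close> unfolding eq by simp
  show "array_norm (\<lambda>h k. second_deriv_array (\<lambda>z. \<phi> (fst z) (snd z)) z h k - second_deriv_array (\<lambda>z. \<phi> (fst z) (snd z)) z' h k)
      \<le> 2 * L * norm (z - z')" for z z'
  proof -
    have "array_norm (\<lambda>h k. second_deriv_array (\<lambda>z. \<phi> (fst z) (snd z)) z h k - second_deriv_array (\<lambda>z. \<phi> (fst z) (snd z)) z' h k)
        \<le> L * (norm (fst z - fst z') + norm (snd z - snd z'))"
      using lip[of "fst z" "snd z" "fst z'" "snd z'"] unfolding eq by simp
    also have "\<dots> \<le> L * (2 * norm (z - z'))"
      using norm_fst_plus_norm_snd_le[of "z - z'"] \<open>L \<ge> 0\<close> by (intro mult_left_mono) auto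
    finally show ?thesis by simp
  qed
qed (use \<open>L \<ge> 0\<close> in auto)

lemma jac_mult:
  assumes "((\<lambda>z. b t (fst z) (snd z)) has_derivative D) (at (x, u))"
  shows "jac_x b t x u *v h = D (h, 0)" "jac_u b t x u *v k = D (0, k)"
  using jacobian_mult[OF has_derivative_partial_fst[OF assms, simplified], of h]
    jacobian_mult[OF has_derivative_partial_snd[OF assms, simplified], of k]
  by (simp_all add: jac_x_def jac_u_def)

lemma grad_inner:
  assumes "((\<lambda>z. f t (fst z) (snd z)) has_derivative D) (at (x, u))"
  shows "grad_x f t x u \<bullet> h = D (h, 0)" "grad_u f t x u \<bullet> k = D (0, k)"
  using inner_gradient[OF has_derivative_partial_fst[OF assms, simplified], of h]
    inner_gradient[OF has_derivative_partial_snd[OF assms, simplified], of k]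
  by (simp_all add: grad_x_def grad_u_def)

lemma linear_pair_split:
  assumes "linear D"
  shows "D (h, k) = D (h, 0) + D (0, k)"
  using linear_add[OF assms, of "(h, 0)" "(0, k)"] by simp

lemma standing_assms_imp_control_problem:
  fixes b :: "real \<Rightarrow> real^'n \<Rightarrow> real^'m \<Rightarrow> real^'n"
  assumes "T > 0" "standing_assms T b f g"
  obtains C where "control_problem T C (\<lambda>t z. b t (fst z) (snd z)) (\<lambda>t z. f t (fst z) (snd z)) g"
proof -
  obtain L where "L > 0" and dyn: "dynamics_assms T b L" and run: "running_cost_assms T f L"
    and ter: "terminal_cost_assms g L"
    using assms(2) by (auto simp: standing_assms_def)
  \<comment> \<open>Dictated by the second derivatives of \<open>b\<close> and \<open>f\<close>;
    being at least \<open>2 * L\<close>, it also covers the first derivatives and the growth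
    bounds.\<close>
  define C where "C = (real DIM((real^'n) \<times> (real^'m)))\<^sup>2 * (2 * L)"
  have "1 \<le> (real DIM((real^'n) \<times> (real^'m)))\<^sup>2"
    using DIM_positive[where 'a="(real^'n) \<times> (real^'m)"] by (intro one_le_power) linarith
  then have LC: "2 * L \<le> C"
    using \<open>L > 0\<close> mult_right_mono[of 1 "(real DIM((real^'n) \<times> (real^'m)))\<^sup>2" "2 * L"] unfolding C_def by linarith
  have bs: "lipschitz_second_derivative (\<lambda>z. b t (fst z) (snd z)) C" if "t \<in> {0..T}" for t
    unfolding C_def using dyn that \<open>L > 0\<close>
    by (intro lipschitz_second_derivative_pairI) (auto simp: dynamics_assms_def)
  have fs: "lipschitz_second_derivative (\<lambda>z. f t (fst z) (snd z)) C" if "t \<in> {0..T}" for t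
    unfolding C_def using run that \<open>L > 0\<close>
    by (intro lipschitz_second_derivative_pairI) (auto simp: running_cost_assms_def)
  have "control_problem T C (\<lambda>t z. b t (fst z) (snd z)) (\<lambda>t z. f t (fst z) (snd z)) g"
  proof (rule control_problem.intro)
    show "T > 0" by fact
    show "C > 0" using LC \<open>L > 0\<close> by linarith
    show "(\<lambda>(t, z). b t (fst z) (snd z)) \<in> borel_measurable (lebesgue_on ({0..T} \<times> UNIV))"
      using dyn by (simp add: dynamics_assms_def case_prod_unfold)
    show "(\<lambda>(t, z). f t (fst z) (snd z)) \<in> borel_measurable (lebesgue_on ({0..T} \<times> UNIV))"
      using run by (simp add: running_cost_assms_def case_prod_unfold)
    show "lipschitz_second_derivative g C"
      using LC \<open>L > 0\<close> by (intro terminal_cost_lipschitz_second_derivative[OF ter]) auto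
    fix t :: real assume t: "t \<in> {0..T}"
    show "lipschitz_second_derivative (\<lambda>z. b t (fst z) (snd z)) C" by (rule bs[OF t])
    show "lipschitz_second_derivative (\<lambda>z. f t (fst z) (snd z)) C" by (rule fs[OF t])
    fix z h :: "(real^'n) \<times> (real^'m)"
    obtain x u where z: "z = (x, u)" by (cases z)
    obtain h1 h2 where h: "h = (h1, h2)" by (cases h)
    have n12: "norm x + norm u + 1 \<le> 2 * (1 + norm z)"
      using norm_fst_plus_norm_snd_le[of z] by (simp add: z)
    have L1: "L * (norm x + norm u + 1) \<le> C * (1 + norm z)"
    proof -
      have "L * (norm x + norm u + 1) \<le> (2 * L) * (1 + norm z)"
        using mult_left_mono[OF n12, of L] \<open>L > 0\<close> by simp
      also have "\<dots> \<le> C * (1 + norm z)"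
        using LC by (intro mult_right_mono) auto
      finally show ?thesis .
    qed
    have "norm (b t x u) \<le> L * (norm x + norm u + 1)"
      using dyn t unfolding dynamics_assms_def by blast
    then show "norm (b t (fst z) (snd z)) \<le> C * (1 + norm z)"
      using L1 by (simp add: z)
    have bD: "((\<lambda>z. b t (fst z) (snd z)) has_derivative frechet_derivative (\<lambda>z. b t (fst z) (snd z)) (at (x, u))) (at (x, u))"
      by (rule lipschitz_second_derivative.first_has_derivative[OF bs[OF t]])
    have "norm (frechet_derivative (\<lambda>z. b t (fst z) (snd z)) (at z) h) = norm (jac_x b t x u *v h1 + jac_u b t x u *v h2)"
      unfolding z h linear_pair_split[OF has_derivative_linear[OF bD], of h1 h2] jac_mult[of b, OF bD] ..
    also have "\<dots> \<le> norm (jac_x b t x u) * norm h1 + norm (jac_u b t x u) * norm h2"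
      by (rule order_trans[OF norm_triangle_ineq add_mono]) (rule norm_matrix_vector_mult_le)+
    also have "\<dots> \<le> norm (jac_x b t x u) * norm h + norm (jac_u b t x u) * norm h"
      using norm_fst_le_norm[of h] norm_snd_le_norm[of h] by (intro add_mono mult_left_mono) (auto simp: h)
    also have "\<dots> = (norm (jac_x b t x u) + norm (jac_u b t x u)) * norm h"
      by (simp add: algebra_simps)
    also have "\<dots> \<le> C * norm h"
    proof (rule mult_right_mono)
      have "norm (jac_x b t x u) + norm (jac_u b t x u) \<le> L"
        using dyn t unfolding dynamics_assms_def by blast
      then show "norm (jac_x b t x u) + norm (jac_u b t x u) \<le> C"
        using LC \<open>L > 0\<close> by linarith
    qed simp
    finally show "norm (frechet_derivative (\<lambda>z. b t (fst z) (snd z)) (at z) h) \<le> C * norm h" .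
    have "\<bar>f t x u\<bar> \<le> L * ((norm x)\<^sup>2 + (norm u)\<^sup>2 + 1)"
      using run t unfolding running_cost_assms_def by blast
    also have "(norm x)\<^sup>2 + (norm u)\<^sup>2 + 1 = 1 + (norm z)\<^sup>2"
      by (simp add: z norm_Pair)
    also have "L * (1 + (norm z)\<^sup>2) \<le> C * (1 + (norm z)\<^sup>2)"
      using LC \<open>L > 0\<close> by (intro mult_right_mono) auto
    finally show "\<bar>f t (fst z) (snd z)\<bar> \<le> C * (1 + (norm z)\<^sup>2)"
      by (simp add: z)
    have fD: "((\<lambda>z. f t (fst z) (snd z)) has_derivative frechet_derivative (\<lambda>z. f t (fst z) (snd z)) (at (x, u))) (at (x, u))"
      by (rule lipschitz_second_derivative.first_has_derivative[OF fs[OF t]])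
    have "\<bar>frechet_derivative (\<lambda>z. f t (fst z) (snd z)) (at z) h\<bar> = \<bar>grad_x f t x u \<bullet> h1 + grad_u f t x u \<bullet> h2\<bar>"
      unfolding z h linear_pair_split[OF has_derivative_linear[OF fD], of h1 h2] grad_inner[of f, OF fD] ..
    also have "\<dots> \<le> norm (grad_x f t x u) * norm h1 + norm (grad_u f t x u) * norm h2"
      by (rule order_trans[OF abs_triangle_ineq add_mono]) (rule Cauchy_Schwarz_ineq2)+
    also have "\<dots> \<le> norm (grad_x f t x u) * norm h + norm (grad_u f t x u) * norm h"
      using norm_fst_le_norm[of h] norm_snd_le_norm[of h] by (intro add_mono mult_left_mono) (auto simp: h)
    also have "\<dots> = (norm (grad_x f t x u) + norm (grad_u f t x u)) * norm h"
      by (simp add: algebra_simps)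
    also have "\<dots> \<le> C * (1 + norm z) * norm h"
    proof (rule mult_right_mono)
      have "norm (grad_x f t x u) + norm (grad_u f t x u) \<le> L * (norm x + norm u + 1)"
        using run t unfolding running_cost_assms_def by blast
      then show "norm (grad_x f t x u) + norm (grad_u f t x u) \<le> C * (1 + norm z)"
        using L1 by linarith
    qed simp
    finally show "\<bar>frechet_derivative (\<lambda>z. f t (fst z) (snd z)) (at z) h\<bar> \<le> C * (1 + norm z) * norm h" .
  qed
  then show ?thesis by (rule that)
qed

text \<open>The coordinate version: curried data become an instance of the joint formulation, and
  the abstract derivatives are matched with Jacobians, gradients and Hessians.\<close>

locale cart_control_problem =
  control_problem T C "\<lambda>t z. b t (fst z) (snd z)" "\<lambda>t z. f t (fst z) (snd z)" g x0
  for T C :: real and b :: "real \<Rightarrow> real^'n \<Rightarrow> real^'m \<Rightarrow> real^'n"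
    and f :: "real \<Rightarrow> real^'n \<Rightarrow> real^'m \<Rightarrow> real" and g :: "real^'n \<Rightarrow> real" and x0 :: "real^'n"
begin

lemma Db_has_derivative: "t \<in> {0..T} \<Longrightarrow> ((\<lambda>z. b t (fst z) (snd z)) has_derivative Db t z) (at z)"
  using lipschitz_second_derivative.first_has_derivative[OF b_smooth] by (simp add: Db_def [abs_def])

lemma Df_has_derivative: "t \<in> {0..T} \<Longrightarrow> ((\<lambda>z. f t (fst z) (snd z)) has_derivative Df t z) (at z)"
  using lipschitz_second_derivative.first_has_derivative[OF f_smooth] by (simp add: Df_def [abs_def])

lemmas jac_eq = jac_mult[of b, OF Db_has_derivative]
lemmas grad_eq = grad_inner[of f, OF Df_has_derivative]

lemma fst_grad_ham:
  assumes t: "t \<in> {0..T}"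
  shows "fst (grad_ham t (x, u) p) = transpose (jac_x b t x u) *v p + grad_x f t x u"
proof (rule vector_eq_rdot[THEN iffD1], rule allI)
  fix h
  have "fst (grad_ham t (x, u) p) \<bullet> h = grad_ham t (x, u) p \<bullet> (h, 0)"
    by (simp add: inner_prod_def)
  also have "\<dots> = p \<bullet> (jac_x b t x u *v h) + grad_x f t x u \<bullet> h"
    by (simp add: inner_grad_ham[OF t] jac_eq[OF t] grad_eq[OF t])
  finally show "fst (grad_ham t (x, u) p) \<bullet> h = (transpose (jac_x b t x u) *v p + grad_x f t x u) \<bullet> h"
    by (simp only: inner_add_left inner_transpose_mult)
qed

lemma ham_has_derivative:
  assumes t: "t \<in> {0..T}"
  shows "((\<lambda>z. ham b f t (fst z) (snd z) p) has_derivative (\<lambda>h. p \<bullet> Db t z h + Df t z h)) (at z)"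
  unfolding ham_def
  by (rule has_derivative_eq_rhs[OF has_derivative_add[OF has_derivative_inner_left[OF Db_has_derivative[OF t]] Df_has_derivative[OF t]]])
    (simp add: inner_commute)

lemma ham_x_u_eq:
  assumes t: "t \<in> {0..T}"
  shows "ham_x b f t x u p = fst (grad_ham t (x, u) p)" "ham_u b f t x u p = snd (grad_ham t (x, u) p)"
proof -
  note d = ham_has_derivative[OF t, of p "(x, u)"]
  show "ham_x b f t x u p = fst (grad_ham t (x, u) p)"
  proof (rule vector_eq_rdot[THEN iffD1], rule allI)
    fix h
    have "ham_x b f t x u p \<bullet> h = p \<bullet> Db t (x, u) (h, 0) + Df t (x, u) (h, 0)"
      unfolding ham_x_def using inner_gradient[OF has_derivative_partial_fst[OF d], of h] by simp
    then show "ham_x b f t x u p \<bullet> h = fst (grad_ham t (x, u) p) \<bullet> h"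
      using inner_grad_ham[OF t, of "(x, u)" p "(h, 0)"] by (simp add: inner_prod_def)
  qed
  show "ham_u b f t x u p = snd (grad_ham t (x, u) p)"
  proof (rule vector_eq_rdot[THEN iffD1], rule allI)
    fix h
    have "ham_u b f t x u p \<bullet> h = p \<bullet> Db t (x, u) (0, h) + Df t (x, u) (0, h)"
      unfolding ham_u_def using inner_gradient[OF has_derivative_partial_snd[OF d], of h] by simp
    then show "ham_u b f t x u p \<bullet> h = snd (grad_ham t (x, u) p) \<bullet> h"
      using inner_grad_ham[OF t, of "(x, u)" p "(0, h)"] by (simp add: inner_prod_def)
  qed
qed

lemma grad_ham_has_derivative:
  assumes t: "t \<in> {0..T}"
  shows "((\<lambda>z. grad_ham t z p) has_derivative (\<lambda>k. grad_ham_lin t z p k 0)) (at z)"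
proof -
  have b': "((\<lambda>z. Db t z i) has_derivative D2b t z i) (at z)" for i
    using lipschitz_second_derivative.second_has_derivative[OF b_smooth[OF t]] by (simp add: Db_def D2b_def [abs_def])
  have f': "((\<lambda>z. Df t z i) has_derivative D2f t z i) (at z)" for i
    using lipschitz_second_derivative.second_has_derivative[OF f_smooth[OF t]] by (simp add: Df_def D2f_def [abs_def])
  have "((\<lambda>z. grad_ham t z p) has_derivative (\<lambda>k. \<Sum>i\<in>Basis. (p \<bullet> D2b t z i k + D2f t z i k) *\<^sub>R i)) (at z)"
    unfolding grad_ham_def riesz_def
    by (intro has_derivative_sum has_derivative_scaleR_left has_derivative_add has_derivative_inner_right b' f')
  then show ?thesis
    by (simp add: grad_ham_lin_def riesz_def)
qed

lemma ham_second_eq: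
  assumes t: "t \<in> {0..T}"
  shows "ham_xx b f t x u p *v y = fst (grad_ham_lin t (x, u) p (y, 0) 0)"
    and "ham_xu b f t x u p *v v = fst (grad_ham_lin t (x, u) p (0, v) 0)"
    and "ham_uu b f t x u p *v v = snd (grad_ham_lin t (x, u) p (0, v) 0)"
proof -
  note d = grad_ham_has_derivative[OF t, of p "(x, u)"]
  show "ham_xx b f t x u p *v y = fst (grad_ham_lin t (x, u) p (y, 0) 0)"
    unfolding ham_xx_def ham_x_u_eq[OF t]
    by (rule jacobian_mult[OF has_derivative_fst[OF has_derivative_partial_fst[OF d]]])
  show "ham_xu b f t x u p *v v = fst (grad_ham_lin t (x, u) p (0, v) 0)"
    unfolding ham_xu_def ham_x_u_eq[OF t]
    by (rule jacobian_mult[OF has_derivative_fst[OF has_derivative_partial_snd[OF d]]])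
  show "ham_uu b f t x u p *v v = snd (grad_ham_lin t (x, u) p (0, v) 0)"
    unfolding ham_uu_def ham_x_u_eq[OF t]
    by (rule jacobian_mult[OF has_derivative_snd[OF has_derivative_partial_snd[OF d]]])
qed

lemma grad_ham_lin_symmetric:
  assumes t: "t \<in> {0..T}"
  shows "grad_ham_lin t z p k 0 \<bullet> h = grad_ham_lin t z p h 0 \<bullet> k"
proof -
  have "D2b t z h k = D2b t z k h" "D2f t z h k = D2f t z k h"
    using lipschitz_second_derivative.second_symmetric[OF b_smooth[OF t]]
      lipschitz_second_derivative.second_symmetric[OF f_smooth[OF t]]
    by (simp_all add: D2b_def D2f_def)
  then show ?thesis
    by (simp add: inner_grad_ham_lin[OF t])
qed

text \<open>The transpose moves the matrix to the other argument, and symmetry of the second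
  derivative turns the result into the control component of the linearization.\<close>

lemma ham_ux_eq:
  assumes t: "t \<in> {0..T}"
  shows "ham_ux b f t x u p *v y = snd (grad_ham_lin t (x, u) p (y, 0) 0)"
proof (rule vector_eq_rdot[THEN iffD1], rule allI)
  fix w
  have "(ham_ux b f t x u p *v y) \<bullet> w = y \<bullet> fst (grad_ham_lin t (x, u) p (0, w) 0)"
    unfolding ham_ux_def inner_transpose_mult ham_second_eq[OF t] ..
  also have "\<dots> = grad_ham_lin t (x, u) p (0, w) 0 \<bullet> (y, 0)"
    by (simp add: inner_prod_def inner_commute)
  also have "\<dots> = grad_ham_lin t (x, u) p (y, 0) 0 \<bullet> (0, w)"
    by (rule grad_ham_lin_symmetric[OF t])
  finally show "(ham_ux b f t x u p *v y) \<bullet> w = snd (grad_ham_lin t (x, u) p (y, 0) 0) \<bullet> w"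
    by (simp add: inner_prod_def)
qed

lemma grad_ham_lin_split:
  assumes t: "t \<in> {0..T}"
  shows "grad_ham_lin t z p (y, v) \<psi> = grad_ham_lin t z p (y, 0) 0 + grad_ham_lin t z p (0, v) 0 + grad_ham_lin t z p 0 \<psi>"
proof -
  have "grad_ham_lin t z p (y, v) \<psi> = grad_ham_lin t z p ((y, 0) + 1 *\<^sub>R (0, v)) (0 + 1 *\<^sub>R \<psi>)"
    by simp
  also have "\<dots> = grad_ham_lin t z p (y, 0) 0 + grad_ham_lin t z p ((0, v) + 1 *\<^sub>R 0) (0 + 1 *\<^sub>R \<psi>)"
    unfolding grad_ham_lin_linear[OF t, of z p "(y, 0)" 1] by simp
  also have "grad_ham_lin t z p ((0, v) + 1 *\<^sub>R 0) (0 + 1 *\<^sub>R \<psi>) = grad_ham_lin t z p (0, v) 0 + grad_ham_lin t z p 0 \<psi>"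
    unfolding grad_ham_lin_linear[OF t] by simp
  finally show ?thesis by (simp add: add.assoc)
qed

text \<open>With \<open>k = 0\<close> the second derivatives drop out, and only the first derivative
  of \<open>b\<close> paired with \<psi> remains.\<close>

lemma grad_ham_lin_adjoint:
  assumes t: "t \<in> {0..T}"
  shows "fst (grad_ham_lin t (x, u) p 0 \<psi>) = transpose (jac_x b t x u) *v \<psi>"
    and "snd (grad_ham_lin t (x, u) p 0 \<psi>) = transpose (jac_u b t x u) *v \<psi>"
proof -
  have *: "grad_ham_lin t (x, u) p 0 \<psi> \<bullet> h = \<psi> \<bullet> Db t (x, u) h" for h
    using linear_0[OF linear_D2b(2)[OF t]] linear_0[OF linear_D2f(2)[OF t]] by (simp add: inner_grad_ham_lin[OF t])
  show "fst (grad_ham_lin t (x, u) p 0 \<psi>) = transpose (jac_x b t x u) *v \<psi>"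
  proof (rule vector_eq_rdot[THEN iffD1], rule allI)
    fix h show "fst (grad_ham_lin t (x, u) p 0 \<psi>) \<bullet> h = (transpose (jac_x b t x u) *v \<psi>) \<bullet> h"
      using *[of "(h, 0)"] unfolding inner_transpose_mult jac_eq[OF t] by (simp add: inner_prod_def)
  qed
  show "snd (grad_ham_lin t (x, u) p 0 \<psi>) = transpose (jac_u b t x u) *v \<psi>"
  proof (rule vector_eq_rdot[THEN iffD1], rule allI)
    fix h show "snd (grad_ham_lin t (x, u) p 0 \<psi>) \<bullet> h = (transpose (jac_u b t x u) *v \<psi>) \<bullet> h"
      using *[of "(0, h)"] unfolding inner_transpose_mult jac_eq[OF t] by (simp add: inner_prod_def)
  qed
qed

lemma grad_ham_lin_eq:
  assumes t: "t \<in> {0..T}"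
  shows "fst (grad_ham_lin t (x, u) p (y, v) \<psi>)
      = transpose (jac_x b t x u) *v \<psi> + ham_xx b f t x u p *v y + ham_xu b f t x u p *v v"
    and "snd (grad_ham_lin t (x, u) p (y, v) \<psi>)
      = ham_ux b f t x u p *v y + ham_uu b f t x u p *v v + transpose (jac_u b t x u) *v \<psi>"
  unfolding ham_second_eq[OF t] ham_ux_eq[OF t] grad_ham_lin_adjoint[OF t, symmetric, where p=p]
    grad_ham_lin_split[OF t, of "(x, u)" p y v \<psi>]
  by (simp_all add: algebra_simps)

lemma gradient_g_eq: "gradient g x = grad_g x"
proof -
  have "gradient g x = riesz (frechet_derivative g (at x))"
    by (rule gradient_eq_riesz[OF lipschitz_second_derivative.first_has_derivative[OF g_smooth]])
  also have "frechet_derivative g (at x) = Dg x"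
    by (simp add: Dg_def [abs_def])
  finally show ?thesis by (simp only: grad_g_def)
qed

lemma hessian_g_eq: "hessian g x *v k = hess_g x k"
  unfolding hessian_def hess_g_def D2g_def
  by (rule jacobian_mult[OF has_derivative_gradient[OF lipschitz_second_derivative.twice_diff[OF g_smooth]]])

lemma is_state_iff: "is_state T b x0 u x \<longleftrightarrow> state_of u x"
  by (simp add: is_state_def state_of_def)

lemma is_adjoint_imp: "is_adjoint T b f g u x p \<Longrightarrow> adjoint_of u x p"
  unfolding is_adjoint_def adjoint_of_def gradient_g_eq
  by (elim conjE, rule conjI, erule solves_ode_ae_cong) (simp_all add: fst_grad_ham)

lemma is_state_variation_imp: "is_state_variation T b u x v y \<Longrightarrow> state_var_of u x v y"
  unfolding is_state_variation_def state_var_of_def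
proof (elim conjE, rule conjI, erule solves_ode_ae_cong)
  fix t assume t: "t \<in> {0..T}"
  show "jac_x b t (x t) (u t) *v y t + jac_u b t (x t) (u t) *v v t = Db t (x t, u t) (y t, v t)"
    unfolding jac_eq[OF t] linear_pair_split[OF linear_Db[OF t], of _ "y t" "v t"] ..
qed

lemma is_adjoint_variation_imp: "is_adjoint_variation T b f g u x p v y \<psi> \<Longrightarrow> adjoint_var_of u x p v y \<psi>"
  unfolding is_adjoint_variation_def adjoint_var_of_def hessian_g_eq
  by (elim conjE, rule conjI, erule solves_ode_ae_cong) (simp_all add: grad_ham_lin_eq)

text \<open>Both selections of a state apply Hilbert choice to the same predicate, so the selected
  functions themselves coincide.\<close>

lemma cost_eq: "cost T b f g x0 = cost_of"
  by (rule ext) (simp add: cost_def cost_of_def state_def the_state_def is_state_iff)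

end

theorem theorem3p6:
  fixes T :: real
    and b :: "real \<Rightarrow> real^'n \<Rightarrow> real^'m \<Rightarrow> real^'n"
    and f :: "real \<Rightarrow> real^'n \<Rightarrow> real^'m \<Rightarrow> real"
    and g :: "real^'n \<Rightarrow> real"
    and x0 :: "real^'n"
    and u v :: "real \<Rightarrow> real^'m"
    and x p y \<psi> :: "real \<Rightarrow> real^'n"
  assumes T_pos: "T > 0"
    and standing: "standing_assms T b f g"
    and u_L2: "u \<in> Lspace T 2"
    and state: "is_state T b x0 u x"
    and adjoint: "is_adjoint T b f g u x p"
    and v_L2: "v \<in> Lspace T 2"
    and state_var: "is_state_variation T b u x v y"
    and adjoint_var: "is_adjoint_variation T b f g u x p v y \<psi>"
  shows
    "(twice_gateaux_differentiable T (cost T b f g x0) \<and>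
     bounded_operator T 2 (second_derivative T (cost T b f g x0) u) \<and>
     (AE t in lebesgue_on {0..T}.
        second_derivative T (cost T b f g x0) u v t =
          ham_ux b f t (x t) (u t) (p t) *v y t
          + ham_uu b f t (x t) (u t) (p t) *v v t
          + transpose (jac_u b t (x t) (u t)) *v \<psi> t)) \<and>
     (\<forall>w\<in>Lspace T 2. \<forall>y\<^sub>w. is_state_variation T b u x w y\<^sub>w \<longrightarrow>
       L2_inner T (second_derivative T (cost T b f g x0) u v) w =
         (LINT t|lebesgue_on {0..T}.
            y\<^sub>w t \<bullet> (ham_xx b f t (x t) (u t) (p t) *v y t + ham_xu b f t (x t) (u t) (p t) *v v t)
            + w t \<bullet> (ham_ux b f t (x t) (u t) (p t) *v y t + ham_uu b f t (x t) (u t) (p t) *v v t))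
         + y\<^sub>w T \<bullet> (hessian g (x T) *v y T)) \<and>
     (\<forall>\<beta>::ennreal. \<beta> \<ge> 2 \<and> u \<in> Lspace T \<beta> \<longrightarrow>
       bounded_operator T \<beta> (second_derivative T (cost T b f g x0) u))"
proof -
  obtain C where "control_problem T C (\<lambda>t z. b t (fst z) (snd z)) (\<lambda>t z. f t (fst z) (snd z)) g"
    by (rule standing_assms_imp_control_problem[OF T_pos standing])
  \<comment> \<open>No locale assumption mentions the initial value, so \<open>x0\<close> is
    supplied at interpretation.\<close>
  then interpret cart_control_problem T C b f g x0
    by (simp add: cart_control_problem_def)
  have x: "state_of u x" and p: "adjoint_of u x p" and y: "state_var_of u x v y"
    and \<psi>: "adjoint_var_of u x p v y \<psi>"
    using state adjoint state_var adjoint_var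
    by (auto simp: is_state_iff intro: is_adjoint_imp is_state_variation_imp is_adjoint_variation_imp)
  have formula: "AE t in lebesgue_on {0..T}. second_derivative T cost_of u v t =
      ham_ux b f t (x t) (u t) (p t) *v y t + ham_uu b f t (x t) (u t) (p t) *v v t
      + transpose (jac_u b t (x t) (u t)) *v \<psi> t"
  proof -
    have "AE t in lebesgue_on {0..T}. hessian_of u v t =
        ham_ux b f t (x t) (u t) (p t) *v y t + ham_uu b f t (x t) (u t) (p t) *v v t
        + transpose (jac_u b t (x t) (u t)) *v \<psi> t"
      by (rule AE_lebesgue_onI) (simp only: hessian_of_eq[OF u_L2 v_L2 x p y \<psi>] grad_ham_lin_eq)
    then show ?thesis
      using second_derivative_AE(2)[OF u_L2 v_L2] by eventually_elim simp
  qed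
  have bilinear: "L2_inner T (second_derivative T cost_of u v) w =
      (LINT t|lebesgue_on {0..T}.
        y' t \<bullet> (ham_xx b f t (x t) (u t) (p t) *v y t + ham_xu b f t (x t) (u t) (p t) *v v t)
        + w t \<bullet> (ham_ux b f t (x t) (u t) (p t) *v y t + ham_uu b f t (x t) (u t) (p t) *v v t))
      + y' T \<bullet> (hessian g (x T) *v y T)"
    if w: "w \<in> Lspace T 2" and y': "is_state_variation T b u x w y'" for w y'
  proof -
    have "(LINT t|lebesgue_on {0..T}. grad_ham_lin t (x t, u t) (p t) (y t, v t) 0 \<bullet> (y' t, w t))
      = (LINT t|lebesgue_on {0..T}.
        y' t \<bullet> (ham_xx b f t (x t) (u t) (p t) *v y t + ham_xu b f t (x t) (u t) (p t) *v v t)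
        + w t \<bullet> (ham_ux b f t (x t) (u t) (p t) *v y t + ham_uu b f t (x t) (u t) (p t) *v v t))"
      \<comment> \<open>For \<psi> = 0 the component formulas lose their transposed Jacobians, and
        the four blocks of the Hamiltonian's second derivative remain.\<close>
      by (rule Bochner_Integration.integral_cong)
        (auto simp: inner_prod_def grad_ham_lin_eq matrix_vector_mult_0_right inner_commute)
    then show ?thesis
      using second_derivative_inner[OF u_L2 v_L2 w x p y \<psi> is_state_variation_imp[OF y']]
      by (simp add: hessian_g_eq inner_commute)
  qed
  show ?thesis
    unfolding cost_eq
    using cost_twice_gateaux_differentiable second_derivative_bounded_operator[OF u_L2] formula bilinear
    by (intro conjI allI ballI impI) auto
qed

end
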